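(* Let $T$ be a consistent ML-theory, where $T_\beta$ is equipped with a definable topology as described in the context, and let $(\mathcal{B},\mathcal{A})\models T$ be $\kappa$-saturated with $\kappa>|T^2|$. Then every open subset of $B^m$ (any $m$) that is definable with parameters in $(\mathcal{B},\mathcal{A})$ is definable (possibly with additional parameters) in $\mathcal{B}$.
   Context: Definable topology: there are $n>0$ and an $\mathcal{L}_\beta$-formula $\tau(x,\vec y)$, $|\vec y|=n$, such that in every $\mathcal{B}\models T_\beta$ the sets $\tau(\mathcal{B},\vec d)$, $\vec d\in B^n$, form a basis of a topology on $B$; $B^m$ carries the product topology. For $\vec d=(\vec d_1,\dots,\vec d_m)\in B^{n\times m}$ let $U_{\vec d}=\{(x_1,\dots,x_m):x_i\in\tau(\mathcal{B},\vec d_i)\ \forall i\}$. It is assumed that each $\tau(\mathcal{B},\vec d)$ is empty or infinite, and that for every open $V\subseteq B^m$ and every $\vec x\in V$ the set $\{\vec d\in B^{n\times m}:\vec x\in U_{\vec d}\subseteq V\}$ has nonempty interior in $B^{n\times m}$. Setup. $T_\beta$ is a consistent $\mathcal{L}_\beta$-theory that is geometric: it eliminates $\exists^\infty$ and in every model $\operatorname{acl}$ is a pregeometry. $\mathcal{L}_\alpha$ is a language all of whose function symbols (constants counted as 0-ary functions) belong to $\mathcal{L}_\beta$, and $T_\alpha$ is a consistent $\mathcal{L}_\alpha$-theory. Put $\mathcal{L}=\mathcal{L}_\alpha\cap\mathcal{L}_\beta$ and $\mathcal{L}^2=\mathcal{L}_\beta\cup\mathcal{L}_\alpha\cup\{A\}$,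 $A$ a new unary predicate. For an $\mathcal{L}_\alpha$-formula $\theta$, $\theta_A$ is $\theta$ with all quantifiers relativized to $A$. $T^2$ is the $\mathcal{L}^2$-theory consisting of $T_\beta$, all $\phi_A$ with $T_\alpha\models\phi$, sentences saying $A$ is closed under each function symbol of $\mathcal{L}_\alpha$, and for each relation symbol $R\in\mathcal{L}_\alpha\setminus\mathcal{L}_\beta$ a sentence saying $R$ holds only of tuples from $A$. A model of $T^2$ is written $(\mathcal{B},\mathcal{A})$ with $\mathcal{B}$ its $\mathcal{L}_\beta$-reduct (universe $B$) and $\mathcal{A}$ the induced $\mathcal{L}_\alpha$-structure on $A$. $|T^2|=|\mathcal{L}^2|$ if infinite, else $\aleph_0$. $\operatorname{acl}$ is algebraic closure in $\mathcal{B}$. For $X,Y,Z\subseteq B$, $X\downarrow_Z Y$ means every subset of $X$ that is $\operatorname{acl}$-independent over $Z$ is $\operatorname{acl}$-independent over $Y\cup Z$. For a tuple $\vec c$ from $B$, $\vec c_\alpha$ is the subtuple of entries lying in $A$; for a variable tuple $\vec x$, $\vec x_\alpha$ is a designated subtuple. For an $\mathcal{L}_\alpha$-type $p$, $p_A=\{\psi_A:\psi\in p\}$. A Mordell-Lang challenge for $T\supseteq T^2$ is $(p(\vec x_\alpha),q(\vec x),\phi(\vec x,y),\psi(\vec x_\alpha,y))$ with $p$ a complete $\mathcal{L}_\alpha$-type, $q$ a complete $\mathcal{L}_\beta$-type, $\phi$ an $\mathcal{L}_\beta$-formula, $\psi$ an $\mathcal{L}_\alpha$-formula, and $q\models\exists^{<\infty}y\,\phi(\vec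 x,y)$. A contender is $((\mathcal{B},\mathcal{A}),\vec c)$ with $(\mathcal{B},\mathcal{A})\models T$, $\vec c$ realizing $q$, $\vec c_\alpha$ realizing $p_A$, and $\vec c\downarrow_{\vec c_\alpha}A$; a solution is a contender plus $a\in A$ with $(\mathcal{B},\mathcal{A})\models\phi(\vec c,a)\wedge\psi_A(\vec c_\alpha,a)$. $T$ satisfies the Mordell-Lang condition if for every challenge having some solution and every contender $((\mathcal{B},\mathcal{A}),\vec c)$ there is $a\in A$ with $((\mathcal{B},\mathcal{A}),\vec c,a)$ a solution. Density/codensity conditions: for every $\kappa$-saturated $(\mathcal{B},\mathcal{A})\models T$ with $\kappa>|T^2|$, every $C\subseteq B$ with $|C|<\kappa$ and every non-algebraic unary $\mathcal{L}_\beta(C)$-type $q(x)$: (Density) if $p(x)$ is a unary $\mathcal{L}_\alpha(A\cap C)$-type such that $q$ implies all quantifier-free $\mathcal{L}$-formulas in $p$, then some $a\in A$ realizes $p_A\cup q$; (Codensity) some $b\in B\setminus\operatorname{acl}(A\cup C)$ realizes $q$. An ML-theory is an $\mathcal{L}^2$-theory $T\supseteq T^2$ satisfying the Mordell-Lang condition and the density and codensity conditions. *)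

theory Defs
  imports "HOL-Analysis.Analysis"
begin

unbundle cardinal_syntax

section \<open>First-order logic\<close>

text \<open>A symbol carries its arity; constants are 0-ary function symbols. The arity of an occurrence
  in a term or formula is the length of its argument list.\<close>

datatype ('f, 'r) symb = FSym 'f nat | RSym 'r nat

type_synonym ('f, 'r) lang = "('f, 'r) symb set"

datatype 'f tm = Var nat | Fn 'f "'f tm list"

datatype ('f, 'r) fm =
    Falsum
  | Eq "'f tm" "'f tm"
  | Rel 'r "'f tm list"
  | Imp "('f, 'r) fm" "('f, 'r) fm"
  | Forall nat "('f, 'r) fm"

definition Neg :: "('f, 'r) fm \<Rightarrow> ('f, 'r) fm" where
  "Neg \<phi> = Imp \<phi> Falsum"

definition Conj :: "('f, 'r) fm \<Rightarrow> ('f, 'r) fm \<Rightarrow> ('f, 'r) fm" where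
  "Conj \<phi> \<psi> = Neg (Imp \<phi> (Neg \<psi>))"

primrec tm_symbs :: "'f tm \<Rightarrow> ('f, 'r) symb set" where
  "tm_symbs (Var x) = {}"
| "tm_symbs (Fn f ts) = insert (FSym f (length ts)) (\<Union>(set (map tm_symbs ts)))"

primrec symbs :: "('f, 'r) fm \<Rightarrow> ('f, 'r) symb set" where
  "symbs Falsum = {}"
| "symbs (Eq s t) = tm_symbs s \<union> tm_symbs t"
| "symbs (Rel r ts) = insert (RSym r (length ts)) (\<Union>t\<in>set ts. tm_symbs t)"
| "symbs (Imp \<phi> \<psi>) = symbs \<phi> \<union> symbs \<psi>"
| "symbs (Forall x \<phi>) = symbs \<phi>"

primrec tm_vars :: "'f tm \<Rightarrow> nat set" where
  "tm_vars (Var x) = {x}"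
| "tm_vars (Fn f ts) = \<Union>(set (map tm_vars ts))"

primrec fv :: "('f, 'r) fm \<Rightarrow> nat set" where
  "fv Falsum = {}"
| "fv (Eq s t) = tm_vars s \<union> tm_vars t"
| "fv (Rel r ts) = (\<Union>t\<in>set ts. tm_vars t)"
| "fv (Imp \<phi> \<psi>) = fv \<phi> \<union> fv \<psi>"
| "fv (Forall x \<phi>) = fv \<phi> - {x}"

primrec quantifier_free :: "('f, 'r) fm \<Rightarrow> bool" where
  "quantifier_free Falsum = True"
| "quantifier_free (Eq s t) = True"
| "quantifier_free (Rel r ts) = True"
| "quantifier_free (Imp \<phi> \<psi>) = (quantifier_free \<phi> \<and> quantifier_free \<psi>)"
| "quantifier_free (Forall x \<phi>) = False"

definition formulas :: "('f, 'r) lang \<Rightarrow> ('f, 'r) fm set" where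
  "formulas L = {\<phi>. symbs \<phi> \<subseteq> L}"

definition sentences :: "('f, 'r) lang \<Rightarrow> ('f, 'r) fm set" where
  "sentences L = {\<phi> \<in> formulas L. fv \<phi> = {}}"

text \<open>One structure interprets all symbols; its \<open>L\<close>-reduct is the same object viewed through
  \<open>L\<close>-formulas only.\<close>

record ('f, 'r, 'b) struct =
  univ :: "'b set"
  fint :: "'f \<Rightarrow> 'b list \<Rightarrow> 'b"
  rint :: "'r \<Rightarrow> 'b list \<Rightarrow> bool"

primrec eval_tm :: "('f, 'r, 'b) struct \<Rightarrow> (nat \<Rightarrow> 'b) \<Rightarrow> 'f tm \<Rightarrow> 'b" where
  "eval_tm M e (Var x) = e x"
| "eval_tm M e (Fn f ts) = fint M f (map (eval_tm M e) ts)"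

primrec sat :: "('f, 'r, 'b) struct \<Rightarrow> (nat \<Rightarrow> 'b) \<Rightarrow> ('f, 'r) fm \<Rightarrow> bool" where
  "sat M e Falsum = False"
| "sat M e (Eq s t) = (eval_tm M e s = eval_tm M e t)"
| "sat M e (Rel r ts) = rint M r (map (eval_tm M e) ts)"
| "sat M e (Imp \<phi> \<psi>) = (sat M e \<phi> \<longrightarrow> sat M e \<psi>)"
| "sat M e (Forall x \<phi>) = (\<forall>a\<in>univ M. sat M (e(x := a)) \<phi>)"

definition is_struct :: "('f, 'r) lang \<Rightarrow> ('f, 'r, 'b) struct \<Rightarrow> bool" where
  "is_struct L M \<longleftrightarrow> univ M \<noteq> {} \<and>
     (\<forall>f k. FSym f k \<in> L \<longrightarrow>
        (\<forall>as. length as = k \<and> set as \<subseteq> univ M \<longrightarrow> fint M f as \<in> univ M))"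

definition models :: "('f, 'r) lang \<Rightarrow> ('f, 'r, 'b) struct \<Rightarrow> ('f, 'r) fm set \<Rightarrow> bool" where
  "models L M T \<longleftrightarrow> is_struct L M \<and> (\<forall>\<phi>\<in>T. \<forall>e. sat M e \<phi>)"

text \<open>Consistency and consequence are tested on structures whose elements are formulas. By
  downward Loewenheim-Skolem every \<open>L\<close>-structure has an elementary substructure of size at most
  \<open>|L| + \<aleph>\<^sub>0\<close>, which is isomorphic to one of these, so nothing is lost.\<close>

definition consistent :: "('f, 'r) lang \<Rightarrow> ('f, 'r) fm set \<Rightarrow> bool" where
  "consistent L T \<longleftrightarrow> (\<exists>M :: ('f, 'r, ('f, 'r) fm) struct. models L M T)"

definition entails :: "('f, 'r) lang \<Rightarrow> ('f, 'r) fm set \<Rightarrow> ('f, 'r) fm \<Rightarrow> bool" where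
  "entails L T \<phi> \<longleftrightarrow>
     (\<forall>M :: ('f, 'r, ('f, 'r) fm) struct. models L M T \<longrightarrow> (\<forall>e. sat M e \<phi>))"

text \<open>\<open>max |L| \<aleph>\<^sub>0\<close>.\<close>

definition lang_card :: "('f, 'r) lang \<Rightarrow> (('f, 'r) symb + nat) rel" where
  "lang_card L = |L| +c natLeq"


section \<open>Types, saturation and definable sets\<close>

text \<open>A pair \<open>(\<phi>, e)\<close> stands for the formula with parameters obtained from \<open>\<phi>\<close> by keeping
  variable 0 as the object variable and replacing every other free variable \<open>v\<close> by the
  element \<open>e v\<close>.\<close>

type_synonym ('f, 'r, 'b) pfm = "('f, 'r) fm \<times> (nat \<Rightarrow> 'b)"

definition pformulas :: "('f, 'r) lang \<Rightarrow> 'b set \<Rightarrow> ('f, 'r, 'b) pfm set" where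
  "pformulas L C = {(\<phi>, e). \<phi> \<in> formulas L \<and> e ` (fv \<phi> - {0}) \<subseteq> C}"

definition psat :: "('f, 'r, 'b) struct \<Rightarrow> 'b \<Rightarrow> ('f, 'r, 'b) pfm \<Rightarrow> bool" where
  "psat M b = (\<lambda>(\<phi>, e). sat M (e(0 := b)) \<phi>)"

definition prealizes :: "('f, 'r, 'b) struct \<Rightarrow> 'b \<Rightarrow> ('f, 'r, 'b) pfm set \<Rightarrow> bool" where
  "prealizes M b p \<longleftrightarrow> (\<forall>\<theta>\<in>p. psat M b \<theta>)"

definition psolutions :: "('f, 'r, 'b) struct \<Rightarrow> ('f, 'r, 'b) pfm \<Rightarrow> 'b set" where
  "psolutions M \<theta> = {b \<in> univ M. psat M b \<theta>}"

definition unary_type ::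
  "('f, 'r) lang \<Rightarrow> ('f, 'r, 'b) struct \<Rightarrow> 'b set \<Rightarrow> ('f, 'r, 'b) pfm set \<Rightarrow> bool" where
  "unary_type L M C p \<longleftrightarrow>
     p \<subseteq> pformulas L C \<and>
     (\<forall>\<phi> e. (\<phi>, e) \<in> pformulas L C \<longrightarrow> (\<phi>, e) \<in> p \<or> (Neg \<phi>, e) \<in> p) \<and>
     (\<forall>p0 \<subseteq> p. finite p0 \<longrightarrow> (\<exists>b\<in>univ M. prealizes M b p0))"

definition nonalgebraic :: "('f, 'r, 'b) struct \<Rightarrow> ('f, 'r, 'b) pfm set \<Rightarrow> bool" where
  "nonalgebraic M p \<longleftrightarrow> (\<forall>\<theta>\<in>p. infinite (psolutions M \<theta>))"

definition type_implies ::
  "('f, 'r, 'b) struct \<Rightarrow> ('f, 'r, 'b) pfm set \<Rightarrow> ('f, 'r, 'b) pfm \<Rightarrow> bool" where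
  "type_implies M q \<theta> \<longleftrightarrow>
     (\<exists>q0 \<subseteq> q. finite q0 \<and> (\<forall>b\<in>univ M. prealizes M b q0 \<longrightarrow> psat M b \<theta>))"

definition saturated :: "'k rel \<Rightarrow> ('f, 'r) lang \<Rightarrow> ('f, 'r, 'b) struct \<Rightarrow> bool" where
  "saturated \<kappa> L M \<longleftrightarrow>
     (\<forall>C \<subseteq> univ M. |C| <o \<kappa> \<longrightarrow>
        (\<forall>p. unary_type L M C p \<longrightarrow> (\<exists>b\<in>univ M. prealizes M b p)))"

text \<open>Complete parameter-free types of a theory in the variables \<open>X\<close>.\<close>

definition realizes :: "('f, 'r, 'b) struct \<Rightarrow> (nat \<Rightarrow> 'b) \<Rightarrow> ('f, 'r) fm set \<Rightarrow> bool" where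
  "realizes M c p \<longleftrightarrow> (\<forall>\<phi>\<in>p. sat M c \<phi>)"

definition complete_type ::
  "'b itself \<Rightarrow> ('f, 'r) lang \<Rightarrow> ('f, 'r) fm set \<Rightarrow> nat set \<Rightarrow> ('f, 'r) fm set \<Rightarrow> bool" where
  "complete_type U L T X p \<longleftrightarrow>
     p \<subseteq> {\<phi> \<in> formulas L. fv \<phi> \<subseteq> X} \<and>
     (\<forall>\<phi>\<in>formulas L. fv \<phi> \<subseteq> X \<longrightarrow> \<phi> \<in> p \<or> Neg \<phi> \<in> p) \<and>
     (\<exists>(M :: ('f, 'r, 'b) struct) c. models L M T \<and> c ` X \<subseteq> univ M \<and> realizes M c p)"

text \<open>The power \<open>B\<^sup>m\<close> is \<open>{..<m} \<rightarrow>\<^sub>E B\<close>; the parameters are the values of \<open>e\<close> at the finitely many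
  free variables \<open>\<ge> m\<close>.\<close>

definition definable_set ::
  "('f, 'r) lang \<Rightarrow> ('f, 'r, 'b) struct \<Rightarrow> nat \<Rightarrow> (nat \<Rightarrow> 'b) set \<Rightarrow> bool" where
  "definable_set L M m V \<longleftrightarrow>
     (\<exists>\<phi>\<in>formulas L. \<exists>e. range e \<subseteq> univ M \<and>
        V = {x \<in> {..<m} \<rightarrow>\<^sub>E univ M. sat M (\<lambda>i. if i < m then x i else e i) \<phi>})"


section \<open>Geometric theories\<close>

text \<open>HOL cannot quantify over structures of all types at once: in the predicates below that take
  a type token, "every model" means every model whose universe is a set of elements of that
  type.\<close>

definition acl :: "('f, 'r) lang \<Rightarrow> ('f, 'r, 'b) struct \<Rightarrow> 'b set \<Rightarrow> 'b set" where
  "acl L M C = {b \<in> univ M. \<exists>\<theta>\<in>pformulas L C. psat M b \<theta> \<and> finite (psolutions M \<theta>)}"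

definition pregeometry :: "'b set \<Rightarrow> ('b set \<Rightarrow> 'b set) \<Rightarrow> bool" where
  "pregeometry B cl \<longleftrightarrow>
     (\<forall>X \<subseteq> B. X \<subseteq> cl X \<and> cl X \<subseteq> B) \<and>
     (\<forall>X Y. X \<subseteq> Y \<and> Y \<subseteq> B \<longrightarrow> cl X \<subseteq> cl Y) \<and>
     (\<forall>X \<subseteq> B. cl (cl X) = cl X) \<and>
     (\<forall>X \<subseteq> B. \<forall>a\<in>cl X. \<exists>X0 \<subseteq> X. finite X0 \<and> a \<in> cl X0) \<and>
     (\<forall>X \<subseteq> B. \<forall>a\<in>B. \<forall>b\<in>B. a \<in> cl (insert b X) \<and> a \<notin> cl X \<longrightarrow> b \<in> cl (insert a X))"

definition eliminates_exists_inf ::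
  "'b itself \<Rightarrow> ('f, 'r) lang \<Rightarrow> ('f, 'r) fm set \<Rightarrow> bool" where
  "eliminates_exists_inf U L T \<longleftrightarrow>
     (\<forall>\<phi>\<in>formulas L. \<forall>x. \<exists>\<psi>\<in>formulas L. fv \<psi> \<subseteq> fv \<phi> - {x} \<and>
        (\<forall>(M :: ('f, 'r, 'b) struct) e. models L M T \<and> range e \<subseteq> univ M \<longrightarrow>
           (infinite {a \<in> univ M. sat M (e(x := a)) \<phi>} \<longleftrightarrow> sat M e \<psi>)))"

definition geometric :: "'b itself \<Rightarrow> ('f, 'r) lang \<Rightarrow> ('f, 'r) fm set \<Rightarrow> bool" where
  "geometric U L T \<longleftrightarrow> eliminates_exists_inf U L T \<and>
     (\<forall>M :: ('f, 'r, 'b) struct. models L M T \<longrightarrow> pregeometry (univ M) (acl L M))"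

definition indep_over ::
  "('f, 'r) lang \<Rightarrow> ('f, 'r, 'b) struct \<Rightarrow> 'b set \<Rightarrow> 'b set \<Rightarrow> bool" where
  "indep_over L M X Z \<longleftrightarrow> (\<forall>x\<in>X. x \<notin> acl L M (Z \<union> (X - {x})))"

definition free_over ::
  "('f, 'r) lang \<Rightarrow> ('f, 'r, 'b) struct \<Rightarrow> 'b set \<Rightarrow> 'b set \<Rightarrow> 'b set \<Rightarrow> bool" where
  "free_over L M X Z Y \<longleftrightarrow>
     (\<forall>X' \<subseteq> X. indep_over L M X' Z \<longrightarrow> indep_over L M X' (Y \<union> Z))"


section \<open>Definable topologies\<close>

text \<open>In \<open>\<tau>(x, y)\<close> the object variable is 0 and the parameter tuple \<open>y\<close> occupies the
  variables \<open>1, \<dots>, n\<close>.\<close>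

definition tau_set :: "('f, 'r, 'b) struct \<Rightarrow> ('f, 'r) fm \<Rightarrow> (nat \<Rightarrow> 'b) \<Rightarrow> 'b set" where
  "tau_set M \<tau> d = {b \<in> univ M. sat M (case_nat b d) \<tau>}"

definition tau_basis :: "('f, 'r, 'b) struct \<Rightarrow> nat \<Rightarrow> ('f, 'r) fm \<Rightarrow> 'b set set" where
  "tau_basis M n \<tau> = tau_set M \<tau> ` ({..<n} \<rightarrow>\<^sub>E univ M)"

definition tau_top :: "('f, 'r, 'b) struct \<Rightarrow> nat \<Rightarrow> ('f, 'r) fm \<Rightarrow> 'b topology" where
  "tau_top M n \<tau> = topology (arbitrary union_of (\<lambda>S. S \<in> tau_basis M n \<tau>))"

definition tau_box ::
  "('f, 'r, 'b) struct \<Rightarrow> ('f, 'r) fm \<Rightarrow> nat \<Rightarrow> (nat \<times> nat \<Rightarrow> 'b) \<Rightarrow> (nat \<Rightarrow> 'b) set" where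
  "tau_box M \<tau> m d = (\<Pi>\<^sub>E i\<in>{..<m}. tau_set M \<tau> (\<lambda>j. d (i, j)))"

definition definable_topology ::
  "'b itself \<Rightarrow> ('f, 'r) lang \<Rightarrow> ('f, 'r) fm set \<Rightarrow> nat \<Rightarrow> ('f, 'r) fm \<Rightarrow> bool" where
  "definable_topology U L T n \<tau> \<longleftrightarrow>
     0 < n \<and> \<tau> \<in> formulas L \<and> fv \<tau> \<subseteq> {..n} \<and>
     (\<forall>M :: ('f, 'r, 'b) struct. models L M T \<longrightarrow>
        istopology (arbitrary union_of (\<lambda>S. S \<in> tau_basis M n \<tau>)) \<and>
        \<Union>(tau_basis M n \<tau>) = univ M \<and>
        (\<forall>S\<in>tau_basis M n \<tau>. S = {} \<or> infinite S) \<and>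
        (\<forall>m V x. openin (product_topology (\<lambda>_. tau_top M n \<tau>) {..<m}) V \<and> x \<in> V \<longrightarrow>
           product_topology (\<lambda>_. tau_top M n \<tau>) ({..<m} \<times> {..<n}) interior_of
             {d \<in> {..<m} \<times> {..<n} \<rightarrow>\<^sub>E univ M. x \<in> tau_box M \<tau> m d \<and> tau_box M \<tau> m d \<subseteq> V}
           \<noteq> {}))"


section \<open>Pairs of theories\<close>

primrec relativize :: "'r \<Rightarrow> ('f, 'r) fm \<Rightarrow> ('f, 'r) fm" where
  "relativize A Falsum = Falsum"
| "relativize A (Eq s t) = Eq s t"
| "relativize A (Rel r ts) = Rel r ts"
| "relativize A (Imp \<phi> \<psi>) = Imp (relativize A \<phi>) (relativize A \<psi>)"
| "relativize A (Forall x \<phi>) = Forall x (Imp (Rel A [Var x]) (relativize A \<phi>))"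

definition A_part :: "'r \<Rightarrow> ('f, 'r, 'b) struct \<Rightarrow> 'b set" where
  "A_part A M = {a \<in> univ M. rint M A [a]}"

definition A_struct :: "'r \<Rightarrow> ('f, 'r, 'b) struct \<Rightarrow> ('f, 'r, 'b) struct" where
  "A_struct A M = M\<lparr>univ := A_part A M\<rparr>"

definition lang2 :: "'r \<Rightarrow> ('f, 'r) lang \<Rightarrow> ('f, 'r) lang \<Rightarrow> ('f, 'r) lang" where
  "lang2 A L\<alpha> L\<beta> = L\<beta> \<union> L\<alpha> \<union> {RSym A 1}"

definition Foralls :: "nat \<Rightarrow> ('f, 'r) fm \<Rightarrow> ('f, 'r) fm" where
  "Foralls k \<phi> = foldr Forall [0..<k] \<phi>"

definition all_in_A :: "'r \<Rightarrow> nat \<Rightarrow> ('f, 'r) fm" where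
  "all_in_A A k = foldr (\<lambda>i. Conj (Rel A [Var i])) [0..<k] (Neg Falsum)"

definition closed_sentence :: "'r \<Rightarrow> 'f \<Rightarrow> nat \<Rightarrow> ('f, 'r) fm" where
  "closed_sentence A f k =
     Foralls k (Imp (all_in_A A k) (Rel A [Fn f (map Var [0..<k])]))"

definition only_on_A_sentence :: "'r \<Rightarrow> 'r \<Rightarrow> nat \<Rightarrow> ('f, 'r) fm" where
  "only_on_A_sentence A R k = Foralls k (Imp (Rel R (map Var [0..<k])) (all_in_A A k))"

definition theory2 ::
  "'r \<Rightarrow> ('f, 'r) lang \<Rightarrow> ('f, 'r) lang \<Rightarrow> ('f, 'r) fm set \<Rightarrow> ('f, 'r) fm set \<Rightarrow> ('f, 'r) fm set" where
  "theory2 A L\<alpha> L\<beta> T\<alpha> T\<beta> =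
     T\<beta> \<union>
     {relativize A \<phi> |\<phi>. \<phi> \<in> sentences L\<alpha> \<and> entails L\<alpha> T\<alpha> \<phi>} \<union>
     {closed_sentence A f k |f k. FSym f k \<in> L\<alpha>} \<union>
     {only_on_A_sentence A R k |R k. RSym R k \<in> L\<alpha> - L\<beta>}"

definition pair_setting ::
  "'b itself \<Rightarrow> 'r \<Rightarrow> ('f, 'r) lang \<Rightarrow> ('f, 'r) lang \<Rightarrow> ('f, 'r) fm set \<Rightarrow> ('f, 'r) fm set \<Rightarrow> bool" where
  "pair_setting U A L\<alpha> L\<beta> T\<alpha> T\<beta> \<longleftrightarrow>
     T\<beta> \<subseteq> sentences L\<beta> \<and> consistent L\<beta> T\<beta> \<and> geometric U L\<beta> T\<beta> \<and>
     (\<forall>f k. FSym f k \<in> L\<alpha> \<longrightarrow> FSym f k \<in> L\<beta>) \<and>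
     T\<alpha> \<subseteq> sentences L\<alpha> \<and> consistent L\<alpha> T\<alpha> \<and>
     RSym A 1 \<notin> L\<alpha> \<union> L\<beta>"


section \<open>The Mordell-Lang, density and codensity conditions\<close>

text \<open>The tuple \<open>x\<close> consists of the variables \<open>{..<k}\<close>, its designated subtuple of those in
  \<open>I \<subseteq> {..<k}\<close>, and \<open>y\<close> is the variable \<open>k\<close>.\<close>

definition mordell_lang_challenge ::
  "'b itself \<Rightarrow> ('f, 'r) lang \<Rightarrow> ('f, 'r) lang \<Rightarrow> ('f, 'r) fm set \<Rightarrow> ('f, 'r) fm set \<Rightarrow>
   nat \<Rightarrow> nat set \<Rightarrow> ('f, 'r) fm set \<Rightarrow> ('f, 'r) fm set \<Rightarrow> ('f, 'r) fm \<Rightarrow> ('f, 'r) fm \<Rightarrow> bool" where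
  "mordell_lang_challenge U L\<alpha> L\<beta> T\<alpha> T\<beta> k I p q \<phi> \<psi> \<longleftrightarrow>
     I \<subseteq> {..<k} \<and>
     complete_type U L\<alpha> T\<alpha> I p \<and>
     complete_type U L\<beta> T\<beta> {..<k} q \<and>
     \<phi> \<in> formulas L\<beta> \<and> fv \<phi> \<subseteq> {..k} \<and>
     \<psi> \<in> formulas L\<alpha> \<and> fv \<psi> \<subseteq> insert k I \<and>
     (\<forall>(M :: ('f, 'r, 'b) struct) c.
        models L\<beta> M T\<beta> \<and> c ` {..<k} \<subseteq> univ M \<and> realizes M c q \<longrightarrow>
        finite {a \<in> univ M. sat M (c(k := a)) \<phi>})"

text \<open>The entries of \<open>c\<close> lying in \<open>A\<close> have to be exactly those at the designated positions.\<close>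

definition mordell_lang_contender ::
  "'r \<Rightarrow> ('f, 'r) lang \<Rightarrow> ('f, 'r) lang \<Rightarrow> ('f, 'r) fm set \<Rightarrow>
   nat \<Rightarrow> nat set \<Rightarrow> ('f, 'r) fm set \<Rightarrow> ('f, 'r) fm set \<Rightarrow>
   ('f, 'r, 'b) struct \<Rightarrow> (nat \<Rightarrow> 'b) \<Rightarrow> bool" where
  "mordell_lang_contender A L\<alpha> L\<beta> T k I p q M c \<longleftrightarrow>
     models (lang2 A L\<alpha> L\<beta>) M T \<and>
     c ` {..<k} \<subseteq> univ M \<and> {i \<in> {..<k}. c i \<in> A_part A M} = I \<and>
     realizes M c q \<and> realizes M c (relativize A ` p) \<and>
     free_over L\<beta> M (c ` {..<k}) (c ` I) (A_part A M)"

definition mordell_lang_solution ::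
  "'r \<Rightarrow> ('f, 'r) lang \<Rightarrow> ('f, 'r) lang \<Rightarrow> ('f, 'r) fm set \<Rightarrow>
   nat \<Rightarrow> nat set \<Rightarrow> ('f, 'r) fm set \<Rightarrow> ('f, 'r) fm set \<Rightarrow> ('f, 'r) fm \<Rightarrow> ('f, 'r) fm \<Rightarrow>
   ('f, 'r, 'b) struct \<Rightarrow> (nat \<Rightarrow> 'b) \<Rightarrow> 'b \<Rightarrow> bool" where
  "mordell_lang_solution A L\<alpha> L\<beta> T k I p q \<phi> \<psi> M c a \<longleftrightarrow>
     mordell_lang_contender A L\<alpha> L\<beta> T k I p q M c \<and> a \<in> A_part A M \<and>
     sat M (c(k := a)) (Conj \<phi> (relativize A \<psi>))"

definition mordell_lang_condition ::
  "'b itself \<Rightarrow> 'r \<Rightarrow> ('f, 'r) lang \<Rightarrow> ('f, 'r) lang \<Rightarrow> ('f, 'r) fm set \<Rightarrow> ('f, 'r) fm set \<Rightarrow>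
   ('f, 'r) fm set \<Rightarrow> bool" where
  "mordell_lang_condition U A L\<alpha> L\<beta> T\<alpha> T\<beta> T \<longleftrightarrow>
     (\<forall>k I p q \<phi> \<psi>.
        mordell_lang_challenge U L\<alpha> L\<beta> T\<alpha> T\<beta> k I p q \<phi> \<psi> \<and>
        (\<exists>(M :: ('f, 'r, 'b) struct) c a. mordell_lang_solution A L\<alpha> L\<beta> T k I p q \<phi> \<psi> M c a) \<longrightarrow>
        (\<forall>(M :: ('f, 'r, 'b) struct) c. mordell_lang_contender A L\<alpha> L\<beta> T k I p q M c \<longrightarrow>
           (\<exists>a. mordell_lang_solution A L\<alpha> L\<beta> T k I p q \<phi> \<psi> M c a)))"

text \<open>It suffices to let \<open>\<kappa>\<close> range over cardinals on the type of elements: an infinite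
  \<open>\<kappa>\<close>-saturated structure has at least \<open>\<kappa>\<close> elements, and a finite one has no non-algebraic
  types.\<close>

definition density_condition ::
  "'b itself \<Rightarrow> 'r \<Rightarrow> ('f, 'r) lang \<Rightarrow> ('f, 'r) lang \<Rightarrow> ('f, 'r) fm set \<Rightarrow> bool" where
  "density_condition U A L\<alpha> L\<beta> T \<longleftrightarrow>
     (\<forall>(M :: ('f, 'r, 'b) struct) (\<kappa> :: 'b rel) C q p.
        models (lang2 A L\<alpha> L\<beta>) M T \<and>
        Card_order \<kappa> \<and> lang_card (lang2 A L\<alpha> L\<beta>) <o \<kappa> \<and> saturated \<kappa> (lang2 A L\<alpha> L\<beta>) M \<and>
        C \<subseteq> univ M \<and> |C| <o \<kappa> \<and>
        unary_type L\<beta> M C q \<and> nonalgebraic M q \<and>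
        unary_type L\<alpha> (A_struct A M) (A_part A M \<inter> C) p \<and>
        (\<forall>(\<theta>, e)\<in>p. quantifier_free \<theta> \<and> \<theta> \<in> formulas (L\<alpha> \<inter> L\<beta>) \<longrightarrow> type_implies M q (\<theta>, e)) \<longrightarrow>
        (\<exists>a\<in>A_part A M. prealizes M a ({(relativize A \<theta>, e) |\<theta> e. (\<theta>, e) \<in> p} \<union> q)))"

definition codensity_condition ::
  "'b itself \<Rightarrow> 'r \<Rightarrow> ('f, 'r) lang \<Rightarrow> ('f, 'r) lang \<Rightarrow> ('f, 'r) fm set \<Rightarrow> bool" where
  "codensity_condition U A L\<alpha> L\<beta> T \<longleftrightarrow>
     (\<forall>(M :: ('f, 'r, 'b) struct) (\<kappa> :: 'b rel) C q.
        models (lang2 A L\<alpha> L\<beta>) M T \<and>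
        Card_order \<kappa> \<and> lang_card (lang2 A L\<alpha> L\<beta>) <o \<kappa> \<and> saturated \<kappa> (lang2 A L\<alpha> L\<beta>) M \<and>
        C \<subseteq> univ M \<and> |C| <o \<kappa> \<and>
        unary_type L\<beta> M C q \<and> nonalgebraic M q \<longrightarrow>
        (\<exists>b\<in>univ M - acl L\<beta> M (A_part A M \<union> C). prealizes M b q))"

definition mordell_lang_theory ::
  "'b itself \<Rightarrow> 'r \<Rightarrow> ('f, 'r) lang \<Rightarrow> ('f, 'r) lang \<Rightarrow> ('f, 'r) fm set \<Rightarrow> ('f, 'r) fm set \<Rightarrow>
   ('f, 'r) fm set \<Rightarrow> bool" where
  "mordell_lang_theory U A L\<alpha> L\<beta> T\<alpha> T\<beta> T \<longleftrightarrow>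
     T \<subseteq> sentences (lang2 A L\<alpha> L\<beta>) \<and> theory2 A L\<alpha> L\<beta> T\<alpha> T\<beta> \<subseteq> T \<and>
     mordell_lang_condition U A L\<alpha> L\<beta> T\<alpha> T\<beta> T \<and>
     density_condition U A L\<alpha> L\<beta> T \<and>
     codensity_condition U A L\<alpha> L\<beta> T"

end

theory Submission
  imports Defs
begin

text \<open>
  Let \<open>V\<close> be open and definable over a finite set \<open>C\<close>, enlarged by elements of \<open>A\<close> so that it is free
  from \<open>A\<close> over \<open>C \<inter> A\<close>. The Mordell-Lang, density and codensity conditions yield a back-and-forth
  system of finite tuples with equal \<open>L\<beta>\<close>-types, equal \<open>L\<alpha>\<close>-types of their parts in \<open>A\<close>, and free
  from \<open>A\<close> over these parts. Consequently two tuples \<open>d\<close>, \<open>d'\<close> that are independent over \<open>A \<union> C\<close>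
  and have the same \<open>L\<beta>\<close>-type over \<open>C\<close> have the same type over \<open>C\<close> in the pair, so that
  \<open>U\<^sub>d \<subseteq> V\<close> depends only on the \<open>L\<beta>\<close>-type of a generic \<open>d\<close>; by saturation it is witnessed by a
  single \<open>L\<beta>(C)\<close>-formula \<open>\<eta>(d)\<close>. If \<open>x \<in> V\<close>, then \<open>{d. x \<in> U\<^sub>d \<subseteq> V}\<close> has nonempty interior and
  hence, by codensity, a point generic over \<open>A \<union> C \<union> x\<close>. Thus \<open>V\<close> is the union, over all such \<open>\<eta>\<close>,
  of the \<open>L\<beta>\<close>-definable sets of those \<open>x\<close> for which \<open>\<eta>(d) \<and> x \<in> U\<^sub>d\<close> holds for infinitely many
  \<open>d\<^sub>1\<close>, for infinitely many \<open>d\<^sub>2\<close>, and so on, and by saturation finitely many \<open>\<eta>\<close> suffice.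
\<close>

text \<open>A point x of V may lie in A or be algebraic over A, so its \<open>L\<beta>\<close>-type
  says little about its type in the pair. The parameters d of a small box around x take its place:
  they can be moved inside an open set, hence away from everything algebraic over A, C and x, and
  for such tuples \<open>L\<beta>\<close> decides the type in the pair. The way back to x is the
  relation that x lies in the box of d, which is an \<open>L\<beta>\<close>-formula.

  Genericity over A is not expressible in \<open>L\<beta>\<close>; infinite quantifiers replace it.
  A formula true at a generic entry has infinitely many solutions there, and codensity finds a
  generic solution among infinitely many. Elimination of infinity keeps each quantifier inside
  \<open>L\<beta>\<close>, one for each of the m * n box parameters.

  In the back-and-forth, Mordell-Lang serves the points of A algebraic over the tuple, density the
  other points of A, and codensity the points generic over A. Freeness is carried along because
  Mordell-Lang speaks only of tuples free from A.\<close>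

section \<open>Renaming of variables and derived connectives\<close>

primrec subst_tm :: "(nat \<Rightarrow> nat) \<Rightarrow> 'f tm \<Rightarrow> 'f tm" where
  "subst_tm \<sigma> (Var x) = Var (\<sigma> x)"
| "subst_tm \<sigma> (Fn f ts) = Fn f (map (subst_tm \<sigma>) ts)"

text \<open>Under a quantifier the bound variable moves above the images of all free variables of
  the body, which rules out capture. Inserting 0 gives \<open>Max\<close> a nonempty argument when
  the body is closed.\<close>

primrec subst :: "('f, 'r) fm \<Rightarrow> (nat \<Rightarrow> nat) \<Rightarrow> ('f, 'r) fm" where
  "subst Falsum \<sigma> = Falsum"
| "subst (Eq s t) \<sigma> = Eq (subst_tm \<sigma> s) (subst_tm \<sigma> t)"
| "subst (Rel r ts) \<sigma> = Rel r (map (subst_tm \<sigma>) ts)"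
| "subst (Imp \<phi> \<psi>) \<sigma> = Imp (subst \<phi> \<sigma>) (subst \<psi> \<sigma>)"
| "subst (Forall x \<phi>) \<sigma> =
     (let z = Suc (Max (insert 0 (\<sigma> ` fv \<phi>))) in Forall z (subst \<phi> (\<sigma>(x := z))))"

lemma finite_tm_vars [simp]: "finite (tm_vars t)"
  by (induction t) auto

lemma finite_fv [simp]: "finite (fv \<phi>)"
  by (induction \<phi>) auto

lemma eval_tm_cong: "(\<And>x. x \<in> tm_vars t \<Longrightarrow> e x = e' x) \<Longrightarrow> eval_tm M e t = eval_tm M e' t"
proof (induction t)
  case (Fn f ts)
  have "map (eval_tm M e) ts = map (eval_tm M e') ts"
    using Fn by (intro map_cong refl Fn.IH) auto
  then show ?case by (simp only: eval_tm.simps)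
qed simp

lemma sat_cong: "(\<And>x. x \<in> fv \<phi> \<Longrightarrow> e x = e' x) \<Longrightarrow> sat M e \<phi> = sat M e' \<phi>"
proof (induction \<phi> arbitrary: e e')
  case (Eq s t)
  then show ?case using eval_tm_cong[of s e e' M] eval_tm_cong[of t e e' M] by simp
next
  case (Rel r ts)
  have "map (eval_tm M e) ts = map (eval_tm M e') ts"
    using Rel by (intro map_cong refl eval_tm_cong) auto
  then show ?case by (simp only: sat.simps)
next
  case (Imp \<phi> \<psi>)
  have "sat M e \<phi> = sat M e' \<phi>" "sat M e \<psi> = sat M e' \<psi>"
    using Imp.prems by (auto intro!: Imp.IH)
  then show ?case by simp
next
  case (Forall x \<phi>)
  have "sat M (e(x := a)) \<phi> = sat M (e'(x := a)) \<phi>" for a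
    using Forall.prems by (intro Forall.IH) auto
  then show ?case by simp
qed simp

lemma eval_subst_tm: "eval_tm M e (subst_tm \<sigma> t) = eval_tm M (e \<circ> \<sigma>) t"
proof (induction t)
  case (Fn f ts)
  then have "map (eval_tm M e \<circ> subst_tm \<sigma>) ts = map (eval_tm M (e \<circ> \<sigma>)) ts"
    by (intro map_cong) (auto simp del: eval_tm.simps simp: comp_def)
  then show ?case by (simp only: subst_tm.simps eval_tm.simps map_map)
qed simp

lemma sat_subst: "sat M e (subst \<phi> \<sigma>) = sat M (e \<circ> \<sigma>) \<phi>"
proof (induction \<phi> arbitrary: e \<sigma>)
  case (Rel r ts)
  have "map (eval_tm M e \<circ> subst_tm \<sigma>) ts = map (eval_tm M (e \<circ> \<sigma>)) ts"
    by (simp add: eval_subst_tm)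
  then show ?case by (simp only: subst.simps sat.simps map_map)
next
  case (Forall x \<phi>)
  define z where "z = Suc (Max (insert 0 (\<sigma> ` fv \<phi>)))"
  have z: "\<sigma> v \<noteq> z" if "v \<in> fv \<phi>" for v
    using that Max_ge[of "insert 0 (\<sigma> ` fv \<phi>)" "\<sigma> v"] unfolding z_def by fastforce
  have "sat M (e(z := a)) (subst \<phi> (\<sigma>(x := z))) = sat M ((e \<circ> \<sigma>)(x := a)) \<phi>" for a
    unfolding Forall.IH by (rule sat_cong) (use z in auto)
  then show ?case by (simp add: z_def[symmetric] comp_def)
qed (simp_all add: eval_subst_tm)

lemma tm_symbs_subst: "tm_symbs (subst_tm \<sigma> t) = tm_symbs t"
  by (induction t) auto

lemma symbs_subst [simp]: "symbs (subst \<phi> \<sigma>) = symbs \<phi>"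
  by (induction \<phi> arbitrary: \<sigma>) (auto simp: tm_symbs_subst Let_def)

lemma subst_formulas [simp]: "subst \<phi> \<sigma> \<in> formulas L \<longleftrightarrow> \<phi> \<in> formulas L"
  by (simp add: formulas_def)

lemma tm_vars_subst: "tm_vars (subst_tm \<sigma> t) = \<sigma> ` tm_vars t"
  by (induction t) auto

lemma fv_subst: "fv (subst \<phi> \<sigma>) \<subseteq> \<sigma> ` fv \<phi>"
proof (induction \<phi> arbitrary: \<sigma>)
  case (Imp \<phi> \<psi>)
  then show ?case by (simp add: image_Un) blast
next
  case (Forall x \<phi>)
  define z where "z = Suc (Max (insert 0 (\<sigma> ` fv \<phi>)))"
  have "fv (subst \<phi> (\<sigma>(x := z))) \<subseteq> (\<sigma>(x := z)) ` fv \<phi>" by (rule Forall)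
  then show ?case by (auto simp: z_def[symmetric] split: if_splits)
qed (auto simp: tm_vars_subst)

lemma quantifier_free_subst [simp]: "quantifier_free (subst \<phi> \<sigma>) = quantifier_free \<phi>"
  by (induction \<phi> arbitrary: \<sigma>) (auto simp: Let_def)

definition Exist :: "nat \<Rightarrow> ('f, 'r) fm \<Rightarrow> ('f, 'r) fm" where
  "Exist x \<phi> = Neg (Forall x (Neg \<phi>))"

lemma sat_Neg [simp]: "sat M e (Neg \<phi>) \<longleftrightarrow> \<not> sat M e \<phi>"
  by (simp add: Neg_def)

lemma sat_Conj [simp]: "sat M e (Conj \<phi> \<psi>) \<longleftrightarrow> sat M e \<phi> \<and> sat M e \<psi>"
  by (simp add: Conj_def)

lemma sat_Exist [simp]: "sat M e (Exist x \<phi>) \<longleftrightarrow> (\<exists>a\<in>univ M. sat M (e(x := a)) \<phi>)"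
  by (simp add: Exist_def)

lemma fv_connectives [simp]:
  "fv (Neg \<phi>) = fv \<phi>" "fv (Conj \<phi> \<psi>) = fv \<phi> \<union> fv \<psi>" "fv (Exist x \<phi>) = fv \<phi> - {x}"
  by (auto simp: Neg_def Conj_def Exist_def)

lemma formulas_connectives [simp]:
  "Falsum \<in> formulas L"
  "Imp \<phi> \<psi> \<in> formulas L \<longleftrightarrow> \<phi> \<in> formulas L \<and> \<psi> \<in> formulas L"
  "Forall x \<phi> \<in> formulas L \<longleftrightarrow> \<phi> \<in> formulas L"
  "Neg \<phi> \<in> formulas L \<longleftrightarrow> \<phi> \<in> formulas L"
  "Conj \<phi> \<psi> \<in> formulas L \<longleftrightarrow> \<phi> \<in> formulas L \<and> \<psi> \<in> formulas L"
  "Exist x \<phi> \<in> formulas L \<longleftrightarrow> \<phi> \<in> formulas L"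
  "Eq (Var x) (Var y) \<in> formulas L"
  by (auto simp: formulas_def Neg_def Conj_def Exist_def)

text \<open>A set carries no order, so an arbitrary enumeration is conjoined; truth, free variables
  and the symbols used do not depend on the choice.\<close>

definition Conj_set :: "('f, 'r) fm set \<Rightarrow> ('f, 'r) fm" where
  "Conj_set F = foldr Conj (SOME xs. set xs = F) (Neg Falsum)"

lemma Conj_set_cases:
  assumes "finite F"
  obtains xs where "set xs = F" "Conj_set F = foldr Conj xs (Neg Falsum)"
proof (rule that)
  show "set (SOME xs. set xs = F) = F" using finite_list[OF assms] by (rule someI_ex)
qed (simp add: Conj_set_def)

lemma sat_Conj_set: "finite F \<Longrightarrow> sat M e (Conj_set F) \<longleftrightarrow> (\<forall>\<phi>\<in>F. sat M e \<phi>)"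
proof -
  have "sat M e (foldr Conj xs (Neg Falsum)) \<longleftrightarrow> (\<forall>\<phi>\<in>set xs. sat M e \<phi>)" for xs
    by (induction xs) auto
  then show "finite F \<Longrightarrow> ?thesis" by (elim Conj_set_cases) simp
qed

lemma fv_Conj_set:
  assumes "finite F"
  shows "fv (Conj_set F) = \<Union>(fv ` F)"
proof -
  obtain xs where xs: "set xs = F" "Conj_set F = foldr Conj xs (Neg Falsum)"
    using assms by (rule Conj_set_cases)
  have "fv (foldr Conj xs (Neg Falsum)) = \<Union>(fv ` set xs)" by (induction xs) auto
  with xs show ?thesis by simp
qed

lemma Conj_set_formulas: "finite F \<Longrightarrow> Conj_set F \<in> formulas L \<longleftrightarrow> F \<subseteq> formulas L"
proof -
  have "foldr Conj xs (Neg Falsum) \<in> formulas L \<longleftrightarrow> set xs \<subseteq> formulas L" for xs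
    by (induction xs) auto
  then show "finite F \<Longrightarrow> ?thesis" by (elim Conj_set_cases) simp
qed

definition Forall_set :: "nat set \<Rightarrow> ('f, 'r) fm \<Rightarrow> ('f, 'r) fm" where
  "Forall_set X \<phi> = foldr Forall (sorted_list_of_set X) \<phi>"

lemma sat_foldr_Forall:
  "sat M e (foldr Forall xs \<phi>) \<longleftrightarrow>
     (\<forall>e'. (\<forall>i. i \<notin> set xs \<longrightarrow> e' i = e i) \<and> e' ` set xs \<subseteq> univ M \<longrightarrow> sat M e' \<phi>)"
proof (induction xs arbitrary: e)
  case Nil
  have "e' = e" if "\<forall>i. e' i = e i" for e' using that by auto
  then show ?case by auto
next
  case (Cons x xs)
  show ?case
  proof
    assume l: "sat M e (foldr Forall (x # xs) \<phi>)"
    show "\<forall>e'. (\<forall>i. i \<notin> set (x # xs) \<longrightarrow> e' i = e i) \<and> e' ` set (x # xs) \<subseteq> univ M \<longrightarrow> sat M e' \<phi>"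
    proof (intro allI impI)
      fix e'
      assume e': "(\<forall>i. i \<notin> set (x # xs) \<longrightarrow> e' i = e i) \<and> e' ` set (x # xs) \<subseteq> univ M"
      then have "sat M (e(x := e' x)) (foldr Forall xs \<phi>)" using l by simp
      then show "sat M e' \<phi>" unfolding Cons.IH using e' by auto
    qed
  next
    assume r: "\<forall>e'. (\<forall>i. i \<notin> set (x # xs) \<longrightarrow> e' i = e i) \<and> e' ` set (x # xs) \<subseteq> univ M \<longrightarrow>
      sat M e' \<phi>"
    have "sat M e' \<phi>" if a: "a \<in> univ M"
      and e': "\<forall>i. i \<notin> set xs \<longrightarrow> e' i = (e(x := a)) i" "e' ` set xs \<subseteq> univ M" for a e'
    proof -
      \<comment> \<open>If x is bound again further inside, the inner value replaces a; both lie in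
        the universe.\<close>
      have "e' x \<in> univ M" using a e' by (cases "x \<in> set xs") auto
      with r e' show ?thesis by auto
    qed
    then show "sat M e (foldr Forall (x # xs) \<phi>)" by (auto simp: Cons.IH)
  qed
qed

lemma sat_Forall_set:
  "finite X \<Longrightarrow> sat M e (Forall_set X \<phi>) \<longleftrightarrow>
     (\<forall>e'. (\<forall>i. i \<notin> X \<longrightarrow> e' i = e i) \<and> e' ` X \<subseteq> univ M \<longrightarrow> sat M e' \<phi>)"
  by (simp add: Forall_set_def sat_foldr_Forall)

lemma fv_Forall_set: "finite X \<Longrightarrow> fv (Forall_set X \<phi>) = fv \<phi> - X"
proof -
  have "fv (foldr Forall xs \<phi>) = fv \<phi> - set xs" for xs by (induction xs) auto
  then show "finite X \<Longrightarrow> ?thesis" by (simp add: Forall_set_def)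
qed

lemma Forall_set_formulas [simp]: "Forall_set X \<phi> \<in> formulas L \<longleftrightarrow> \<phi> \<in> formulas L"
proof -
  have "foldr Forall xs \<phi> \<in> formulas L \<longleftrightarrow> \<phi> \<in> formulas L" for xs by (induction xs) auto
  then show ?thesis by (simp add: Forall_set_def)
qed

lemma eval_tm_univ:
  assumes "is_struct L M" "tm_symbs t \<subseteq> L" "e ` tm_vars t \<subseteq> univ M"
  shows "eval_tm M e t \<in> univ M"
  using assms(2,3)
proof (induction t)
  case (Fn f ts)
  have "set (map (eval_tm M e) ts) \<subseteq> univ M"
  proof -
    have "eval_tm M e t \<in> univ M" if "t \<in> set ts" for t
      using that Fn.prems by (intro Fn.IH) fastforce+
    then show ?thesis by auto
  qed
  moreover have "FSym f (length ts) \<in> L" using Fn.prems by simp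
  ultimately show ?case using assms(1) unfolding is_struct_def by fastforce
qed simp

text \<open>\<open>A_struct\<close> shrinks only the universe, so terms and atoms keep their values
  and only the quantifier clause has to be relativized.\<close>

lemma sat_A_struct: "sat (A_struct A M) e \<phi> = sat M e (relativize A \<phi>)"
proof (induction \<phi> arbitrary: e)
  case (Eq s t)
  have "eval_tm (A_struct A M) e u = eval_tm M e u" for u
    by (induction u) (auto simp: A_struct_def cong: map_cong)
  then show ?case by simp
next
  case (Rel r ts)
  have "eval_tm (A_struct A M) e u = eval_tm M e u" for u
    by (induction u) (auto simp: A_struct_def cong: map_cong)
  then show ?case by (simp add: A_struct_def cong: map_cong)
qed (auto simp: A_struct_def A_part_def)

lemma relativize_quantifier_free: "quantifier_free \<phi> \<Longrightarrow> relativize A \<phi> = \<phi>"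
  by (induction \<phi>) auto

lemma univ_A_struct [simp]: "univ (A_struct A M) = A_part A M"
  by (simp add: A_struct_def)

subsection \<open>Formulas with parameters and tuples\<close>

lemma psat_Pair: "psat M b (\<phi>, e) = sat M (e(0 := b)) \<phi>"
  by (simp add: psat_def)

text \<open>Choosing least indices makes the translation depend only on \<open>c\<close> and \<open>k\<close>, not on the
  language or on the set of indices allowed for the parameters.\<close>

definition tuple_fm :: "(nat \<Rightarrow> 'b) \<Rightarrow> nat \<Rightarrow> ('f, 'r, 'b) pfm \<Rightarrow> ('f, 'r) fm" where
  "tuple_fm c k = (\<lambda>(\<phi>, e). subst \<phi> (\<lambda>v. if v = 0 then k else LEAST j. c j = e v))"

lemma tuple_fm_formulas [simp]: "tuple_fm c k (\<phi>, e) \<in> formulas L \<longleftrightarrow> \<phi> \<in> formulas L"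
  by (simp add: tuple_fm_def)

text \<open>P tests elements rather than indices, so it passes from any index of v to the least one.
  This lets one translation serve both the whole tuple (P always true) and its part in A.\<close>

lemma least_index:
  fixes c :: "nat \<Rightarrow> 'b"
  assumes "v \<in> c ` {i. i < k \<and> P (c i)}"
  shows "(LEAST j. c j = v) < k" "c (LEAST j. c j = v) = v" "P v"
proof -
  obtain i where i: "i < k" "c i = v" "P v" using assms by auto
  show "c (LEAST j. c j = v) = v" by (rule LeastI[of _ i]) (rule i)
  show "(LEAST j. c j = v) < k" using Least_le[of "\<lambda>j. c j = v" i] i by simp
  show "P v" by (rule i)
qed

lemma fv_tuple_fm:
  assumes "(\<phi>, e) \<in> pformulas L (c ` {i. i < k \<and> P (c i)})"
  shows "fv (tuple_fm c k (\<phi>, e)) \<subseteq> insert k {i. i < k \<and> P (c i)}"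
proof
  fix x assume "x \<in> fv (tuple_fm c k (\<phi>, e))"
  then obtain v where v: "v \<in> fv \<phi>" "x = (if v = 0 then k else LEAST j. c j = e v)"
    using fv_subst by (fastforce simp: tuple_fm_def)
  show "x \<in> insert k {i. i < k \<and> P (c i)}"
  proof (cases "v = 0")
    case False
    then have "e v \<in> c ` {i. i < k \<and> P (c i)}" using assms v by (auto simp: pformulas_def)
    from least_index[OF this] False v show ?thesis by auto
  qed (use v in simp)
qed

lemma sat_tuple_fm:
  assumes "(\<phi>, e) \<in> pformulas L (c ` {i. i < k \<and> P (c i)})"
  shows "sat N (c(k := b)) (tuple_fm c k (\<phi>, e)) = psat N b (\<phi>, e)"
  unfolding tuple_fm_def psat_Pair prod.case sat_subst
proof (rule sat_cong)
  fix v assume v: "v \<in> fv \<phi>"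
  show "(c(k := b) \<circ> (\<lambda>v. if v = 0 then k else LEAST j. c j = e v)) v = (e(0 := b)) v"
  proof (cases "v = 0")
    case False
    then have "e v \<in> c ` {i. i < k \<and> P (c i)}" using assms v by (auto simp: pformulas_def)
    from least_index[OF this] False v show ?thesis by auto
  qed simp
qed

lemma acl_tupleI:
  assumes "\<eta> \<in> formulas L" "fv \<eta> \<subseteq> insert k J" "k \<notin> J" "sat M (c(k := b)) \<eta>"
    "finite {a \<in> univ M. sat M (c(k := a)) \<eta>}" "b \<in> univ M"
  shows "b \<in> acl L M (c ` J)"
proof -
  \<comment> \<open>The object variable of a \<open>pfm\<close> is 0, so k is sent to 0 and every
    other variable is shifted up by one to make room.\<close>
  define \<theta> where "\<theta> = (subst \<eta> (\<lambda>i. if i = k then 0 else Suc i), case_nat b c)"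
  have sat: "psat M a \<theta> = sat M (c(k := a)) \<eta>" for a
    unfolding \<theta>_def psat_Pair sat_subst by (rule sat_cong) auto
  have "\<theta> \<in> pformulas L (c ` J)"
    using assms(1,2) fv_subst[of \<eta> "\<lambda>i. if i = k then 0 else Suc i"]
    by (fastforce simp: \<theta>_def pformulas_def split: if_splits)
  then show ?thesis using assms(4-6) by (auto simp: acl_def psolutions_def sat intro!: bexI[of _ \<theta>])
qed

lemma acl_tupleE:
  assumes "b \<in> acl L M (c ` {..<k})"
  obtains \<eta> where "\<eta> \<in> formulas L" "fv \<eta> \<subseteq> {..k}" "sat M (c(k := b)) \<eta>"
    "finite {a \<in> univ M. sat M (c(k := a)) \<eta>}"
proof -
  obtain \<phi> e where \<phi>: "(\<phi>, e) \<in> pformulas L (c ` {..<k})" "psat M b (\<phi>, e)"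
    "finite (psolutions M (\<phi>, e))" using assms by (auto simp: acl_def)
  have p: "(\<phi>, e) \<in> pformulas L (c ` {i. i < k \<and> True})" using \<phi>(1) by (simp add: lessThan_def)
  show thesis
  proof (rule that[of "tuple_fm c k (\<phi>, e)"])
    show "fv (tuple_fm c k (\<phi>, e)) \<subseteq> {..k}"
      using fv_tuple_fm[of \<phi> e L c k "\<lambda>_. True"] p by auto
  qed (use \<phi> sat_tuple_fm[of \<phi> e L c k "\<lambda>_. True", OF p] in \<open>auto simp: pformulas_def psolutions_def\<close>)
qed

text \<open>The type of \<open>b\<close> over the tuple \<open>c\<close>, transported to the tuple \<open>c'\<close>.\<close>

definition transfer_type ::
  "('f, 'r) lang \<Rightarrow> ('f, 'r, 'b) struct \<Rightarrow> nat \<Rightarrow> nat set \<Rightarrow> (nat \<Rightarrow> 'b) \<Rightarrow> 'b \<Rightarrow> (nat \<Rightarrow> 'b) \<Rightarrow>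
   ('f, 'r, 'b) pfm set" where
  "transfer_type L N k J c b c' =
     {\<theta> \<in> pformulas L (c' ` J). sat N (c(k := b)) (tuple_fm c' k \<theta>)}"

text \<open>The conjunction of finitely many formulas of the transported type, with its object
  variable quantified existentially, holds at c with witness b. Its variables lie in J, where c and
  c' have the same type, so it has a witness at c' too.\<close>

lemma unary_type_transfer:
  fixes N :: "('f, 'r, 'b) struct"
  assumes J: "J = {i. i < k \<and> P (c' i)}" and b: "b \<in> univ N"
    and eq: "\<And>\<phi>. \<phi> \<in> formulas L \<Longrightarrow> fv \<phi> \<subseteq> J \<Longrightarrow> sat N c \<phi> = sat N c' \<phi>"
  shows "unary_type L N (c' ` J) (transfer_type L N k J c b c')"
  unfolding unary_type_def
proof (intro conjI allI impI)
  let ?q = "transfer_type L N k J c b c'"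
  show "?q \<subseteq> pformulas L (c' ` J)" by (auto simp: transfer_type_def)
  show "(\<phi>, e) \<in> ?q \<or> (Neg \<phi>, e) \<in> ?q" if "(\<phi>, e) \<in> pformulas L (c' ` J)" for \<phi> e
    using that by (auto simp: transfer_type_def pformulas_def tuple_fm_def sat_subst)
  fix p0 assume p0: "p0 \<subseteq> ?q" "finite p0"
  then have fin: "finite (tuple_fm c' k ` p0)" and sub: "tuple_fm c' k ` p0 \<subseteq> formulas L"
    by (auto simp: transfer_type_def pformulas_def)
  define \<eta> where "\<eta> = Conj_set (tuple_fm c' k ` p0)"
  have \<eta>: "\<eta> \<in> formulas L" "fv \<eta> \<subseteq> \<Union>(fv ` tuple_fm c' k ` p0)"
    "\<And>(M :: ('f, 'r, 'b) struct) e. sat M e \<eta> \<longleftrightarrow> (\<forall>\<phi>\<in>tuple_fm c' k ` p0. sat M e \<phi>)"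
    using fin sub by (auto simp: \<eta>_def sat_Conj_set fv_Conj_set Conj_set_formulas)
  have p0': "\<theta> \<in> pformulas L (c' ` {i. i < k \<and> P (c' i)})" if "\<theta> \<in> p0" for \<theta>
    using p0 that J by (auto simp: transfer_type_def)
  have "fv (tuple_fm c' k \<theta>) \<subseteq> insert k J" if "\<theta> \<in> p0" for \<theta>
    using fv_tuple_fm[of "fst \<theta>" "snd \<theta>" L c' k P] p0'[OF that] J by simp
  then have "\<Union>(fv ` tuple_fm c' k ` p0) \<subseteq> insert k J" by blast
  with \<eta>(2) have "fv \<eta> \<subseteq> insert k J" by (rule order_trans)
  then have "fv (Exist k \<eta>) \<subseteq> J" by auto
  moreover have "sat N c (Exist k \<eta>)"
    using p0 b by (auto simp: transfer_type_def \<eta>(3))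
  moreover have "Exist k \<eta> \<in> formulas L" using \<eta>(1) by simp
  ultimately have "sat N c' (Exist k \<eta>)" using eq by blast
  then obtain b' where b': "b' \<in> univ N" "\<forall>\<theta>\<in>p0. sat N (c'(k := b')) (tuple_fm c' k \<theta>)"
    by (auto simp: \<eta>(3))
  have "psat N b' \<theta>" if "\<theta> \<in> p0" for \<theta>
    using sat_tuple_fm[of "fst \<theta>" "snd \<theta>" L c' k P N b'] p0'[OF that] b' that by simp
  with b' show "\<exists>b\<in>univ N. prealizes N b p0" unfolding prealizes_def by blast
qed

text \<open>Lindenbaum's lemma for unary types: Zorn gives a maximal finitely satisfiable extension,
  and maximality forces it to decide every formula.\<close>

lemma exists_complete_type:
  assumes p: "p \<subseteq> pformulas L C"
    and fin: "\<And>p0. p0 \<subseteq> p \<Longrightarrow> finite p0 \<Longrightarrow> \<exists>b\<in>univ M. prealizes M b p0"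
  obtains q where "unary_type L M C q" "p \<subseteq> q"
proof -
  define fs where "fs q \<longleftrightarrow> (\<forall>p0\<subseteq>q. finite p0 \<longrightarrow> (\<exists>b\<in>univ M. prealizes M b p0))" for q
  let ?S = "{q. p \<subseteq> q \<and> q \<subseteq> pformulas L C \<and> fs q}"
  have "\<exists>q\<in>?S. \<forall>X\<in>?S. q \<subseteq> X \<longrightarrow> X = q"
  proof (rule subset_Zorn_nonempty)
    show "?S \<noteq> {}" using p fin by (auto simp: fs_def)
    fix \<C> assume \<C>: "\<C> \<noteq> {}" "subset.chain ?S \<C>"
    have "fs (\<Union>\<C>)"
      unfolding fs_def
    proof (intro allI impI)
      fix p0 assume "p0 \<subseteq> \<Union>\<C>" "finite p0"
      then obtain q where "q \<in> \<C>" "p0 \<subseteq> q"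
        using finite_subset_Union_chain[of p0 \<C> ?S] \<C> by auto
      then show "\<exists>b\<in>univ M. prealizes M b p0"
        using \<C>(2) \<open>finite p0\<close> unfolding subset.chain_def fs_def by blast
    qed
    then show "\<Union>\<C> \<in> ?S" using \<C> unfolding subset.chain_def by blast
  qed
  then obtain q where q: "p \<subseteq> q" "q \<subseteq> pformulas L C" "fs q"
    and max: "\<And>q'. q \<subseteq> q' \<Longrightarrow> q' \<subseteq> pformulas L C \<Longrightarrow> fs q' \<Longrightarrow> q' = q" by auto
  \<comment> \<open>By maximality, each excluded formula is refuted by a finite part of q. If a
    formula and its negation were both excluded, the union of the two finite parts would have no
    realization.\<close>
  have bad: "\<exists>p0\<subseteq>q. finite p0 \<and> (\<forall>b\<in>univ M. prealizes M b p0 \<longrightarrow> \<not> psat M b \<theta>)"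
    if "\<theta> \<in> pformulas L C" "\<theta> \<notin> q" for \<theta>
  proof -
    have "\<not> fs (insert \<theta> q)" using max[of "insert \<theta> q"] that q by blast
    then obtain p1 where p1: "p1 \<subseteq> insert \<theta> q" "finite p1" "\<forall>b\<in>univ M. \<not> prealizes M b p1"
      by (auto simp: fs_def)
    show ?thesis
      by (rule exI[of _ "p1 - {\<theta>}"]) (use p1 in \<open>auto simp: prealizes_def\<close>)
  qed
  have "(\<phi>, e) \<in> q \<or> (Neg \<phi>, e) \<in> q" if \<phi>: "(\<phi>, e) \<in> pformulas L C" for \<phi> e
  proof (rule ccontr)
    assume n: "\<not> ((\<phi>, e) \<in> q \<or> (Neg \<phi>, e) \<in> q)"
    have n': "(Neg \<phi>, e) \<in> pformulas L C" using \<phi> by (auto simp: pformulas_def)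
    obtain p1 where p1: "p1 \<subseteq> q" "finite p1" "\<forall>b\<in>univ M. prealizes M b p1 \<longrightarrow> \<not> psat M b (\<phi>, e)"
      using bad[OF \<phi>] n by auto
    obtain p2 where p2: "p2 \<subseteq> q" "finite p2" "\<forall>b\<in>univ M. prealizes M b p2 \<longrightarrow> \<not> psat M b (Neg \<phi>, e)"
      using bad[OF n'] n by auto
    have "\<exists>b\<in>univ M. prealizes M b (p1 \<union> p2)"
      using q(3) p1 p2 unfolding fs_def by (meson Un_subset_iff finite_Un)
    then obtain b where "b \<in> univ M" "prealizes M b p1" "prealizes M b p2"
      by (auto simp: prealizes_def)
    with p1 p2 show False by (auto simp: psat_Pair)
  qed
  then have "unary_type L M C q" using q(2,3) by (auto simp: unary_type_def fs_def)
  with q(1) that show thesis by blast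
qed

text \<open>A compactness principle inside a finite set: a member of the directed family with the
  fewest points in Z implies every other member on Z. It serves algebraic points, where only
  finitely many partners are possible.\<close>

lemma finite_common_point:
  assumes "finite Z" "\<P> \<noteq> {}"
    and "\<And>P Q. P \<in> \<P> \<Longrightarrow> Q \<in> \<P> \<Longrightarrow> \<exists>R\<in>\<P>. \<forall>z. R z \<longrightarrow> P z \<and> Q z"
    and "\<And>P. P \<in> \<P> \<Longrightarrow> \<exists>z\<in>Z. P z"
  shows "\<exists>z\<in>Z. \<forall>P\<in>\<P>. P z"
proof -
  define f where "f P = card {z \<in> Z. P z}" for P
  obtain P where P: "P \<in> \<P>" "\<And>Q. Q \<in> \<P> \<Longrightarrow> f P \<le> f Q"
    using assms(2) ex_has_least_nat[of "\<lambda>P. P \<in> \<P>" _ f] by blast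
  obtain z where z: "z \<in> Z" "P z" using assms(4) P(1) by auto
  have "Q z" if "Q \<in> \<P>" for Q
  proof -
    obtain R where R: "R \<in> \<P>" "\<forall>z. R z \<longrightarrow> P z \<and> Q z" using assms(3) P(1) \<open>Q \<in> \<P>\<close> by blast
    have "{z \<in> Z. R z} \<subseteq> {z \<in> Z. P z}" using R by auto
    moreover have "card {z \<in> Z. P z} \<le> card {z \<in> Z. R z}" using P(2)[OF R(1)] by (simp add: f_def)
    ultimately have "{z \<in> Z. R z} = {z \<in> Z. P z}" using assms(1) by (intro card_seteq) auto
    with z R show ?thesis by auto
  qed
  with z show ?thesis by blast
qed

text \<open>If c' has repeated entries, \<eta> may name one of them by an index other than the
  least, so \<eta> and its translation \<open>?t\<close> can be different formulas. They agree at c'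
  for every object value; a disagreement at c and b would be an existential statement about c, and
  would then also occur at c'.\<close>

lemma transfer_type_realized:
  fixes N :: "('f, 'r, 'b) struct"
  assumes J: "J = {i. i < k \<and> P (c' i)}" and b: "b \<in> univ N" and a: "a \<in> univ N"
    and eq: "\<And>\<phi>. \<phi> \<in> formulas L \<Longrightarrow> fv \<phi> \<subseteq> J \<Longrightarrow> sat N c \<phi> = sat N c' \<phi>"
    and real: "prealizes N a (transfer_type L N k J c b c')"
    and \<eta>: "\<eta> \<in> formulas L" "fv \<eta> \<subseteq> insert k J" "sat N (c(k := b)) \<eta>"
  shows "sat N (c'(k := a)) \<eta>"
proof -
  define \<theta> where "\<theta> = (subst \<eta> (\<lambda>i. if i = k then 0 else Suc i), case_nat b c')"
  have psat: "psat N x \<theta> = sat N (c'(k := x)) \<eta>" for x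
    unfolding \<theta>_def psat_Pair sat_subst by (rule sat_cong) auto
  have \<theta>: "\<theta> \<in> pformulas L (c' ` J)"
    using \<eta>(1,2) fv_subst[of \<eta> "\<lambda>i. if i = k then 0 else Suc i"]
    by (fastforce simp: \<theta>_def pformulas_def split: if_splits)
  then have \<theta>': "\<theta> \<in> pformulas L (c' ` {i. i < k \<and> P (c' i)})" using J by simp
  let ?t = "tuple_fm c' k \<theta>"
  have tf: "?t \<in> formulas L" using \<eta>(1) by (simp add: \<theta>_def)
  have fvt: "fv ?t \<subseteq> insert k J"
    using fv_tuple_fm[of "fst \<theta>" "snd \<theta>" L c' k P] \<theta>' J by simp
  have satt: "sat N (c'(k := x)) ?t = psat N x \<theta>" for x
    using sat_tuple_fm[of "fst \<theta>" "snd \<theta>" L c' k P N x] \<theta>' by simp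
  have "sat N (c(k := b)) ?t"
  proof (rule ccontr)
    assume "\<not> sat N (c(k := b)) ?t"
    then have "sat N c (Exist k (Conj \<eta> (Neg ?t)))" using \<eta>(3) b by auto
    moreover have "Exist k (Conj \<eta> (Neg ?t)) \<in> formulas L" "fv (Exist k (Conj \<eta> (Neg ?t))) \<subseteq> J"
      using \<eta>(1,2) tf fvt by auto
    ultimately have "sat N c' (Exist k (Conj \<eta> (Neg ?t)))" using eq by blast
    then show False by (auto simp: satt psat)
  qed
  with \<theta> have "\<theta> \<in> transfer_type L N k J c b c'" by (auto simp: transfer_type_def)
  with real show ?thesis by (auto simp: prealizes_def psat)
qed

lemma subset_lessThan:
  fixes k :: nat
  assumes "X \<subseteq> Y - {k}" "Y \<subseteq> {..k}"
  shows "X \<subseteq> {..<k}"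
proof
  fix i assume "i \<in> X"
  then have "i \<noteq> k" "i \<le> k" using assms by auto
  then show "i \<in> {..<k}" by simp
qed

section \<open>A saturated model of the pair and its two reducts\<close>

locale ml_model =
  fixes L\<alpha> L\<beta> :: "('f, 'r) lang" and A :: 'r
    and T\<alpha> T\<beta> T :: "('f, 'r) fm set" and \<tau> :: "('f, 'r) fm" and n :: nat
    and M :: "('f, 'r, 'b) struct" and \<kappa> :: "'k rel"
  assumes setting: "pair_setting TYPE('b) A L\<alpha> L\<beta> T\<alpha> T\<beta>"
    and topology: "definable_topology TYPE('b) L\<beta> T\<beta> n \<tau>"
    and ml_theory: "mordell_lang_theory TYPE('b) A L\<alpha> L\<beta> T\<alpha> T\<beta> T"
    and models_T: "models (lang2 A L\<alpha> L\<beta>) M T"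
    and Card_order_\<kappa>: "Card_order \<kappa>"
    and lang_card_less: "lang_card (lang2 A L\<alpha> L\<beta>) <o \<kappa>"
    and saturated_M: "saturated \<kappa> (lang2 A L\<alpha> L\<beta>) M"
begin

abbreviation "L2 \<equiv> lang2 A L\<alpha> L\<beta>"
abbreviation "B \<equiv> univ M"
abbreviation "AA \<equiv> A_part A M"
abbreviation "AM \<equiv> A_struct A M"
abbreviation "cl \<equiv> acl L\<beta> M"

lemma AA_subset: "AA \<subseteq> B"
  by (auto simp: A_part_def)

lemma formulas_beta: "\<phi> \<in> formulas L\<beta> \<Longrightarrow> \<phi> \<in> formulas L2"
  by (auto simp: formulas_def lang2_def)

lemma is_struct_L2: "is_struct L2 M"
  using models_T by (simp add: models_def)

lemma theory2_true: "\<phi> \<in> theory2 A L\<alpha> L\<beta> T\<alpha> T\<beta> \<Longrightarrow> sat M e \<phi>"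
  using models_T ml_theory by (auto simp: models_def mordell_lang_theory_def)

lemma models_beta: "models L\<beta> M T\<beta>"
proof -
  have "is_struct L\<beta> M" using is_struct_L2 by (auto simp: is_struct_def lang2_def)
  moreover have "sat M e \<phi>" if "\<phi> \<in> T\<beta>" for e \<phi>
    by (rule theory2_true) (use that in \<open>simp add: theory2_def\<close>)
  ultimately show ?thesis by (auto simp: models_def)
qed

lemma B_nonempty: "B \<noteq> {}"
  using is_struct_L2 by (simp add: is_struct_def)

lemma fun_symbols: "FSym f k \<in> L2 \<Longrightarrow> FSym f k \<in> L\<beta>"
  using setting by (auto simp: lang2_def pair_setting_def)

lemma sat_all_in_A: "sat M e (all_in_A A k) \<longleftrightarrow> (\<forall>i<k. rint M A [e i])"
proof -
  have "sat M e (foldr (\<lambda>i. Conj (Rel A [Var i])) xs (Neg Falsum)) \<longleftrightarrow> (\<forall>i\<in>set xs. rint M A [e i])"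
    for xs by (induction xs) auto
  then show ?thesis by (auto simp: all_in_A_def)
qed

lemma sat_Foralls:
  "sat M e (Foralls k \<phi>) \<longleftrightarrow>
     (\<forall>e'. (\<forall>i\<ge>k. e' i = e i) \<and> e' ` {..<k} \<subseteq> B \<longrightarrow> sat M e' \<phi>)"
  by (auto simp: Foralls_def sat_foldr_Forall not_less lessThan_atLeast0)

lemma A_closed:
  assumes "FSym f (length as) \<in> L\<alpha>" "set as \<subseteq> AA"
  shows "fint M f as \<in> AA"
proof -
  have m: "map (eval_tm M (\<lambda>i. as ! i)) (map Var [0..<length as]) = as"
    by (auto simp: comp_def map_nth)
  have nth: "as ! i \<in> AA" if "i < length as" for i using that assms(2) by auto
  have "sat M (\<lambda>i. as ! i) (closed_sentence A f (length as))"
    by (rule theory2_true) (use assms in \<open>auto simp: theory2_def\<close>)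
  then have "sat M (\<lambda>i. as ! i) (Imp (all_in_A A (length as))
      (Rel A [Fn f (map Var [0..<length as])]))"
    unfolding closed_sentence_def sat_Foralls using nth AA_subset by auto
  then have "rint M A [fint M f (map (eval_tm M (\<lambda>i. as ! i)) (map Var [0..<length as]))]"
    using nth by (auto simp: sat_all_in_A A_part_def)
  then have "rint M A [fint M f as]" unfolding m .
  moreover have "fint M f as \<in> B"
    using is_struct_L2 assms AA_subset by (auto simp: is_struct_def lang2_def)
  ultimately show ?thesis by (simp add: A_part_def)
qed

lemma rel_only_on_A:
  assumes "RSym R (length as) \<in> L\<alpha> - L\<beta>" "set as \<subseteq> B" "rint M R as"
  shows "set as \<subseteq> AA"
proof -
  have m: "map (eval_tm M (\<lambda>i. as ! i)) (map Var [0..<length as]) = as"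
    by (auto simp: comp_def map_nth)
  have nth: "as ! i \<in> B" if "i < length as" for i using that assms(2) by auto
  have "sat M (\<lambda>i. as ! i) (only_on_A_sentence A R (length as))"
    by (rule theory2_true) (use assms in \<open>auto simp: theory2_def\<close>)
  then have "sat M (\<lambda>i. as ! i) (Imp (Rel R (map Var [0..<length as])) (all_in_A A (length as)))"
    unfolding only_on_A_sentence_def sat_Foralls using nth by auto
  then have "sat M (\<lambda>i. as ! i) (all_in_A A (length as))"
    using assms(3) m by (simp only: sat.simps)
  then show ?thesis using nth by (auto simp: sat_all_in_A A_part_def in_set_conv_nth)
qed

lemma models_alpha: "models L\<alpha> AM T\<alpha>"
proof -
  have rel: "sat AM e \<phi>" if "\<phi> \<in> sentences L\<alpha>" "entails L\<alpha> T\<alpha> \<phi>" for \<phi> e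
    unfolding sat_A_struct by (rule theory2_true) (use that in \<open>auto simp: theory2_def\<close>)
  \<comment> \<open>Nonempty structures satisfy the sentence that not everything is absurd. Its
    relativization therefore belongs to the theory of the pair, and it says that A is
    nonempty.\<close>
  have "sat AM undefined (Imp (Forall 0 Falsum) Falsum)"
    by (rule rel) (auto simp: sentences_def entails_def models_def is_struct_def)
  then have "AA \<noteq> {}" by auto
  then have "is_struct L\<alpha> AM" using A_closed by (auto simp: is_struct_def A_struct_def)
  moreover have "sat AM e \<phi>" if "\<phi> \<in> T\<alpha>" for \<phi> e
    by (rule rel) (use that setting in \<open>auto simp: pair_setting_def entails_def models_def\<close>)
  ultimately show ?thesis by (auto simp: models_def)
qed

subsection \<open>The pregeometry\<close>

lemma pregeometry_cl: "pregeometry B cl"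
  using setting models_beta by (auto simp: pair_setting_def geometric_def)

lemma cl_ext: "X \<subseteq> B \<Longrightarrow> X \<subseteq> cl X"
  using pregeometry_cl[unfolded pregeometry_def, THEN conjunct1] by simp

lemma cl_mono: "X \<subseteq> Y \<Longrightarrow> Y \<subseteq> B \<Longrightarrow> cl X \<subseteq> cl Y"
  using pregeometry_cl[unfolded pregeometry_def, THEN conjunct2, THEN conjunct1] by simp

lemma cl_subset: "cl X \<subseteq> B"
  by (auto simp: acl_def)

lemma cl_idem: "X \<subseteq> B \<Longrightarrow> cl (cl X) = cl X"
  using pregeometry_cl[unfolded pregeometry_def, THEN conjunct2, THEN conjunct2, THEN conjunct1]
  by simp

lemma cl_trans: "X \<subseteq> cl Y \<Longrightarrow> Y \<subseteq> B \<Longrightarrow> cl X \<subseteq> cl Y"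
  using cl_mono[of X "cl Y"] cl_subset[of Y] cl_idem[of Y] by simp

lemma cl_insert_trans: "b \<in> cl Y \<Longrightarrow> Y \<subseteq> B \<Longrightarrow> cl (insert b Y) \<subseteq> cl Y"
  using cl_trans[of "insert b Y" Y] cl_ext[of Y] by auto

lemma cl_finite: "X \<subseteq> B \<Longrightarrow> a \<in> cl X \<Longrightarrow> \<exists>X0\<subseteq>X. finite X0 \<and> a \<in> cl X0"
  using pregeometry_cl[unfolded pregeometry_def, THEN conjunct2, THEN conjunct2, THEN conjunct2,
      THEN conjunct1] by simp

lemma cl_exchange:
  "X \<subseteq> B \<Longrightarrow> a \<in> B \<Longrightarrow> b \<in> B \<Longrightarrow> a \<in> cl (insert b X) \<Longrightarrow> a \<notin> cl X \<Longrightarrow> b \<in> cl (insert a X)"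
  using pregeometry_cl[unfolded pregeometry_def, THEN conjunct2, THEN conjunct2, THEN conjunct2,
      THEN conjunct2] by simp

text \<open>A reformulation of \<open>C \<down> A\<close> over \<open>C \<inter> A\<close> that is preserved by one-point extensions without
  any counting of dimensions.\<close>

definition free_from_A :: "'b set \<Rightarrow> bool" where
  "free_from_A C \<longleftrightarrow> (\<forall>Y\<subseteq>C. \<forall>x\<in>C. x \<in> cl (AA \<union> Y) \<longrightarrow> x \<in> cl (C \<inter> AA \<union> Y))"

lemma free_from_A_D:
  "free_from_A C \<Longrightarrow> Y \<subseteq> C \<Longrightarrow> x \<in> C \<Longrightarrow> x \<in> cl (AA \<union> Y) \<Longrightarrow> x \<in> cl (C \<inter> AA \<union> Y)"
  by (auto simp: free_from_A_def)

text \<open>The instance Y = X - {x} of freeness gives exactly the form that a Mordell-Lang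
  contender asks for.\<close>

lemma free_over_if_free_from_A:
  assumes "C \<subseteq> B" "free_from_A C"
  shows "free_over L\<beta> M C (C \<inter> AA) AA"
  unfolding free_over_def indep_over_def
proof (intro allI impI ballI notI)
  fix X x assume X: "X \<subseteq> C" "\<forall>x\<in>X. x \<notin> cl (C \<inter> AA \<union> (X - {x}))"
    and x: "x \<in> X" "x \<in> cl (AA \<union> C \<inter> AA \<union> (X - {x}))"
  have "AA \<union> C \<inter> AA \<union> (X - {x}) = AA \<union> (X - {x})" by auto
  with x have "x \<in> cl (AA \<union> (X - {x}))" by simp
  then have "x \<in> cl (C \<inter> AA \<union> (X - {x}))"
    using X x by - (rule free_from_A_D[OF assms(2)], auto)
  with X x show False by blast
qed

text \<open>A point of A is absorbed by \<open>AA\<close> on one side and by the enlarged base on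
  the other, so it can be removed from Y.\<close>

lemma free_insert_A:
  assumes "C \<subseteq> B" "free_from_A C" "a \<in> AA"
  shows "free_from_A (insert a C)"
  unfolding free_from_A_def
proof (intro allI impI ballI)
  fix Y x assume Y: "Y \<subseteq> insert a C" and x: "x \<in> insert a C" "x \<in> cl (AA \<union> Y)"
  have sub: "insert a C \<inter> AA \<union> Y \<subseteq> B" using assms Y AA_subset by auto
  show "x \<in> cl (insert a C \<inter> AA \<union> Y)"
  proof (cases "x = a")
    case True
    then show ?thesis using cl_ext[OF sub] assms by auto
  next
    case False
    have "AA \<union> Y = AA \<union> (Y - {a})" using assms by auto
    then have "x \<in> cl (C \<inter> AA \<union> (Y - {a}))"
      using x Y False by - (rule free_from_A_D[OF assms(2)], auto)
    moreover have "C \<inter> AA \<union> (Y - {a}) \<subseteq> insert a C \<inter> AA \<union> Y" by auto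
    ultimately show ?thesis using cl_mono[OF _ sub] by blast
  qed
qed

text \<open>If a point of C needed b to become algebraic over \<open>AA\<close> and Y, exchange
  would make b algebraic over \<open>AA\<close> and C. Hence b can be removed from Y.\<close>

lemma free_insert_generic:
  assumes "C \<subseteq> B" "free_from_A C" "b \<in> B" "b \<notin> cl (AA \<union> C)"
  shows "free_from_A (insert b C)"
  unfolding free_from_A_def
proof (intro allI impI ballI)
  fix Y x assume Y: "Y \<subseteq> insert b C" and x: "x \<in> insert b C" "x \<in> cl (AA \<union> Y)"
  have sub: "insert b C \<inter> AA \<union> Y \<subseteq> B" using assms Y AA_subset by auto
  have subA: "AA \<union> C \<subseteq> B" using assms AA_subset by auto
  show "x \<in> cl (insert b C \<inter> AA \<union> Y)"
  proof (cases "x = b \<and> b \<in> Y")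
    case True
    then show ?thesis using cl_ext[OF sub] by auto
  next
    case False
    have xC: "x \<in> C"
    proof (rule ccontr)
      assume "x \<notin> C"
      then have "x = b" "Y \<subseteq> C" using False x Y by auto
      then show False using assms(4) x cl_mono[OF _ subA, of "AA \<union> Y"] by auto
    qed
    have "x \<in> cl (AA \<union> (Y - {b}))"
    proof (rule ccontr)
      assume n: "x \<notin> cl (AA \<union> (Y - {b}))"
      have "AA \<union> Y \<subseteq> insert b (AA \<union> (Y - {b}))" by auto
      then have "x \<in> cl (insert b (AA \<union> (Y - {b})))"
        using x cl_mono[of "AA \<union> Y" "insert b (AA \<union> (Y - {b}))"] Y assms AA_subset by auto
      then have "b \<in> cl (insert x (AA \<union> (Y - {b})))"
        using n xC Y assms AA_subset by - (rule cl_exchange, auto)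
      moreover have "insert x (AA \<union> (Y - {b})) \<subseteq> AA \<union> C" using xC Y by auto
      ultimately show False using assms(4) cl_mono[OF _ subA] by blast
    qed
    then have "x \<in> cl (C \<inter> AA \<union> (Y - {b}))"
      using xC Y by - (rule free_from_A_D[OF assms(2)], auto)
    moreover have "C \<inter> AA \<union> (Y - {b}) \<subseteq> insert b C \<inter> AA \<union> Y" by auto
    ultimately show ?thesis using cl_mono[OF _ sub] by blast
  qed
qed

text \<open>A maximality argument replaces a dimension count. Let Z be maximal between Y and C with
  b outside the closure of Z over the base. As b is algebraic over C, some z in C is missing from Z,
  and adding z captures b. By exchange z depends on b, and b depends on \<open>AA\<close> and Z, so
  freeness of C puts z into the closure of Z over the base, and b follows.\<close>

lemma free_insert_algebraic_aux:
  assumes C: "C \<subseteq> B" "finite C" "free_from_A C" and b: "b \<in> cl C" "b \<in> B"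
    and Y: "Y \<subseteq> C" "b \<in> cl (AA \<union> Y)"
  shows "b \<in> cl (C \<inter> AA \<union> Y)"
proof (rule ccontr)
  assume n: "b \<notin> cl (C \<inter> AA \<union> Y)"
  let ?S = "{Z. Y \<subseteq> Z \<and> Z \<subseteq> C \<and> b \<notin> cl (C \<inter> AA \<union> Z)}"
  have "finite ?S" by (rule finite_subset[of _ "Pow C"]) (use C in auto)
  moreover have "Y \<in> ?S" using n Y by auto
  ultimately have "\<exists>Z\<in>?S. \<forall>Z'\<in>?S. Z \<subseteq> Z' \<longrightarrow> Z = Z'"
    by (intro finite_has_maximal) (simp, metis empty_iff)
  then obtain Z where Z: "Z \<in> ?S" and max: "\<forall>Z'\<in>?S. Z \<subseteq> Z' \<longrightarrow> Z = Z'"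
    by (rule bexE)
  have "C \<inter> AA \<union> C = C" by auto
  then have "Z \<noteq> C" using Z b by auto
  then obtain z where z: "z \<in> C" "z \<notin> Z" using Z by auto
  have "insert z Z \<notin> ?S" using bspec[OF max, of "insert z Z"] z by auto
  then have "b \<in> cl (insert z (C \<inter> AA \<union> Z))" using Z z by auto
  then have zb: "z \<in> cl (insert b (C \<inter> AA \<union> Z))"
    using Z z b C by - (rule cl_exchange, auto)
  have AZ: "AA \<union> Z \<subseteq> B" using Z C AA_subset by auto
  have "AA \<union> Y \<subseteq> AA \<union> Z" using Z by auto
  then have bZ: "b \<in> cl (AA \<union> Z)" using Y cl_mono[OF _ AZ] by blast
  have "insert b (C \<inter> AA \<union> Z) \<subseteq> insert b (AA \<union> Z)" by auto
  then have "z \<in> cl (insert b (AA \<union> Z))" using zb cl_mono AZ b by (meson insert_subset subsetD)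
  then have "z \<in> cl (AA \<union> Z)" using cl_insert_trans[OF bZ AZ] by auto
  then have "z \<in> cl (C \<inter> AA \<union> Z)" using Z z by - (rule free_from_A_D[OF C(3)], auto)
  then have "cl (insert z (C \<inter> AA \<union> Z)) \<subseteq> cl (C \<inter> AA \<union> Z)"
    using Z C by (intro cl_insert_trans) auto
  with \<open>b \<in> cl (insert z (C \<inter> AA \<union> Z))\<close> Z show False by auto
qed

text \<open>Points algebraic over \<open>AA\<close> and Z = Y - {b} are handled by freeness of C or
  by the auxiliary lemma. For any other x in C, exchange over \<open>AA\<close> makes b depend on x,
  the auxiliary lemma moves this dependence down to the base, and a second exchange there makes x
  depend on b.\<close>

lemma free_insert_algebraic:
  assumes C: "C \<subseteq> B" "finite C" "free_from_A C" and b: "b \<in> cl C" "b \<in> B"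
  shows "free_from_A (insert b C)"
  unfolding free_from_A_def
proof (intro allI impI ballI)
  fix Y x assume Y: "Y \<subseteq> insert b C" and x: "x \<in> insert b C" "x \<in> cl (AA \<union> Y)"
  define Z where "Z = Y - {b}"
  have Z: "Z \<subseteq> C" using Y by (auto simp: Z_def)
  note aux = free_insert_algebraic_aux[OF C b]
  have sub: "insert b C \<inter> AA \<union> Y \<subseteq> B" using C b Y AA_subset by auto
  have up: "cl (C \<inter> AA \<union> Z) \<subseteq> cl (insert b C \<inter> AA \<union> Y)"
    by (rule cl_mono[OF _ sub]) (auto simp: Z_def)
  have AZ: "AA \<union> Z \<subseteq> B" "C \<inter> AA \<union> Z \<subseteq> B" using Z C AA_subset by auto
  show "x \<in> cl (insert b C \<inter> AA \<union> Y)"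
  proof (cases "x \<in> cl (AA \<union> Z)")
    case True
    then have "x \<in> cl (C \<inter> AA \<union> Z)"
      using x(1) aux[OF Z] free_from_A_D[OF C(3) Z] by auto
    then show ?thesis using up by auto
  next
    case False
    have bY: "b \<in> Y"
    proof (rule ccontr)
      assume "b \<notin> Y"
      then have "Z = Y" by (auto simp: Z_def)
      with False x show False by simp
    qed
    show ?thesis
    proof (cases "x = b")
      case True
      then show ?thesis using bY cl_ext[OF sub] by auto
    next
      case xb: False
      then have xC: "x \<in> C" using x by auto
      have "AA \<union> Y = insert b (AA \<union> Z)" using bY by (auto simp: Z_def)
      then have xb': "x \<in> cl (insert b (AA \<union> Z))" using x by simp
      then have nb: "b \<notin> cl (AA \<union> Z)" using cl_insert_trans[OF _ AZ(1)] False by blast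
      have "b \<in> cl (insert x (AA \<union> Z))"
        using xb' False AZ xC C b by - (rule cl_exchange, auto)
      then have "b \<in> cl (AA \<union> insert x Z)" by simp
      then have "b \<in> cl (C \<inter> AA \<union> insert x Z)" using Z xC by - (rule aux, auto)
      then have "b \<in> cl (insert x (C \<inter> AA \<union> Z))" by simp
      moreover have "b \<notin> cl (C \<inter> AA \<union> Z)"
        using nb cl_mono[OF _ AZ(1), of "C \<inter> AA \<union> Z"] by auto
      ultimately have "x \<in> cl (insert b (C \<inter> AA \<union> Z))"
        using AZ xC C b by - (rule cl_exchange, auto)
      moreover have "insert b (C \<inter> AA \<union> Z) \<subseteq> insert b C \<inter> AA \<union> Y" using bY by (auto simp: Z_def)
      ultimately show ?thesis using cl_mono[OF _ sub] by blast
    qed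
  qed
qed

text \<open>Only finitely many pairs of a subset Y and a point x of C0 can violate freeness. By
  finite character each dependence over A uses finitely many elements of A, and all of these are
  added.\<close>

lemma extend_to_free:
  assumes "C0 \<subseteq> B" "finite C0"
  obtains C where "C0 \<subseteq> C" "finite C" "C \<subseteq> B" "free_from_A C"
proof -
  define I where "I = {(Y, x). Y \<subseteq> C0 \<and> x \<in> C0 \<and> x \<in> cl (AA \<union> Y)}"
  have "finite I"
    by (rule finite_subset[of _ "Pow C0 \<times> C0"]) (use assms in \<open>auto simp: I_def\<close>)
  have "\<exists>X\<subseteq>AA. finite X \<and> x \<in> cl (X \<union> Y)" if "(Y, x) \<in> I" for Y x
  proof -
    have Y: "Y \<subseteq> C0" "x \<in> cl (AA \<union> Y)" using that by (auto simp: I_def)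
    have sub: "AA \<union> Y \<subseteq> B" using Y assms AA_subset by auto
    then obtain X where X: "X \<subseteq> AA \<union> Y" "finite X" "x \<in> cl X" using cl_finite Y by meson
    have "X \<subseteq> X \<inter> AA \<union> Y" "X \<inter> AA \<union> Y \<subseteq> B" using X sub by auto
    then have "x \<in> cl (X \<inter> AA \<union> Y)" using X cl_mono by blast
    then show ?thesis using X by (intro exI[of _ "X \<inter> AA"]) auto
  qed
  then have "\<forall>i\<in>I. \<exists>X. X \<subseteq> AA \<and> finite X \<and> snd i \<in> cl (X \<union> fst i)" by auto
  from bchoice[OF this] obtain F where
    F: "\<And>Y x. (Y, x) \<in> I \<Longrightarrow> F (Y, x) \<subseteq> AA \<and> finite (F (Y, x)) \<and> x \<in> cl (F (Y, x) \<union> Y)"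
    by fastforce
  define C where "C = C0 \<union> \<Union>(F ` I)"
  have FA: "\<Union>(F ` I) \<subseteq> AA" using F by force
  have finC: "finite C" using assms \<open>finite I\<close> F by (force simp: C_def)
  have CB: "C \<subseteq> B" using assms FA AA_subset by (auto simp: C_def)
  have "free_from_A C"
    unfolding free_from_A_def
  proof (intro allI impI ballI)
    fix Y x assume Y: "Y \<subseteq> C" and x: "x \<in> C" "x \<in> cl (AA \<union> Y)"
    have sub: "C \<inter> AA \<union> Y \<subseteq> B" using Y CB AA_subset by auto
    show "x \<in> cl (C \<inter> AA \<union> Y)"
    proof (cases "x \<in> AA")
      case True
      then show ?thesis using cl_ext[OF sub] x by auto
    next
      case False
      \<comment> \<open>The added points lie in A, so subsets of C give the same closures over A as
        subsets of C0, and \<open>I\<close> lists all dependences over the latter.\<close>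
      have "AA \<union> Y = AA \<union> (Y \<inter> C0)" using Y FA by (auto simp: C_def)
      with x False FA have I: "(Y \<inter> C0, x) \<in> I" by (auto simp: I_def C_def)
      then have "x \<in> cl (F (Y \<inter> C0, x) \<union> (Y \<inter> C0))" using F by blast
      moreover have "F (Y \<inter> C0, x) \<union> (Y \<inter> C0) \<subseteq> C \<inter> AA \<union> Y"
        using I F[OF I] by (auto simp: C_def)
      ultimately show ?thesis using cl_mono[OF _ sub] by blast
    qed
  qed
  then show thesis using that[of C] finC CB by (auto simp: C_def)
qed

subsection \<open>Saturation\<close>

lemma countable_less_\<kappa>: "countable C \<Longrightarrow> |C| <o \<kappa>"
proof -
  assume "countable C"
  then have "|C| \<le>o |UNIV :: nat set|" 
    using card_of_ordLeq[of C "UNIV :: nat set"] by (auto simp: countable_def)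
  also have "|UNIV :: nat set| =o natLeq" by (rule card_of_nat)
  also have "natLeq \<le>o lang_card L2"
    unfolding lang_card_def by (rule ordLeq_csum2) (rule natLeq_Card_order)
  finally show ?thesis using lang_card_less by (rule ordLeq_ordLess_trans)
qed

lemma saturation_partial:
  assumes "|C| <o \<kappa>" "C \<subseteq> B" "p \<subseteq> pformulas L2 C"
    and "\<And>p0. p0 \<subseteq> p \<Longrightarrow> finite p0 \<Longrightarrow> \<exists>b\<in>B. prealizes M b p0"
  shows "\<exists>b\<in>B. prealizes M b p"
proof -
  obtain q where q: "unary_type L2 M C q" "p \<subseteq> q" using exists_complete_type[OF assms(3,4)] by blast
  then obtain b where "b \<in> B" "prealizes M b q"
    using saturated_M assms(1,2) unfolding saturated_def by blast
  with q show ?thesis by (auto simp: prealizes_def)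
qed

text \<open>Infinitude comes from the topology: B is covered by basic sets, and the nonempty ones
  are infinite.\<close>

lemma infinite_B: "infinite B"
proof -
  have top: "\<Union>(tau_basis M n \<tau>) = B" "\<forall>S\<in>tau_basis M n \<tau>. S = {} \<or> infinite S"
    using topology models_beta by (auto simp: definable_topology_def)
  then obtain S where "S \<in> tau_basis M n \<tau>" "S \<noteq> {}" using B_nonempty by auto
  then have "infinite S" "S \<subseteq> B" using top by auto
  then show ?thesis using finite_subset by blast
qed

text \<open>With fewer than \<kappa> elements, the type saying that x differs from every element of
  B would have an admissible parameter set; it is finitely satisfiable because B is
  infinite.\<close>

lemma \<kappa>_le_B: "\<kappa> \<le>o |B|"
proof (rule ccontr)
  assume "\<not> \<kappa> \<le>o |B|"
  then have less: "|B| <o \<kappa>"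
    using Card_order_\<kappa> not_ordLeq_iff_ordLess card_order_on_well_order_on card_of_Well_order by blast
  define p where "p = (\<lambda>b. (Neg (Eq (Var 0) (Var 1)) :: ('f, 'r) fm, \<lambda>_ :: nat. b)) ` B"
  have psat: "psat M x (Neg (Eq (Var 0) (Var 1)), \<lambda>_. b) \<longleftrightarrow> x \<noteq> b" for x b
    by (simp add: psat_Pair)
  have "\<exists>b\<in>B. prealizes M b p"
  proof (rule saturation_partial[OF less])
    show "p \<subseteq> pformulas L2 B" by (auto simp: p_def pformulas_def)
    fix p0 assume "p0 \<subseteq> p" "finite p0"
    then obtain X where X: "X \<subseteq> B" "finite X"
      "p0 = (\<lambda>b. (Neg (Eq (Var 0) (Var 1)), \<lambda>_. b)) ` X"
      unfolding p_def by (meson finite_subset_image)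
    obtain x where "x \<in> B" "x \<notin> X" using infinite_B X by (meson finite_subset subsetI)
    then show "\<exists>b\<in>B. prealizes M b p0" using X psat by (auto simp: prealizes_def)
  qed auto
  then show False by (auto simp: prealizes_def p_def psat_Pair)
qed

text \<open>The density and codensity conditions range over cardinals on the type of elements, while
  \<kappa> lives on an arbitrary type. Since \<kappa> is at most the size of B, a subset of B
  provides an equivalent cardinal.\<close>

lemma \<kappa>_on_elements:
  obtains \<kappa>' :: "'b rel" where "Card_order \<kappa>'" "lang_card L2 <o \<kappa>'" "saturated \<kappa>' L2 M"
    "\<And>C :: 'b set. countable C \<Longrightarrow> |C| <o \<kappa>'"
proof -
  have "|Field \<kappa>| =o \<kappa>" by (rule card_of_Field_ordIso) (rule Card_order_\<kappa>)
  then have "|Field \<kappa>| \<le>o |B|" using \<kappa>_le_B ordIso_ordLeq_trans by blast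
  then obtain Y :: "'b set" where "|Field \<kappa>| =o |Y|"
    using internalize_card_of_ordLeq[of "Field \<kappa>" "|B|"] by auto
  with \<open>|Field \<kappa>| =o \<kappa>\<close> have iso: "\<kappa> =o |Y|" 
    using ordIso_transitive[OF ordIso_symmetric] by blast
  show thesis
  proof (rule that[of "|Y|"])
    show "lang_card L2 <o |Y|" using lang_card_less iso by (rule ordLess_ordIso_trans)
    have "|C| <o \<kappa>" if "|C| <o |Y|" for C :: "'b set"
      using that ordIso_symmetric[OF iso] by (rule ordLess_ordIso_trans)
    then show "saturated |Y| L2 M" using saturated_M by (auto simp: saturated_def)
    show "|C| <o |Y|" if "countable C" for C :: "'b set"
      using countable_less_\<kappa>[OF that] iso by (rule ordLess_ordIso_trans)
  qed (rule card_of_Card_order)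
qed

lemma saturation_variable:
  assumes "range c \<subseteq> B" "Q \<subseteq> formulas L2"
    and fin: "\<And>F. F \<subseteq> Q \<Longrightarrow> finite F \<Longrightarrow> \<exists>b\<in>B. \<forall>\<phi>\<in>F. sat M (c(x := b)) \<phi>"
  shows "\<exists>b\<in>B. \<forall>\<phi>\<in>Q. sat M (c(x := b)) \<phi>"
proof -
  define \<theta> where "\<theta> \<phi> = (subst \<phi> (\<lambda>i. if i = x then 0 else Suc i), case_nat (c 0) c)"
    for \<phi> :: "('f, 'r) fm"
  have psat: "psat M b (\<theta> \<phi>) = sat M (c(x := b)) \<phi>" for b \<phi>
    unfolding \<theta>_def psat_Pair sat_subst by (rule sat_cong) auto
  have "\<exists>b\<in>B. prealizes M b (\<theta> ` Q)"
  proof (rule saturation_partial[of "range c"])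
    \<comment> \<open>An assignment has countable range and \<kappa> is uncountable, so all values
      of c may be parameters at once.\<close>
    show "|range c| <o \<kappa>" by (rule countable_less_\<kappa>) auto
    show "\<theta> ` Q \<subseteq> pformulas L2 (range c)"
      using assms(2) by (auto simp: \<theta>_def pformulas_def split: nat.splits)
    fix p0 assume "p0 \<subseteq> \<theta> ` Q" "finite p0"
    then obtain F where "F \<subseteq> Q" "finite F" "p0 = \<theta> ` F" by (meson finite_subset_image)
    with fin[of F] show "\<exists>b\<in>B. prealizes M b p0" by (auto simp: prealizes_def psat)
  qed fact
  then show ?thesis by (auto simp: prealizes_def psat)
qed

text \<open>The unknowns are found one at a time. The value for x realizes, for every finite part F
  of Q, the formula saying that the remaining unknowns can be completed to satisfy F; this is
  precisely the finite satisfiability needed for the remaining unknowns.\<close>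

lemma saturation_tuple:
  assumes "finite X" "range c \<subseteq> B" "Q \<subseteq> formulas L2"
    and "\<And>F. F \<subseteq> Q \<Longrightarrow> finite F \<Longrightarrow>
      \<exists>e. (\<forall>i. i \<notin> X \<longrightarrow> e i = c i) \<and> range e \<subseteq> B \<and> (\<forall>\<phi>\<in>F. sat M e \<phi>)"
  shows "\<exists>e. (\<forall>i. i \<notin> X \<longrightarrow> e i = c i) \<and> range e \<subseteq> B \<and> (\<forall>\<phi>\<in>Q. sat M e \<phi>)"
  using assms
proof (induction X arbitrary: c)
  case empty
  have "sat M c \<phi>" if "\<phi> \<in> Q" for \<phi>
  proof -
    obtain e where e: "\<forall>i. e i = c i" "sat M e \<phi>" using empty.prems(3)[of "{\<phi>}"] \<open>\<phi> \<in> Q\<close> by auto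
    then have "e = c" by auto
    with e show ?thesis by simp
  qed
  with empty.prems show ?case by auto
next
  case (insert x X)
  define ext where "ext F e \<longleftrightarrow>
    (\<exists>e'. (\<forall>i. i \<notin> X \<longrightarrow> e' i = e i) \<and> range e' \<subseteq> B \<and> (\<forall>\<phi>\<in>F. sat M e' \<phi>))" for F e
  have ext_fm: "\<exists>\<psi>\<in>formulas L2. \<forall>e. range e \<subseteq> B \<longrightarrow> sat M e \<psi> = ext F e"
    if F: "F \<subseteq> Q" "finite F" for F
  proof -
    have sub: "F \<subseteq> formulas L2" using F insert.prems(2) by auto
    define \<eta> where "\<eta> = Conj_set F"
    have \<eta>: "\<eta> \<in> formulas L2" using F(2) sub by (simp add: \<eta>_def Conj_set_formulas)
    have "sat M e (Neg (Forall_set X (Neg \<eta>))) = ext F e" if e: "range e \<subseteq> B" for e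
    proof -
      have "range e' \<subseteq> B \<longleftrightarrow> e' ` X \<subseteq> B" if "\<forall>i. i \<notin> X \<longrightarrow> e' i = e i" for e'
        using that e by (auto simp: image_subset_iff)
      then show ?thesis using insert.hyps(1) F(2)
        unfolding ext_def \<eta>_def sat_Neg sat_Forall_set[OF insert.hyps(1)] sat_Conj_set[OF F(2)] by blast
    qed
    with \<eta> show ?thesis by (intro bexI[of _ "Neg (Forall_set X (Neg \<eta>))"]) auto
  qed
  define Q' where "Q' = {\<psi> \<in> formulas L2. \<exists>F\<subseteq>Q. finite F \<and> (\<forall>e. range e \<subseteq> B \<longrightarrow> sat M e \<psi> = ext F e)}"
  have "\<exists>b\<in>B. \<forall>\<psi>\<in>Q'. sat M (c(x := b)) \<psi>"
  proof (rule saturation_variable)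
    show "range c \<subseteq> B" by (rule insert.prems)
    show "Q' \<subseteq> formulas L2" by (auto simp: Q'_def)
    fix G assume G: "G \<subseteq> Q'" "finite G"
    then have "\<forall>\<psi>\<in>G. \<exists>F. F \<subseteq> Q \<and> finite F \<and> (\<forall>e. range e \<subseteq> B \<longrightarrow> sat M e \<psi> = ext F e)"
      by (auto simp: Q'_def)
    from bchoice[OF this] obtain f where
      f: "\<forall>\<psi>\<in>G. f \<psi> \<subseteq> Q \<and> finite (f \<psi>) \<and> (\<forall>e. range e \<subseteq> B \<longrightarrow> sat M e \<psi> = ext (f \<psi>) e)" ..
    have "\<Union>(f ` G) \<subseteq> Q" "finite (\<Union>(f ` G))" using f G by auto
    from insert.prems(3)[OF this] obtain e where
      e: "\<forall>i. i \<notin> insert x X \<longrightarrow> e i = c i" "range e \<subseteq> B" "\<forall>\<phi>\<in>\<Union>(f ` G). sat M e \<phi>" by blast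
    have "sat M (c(x := e x)) \<psi>" if "\<psi> \<in> G" for \<psi>
    proof -
      have "ext (f \<psi>) (c(x := e x))"
        unfolding ext_def by (rule exI[of _ e]) (use e that in auto)
      moreover have "range (c(x := e x)) \<subseteq> B" using insert.prems(1) e(2) by auto
      ultimately show ?thesis using f that by auto
    qed
    moreover have "e x \<in> B" using e(2) by auto
    ultimately show "\<exists>b\<in>B. \<forall>\<psi>\<in>G. sat M (c(x := b)) \<psi>" by blast
  qed
  then obtain b where b: "b \<in> B" "\<And>\<psi>. \<psi> \<in> Q' \<Longrightarrow> sat M (c(x := b)) \<psi>" by blast
  have rc: "range (c(x := b)) \<subseteq> B" using insert.prems(1) b by auto
  have "\<exists>e. (\<forall>i. i \<notin> X \<longrightarrow> e i = (c(x := b)) i) \<and> range e \<subseteq> B \<and> (\<forall>\<phi>\<in>Q. sat M e \<phi>)"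
  proof (rule insert.IH[OF rc insert.prems(2)])
    fix F assume F: "F \<subseteq> Q" "finite F"
    from ext_fm[OF this] obtain \<psi> where
      \<psi>: "\<psi> \<in> formulas L2" "\<forall>e. range e \<subseteq> B \<longrightarrow> sat M e \<psi> = ext F e" ..
    then have "\<psi> \<in> Q'" using F by (auto simp: Q'_def)
    then have "ext F (c(x := b))" using \<psi>(2) rc b(2) by blast
    then show "\<exists>e. (\<forall>i. i \<notin> X \<longrightarrow> e i = (c(x := b)) i) \<and> range e \<subseteq> B \<and> (\<forall>\<phi>\<in>F. sat M e \<phi>)"
      by (simp only: ext_def)
  qed
  then obtain e where "\<forall>i. i \<notin> X \<longrightarrow> e i = (c(x := b)) i" "range e \<subseteq> B" "\<forall>\<phi>\<in>Q. sat M e \<phi>" by blast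
  then show ?case by (intro exI[of _ e]) auto
qed

section \<open>Codensity and elimination of infinity\<close>

lemma codensity_type:
  assumes C: "finite C" "C \<subseteq> B" and q: "unary_type L\<beta> M C q" "nonalgebraic M q"
  obtains b where "b \<in> B" "b \<notin> cl (AA \<union> C)" "prealizes M b q"
proof -
  obtain \<kappa>' :: "'b rel" where \<kappa>': "Card_order \<kappa>'" "lang_card L2 <o \<kappa>'" "saturated \<kappa>' L2 M"
    "\<And>C :: 'b set. countable C \<Longrightarrow> |C| <o \<kappa>'" by (rule \<kappa>_on_elements) blast
  have "codensity_condition TYPE('b) A L\<alpha> L\<beta> T" using ml_theory by (simp add: mordell_lang_theory_def)
  moreover have "|C| <o \<kappa>'" by (rule \<kappa>'(4)) (use C in \<open>simp add: countable_finite\<close>)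
  ultimately have "\<exists>b\<in>B - cl (AA \<union> C). prealizes M b q"
    unfolding codensity_condition_def using models_T \<kappa>'(1-3) C q by blast
  with that show thesis by blast
qed

text \<open>To reach a non-algebraic complete type, the negations of all algebraic formulas are
  added to \<eta>. Finitely many of them exclude only finitely many points, and \<eta> has
  infinitely many solutions.\<close>

lemma codensity:
  assumes \<eta>: "\<eta> \<in> formulas L\<beta>" and c: "range c \<subseteq> B"
    and inf: "infinite {a \<in> B. sat M (c(x := a)) \<eta>}" and D: "finite D" "D \<subseteq> B"
  obtains b where "b \<in> B" "sat M (c(x := b)) \<eta>" "b \<notin> cl (AA \<union> D)"
proof -
  \<comment> \<open>C contains both the set to be avoided and the parameters of \<eta>.\<close>
  define C where "C = D \<union> c ` fv \<eta>"
  define \<theta> where "\<theta> = (subst \<eta> (\<lambda>i. if i = x then 0 else Suc i), case_nat (c 0) c)"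
  have psat: "psat M b \<theta> = sat M (c(x := b)) \<eta>" for b
    unfolding \<theta>_def psat_Pair sat_subst by (rule sat_cong) auto
  define N where "N = (\<lambda>(\<phi>, e). (Neg \<phi>, e)) ` {\<theta> \<in> pformulas L\<beta> C. finite (psolutions M \<theta>)}"
  have C: "C \<subseteq> B" "finite C" using c D by (auto simp: C_def)
  obtain q where q: "unary_type L\<beta> M C q" "insert \<theta> N \<subseteq> q"
  proof (rule exists_complete_type)
    have "\<theta> \<in> pformulas L\<beta> C"
      using \<eta> fv_subst[of \<eta> "\<lambda>i. if i = x then 0 else Suc i"]
      by (fastforce simp: \<theta>_def pformulas_def C_def split: if_splits)
    then show "insert \<theta> N \<subseteq> pformulas L\<beta> C" by (auto simp: N_def pformulas_def image_subset_iff)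
    fix p0 assume p0: "p0 \<subseteq> insert \<theta> N" "finite p0"
    have "finite {b \<in> B. \<not> psat M b \<theta>'}" if "\<theta>' \<in> N" for \<theta>'
      using that by (auto simp: N_def psolutions_def psat_Pair)
    then have "finite (\<Union>\<theta>'\<in>p0 \<inter> N. {b \<in> B. \<not> psat M b \<theta>'})" using p0 by auto
    with inf have "infinite ({a \<in> B. sat M (c(x := a)) \<eta>} - (\<Union>\<theta>'\<in>p0 \<inter> N. {b \<in> B. \<not> psat M b \<theta>'}))"
      by (rule Diff_infinite_finite[rotated])
    then obtain b where "b \<in> B" "sat M (c(x := b)) \<eta>" "\<forall>\<theta>'\<in>p0 \<inter> N. psat M b \<theta>'"
      by (auto dest!: infinite_imp_nonempty)
    with p0 show "\<exists>b\<in>B. prealizes M b p0" unfolding prealizes_def using psat by blast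
  qed
  have "nonalgebraic M q"
    unfolding nonalgebraic_def
  proof (intro ballI notI)
    fix \<theta>' assume \<theta>': "\<theta>' \<in> q" "finite (psolutions M \<theta>')"
    obtain \<phi> e where [simp]: "\<theta>' = (\<phi>, e)" by (cases \<theta>')
    have "(\<phi>, e) \<in> pformulas L\<beta> C" using \<theta>' q(1) by (auto simp: unary_type_def)
    then have "(Neg \<phi>, e) \<in> N" using \<theta>'(2) by (force simp: N_def)
    then have "{(\<phi>, e), (Neg \<phi>, e)} \<subseteq> q" using \<theta>' q(2) by auto
    then have "\<exists>b\<in>B. prealizes M b {(\<phi>, e), (Neg \<phi>, e)}" using q(1) unfolding unary_type_def by blast
    then show False by (auto simp: prealizes_def psat_Pair)
  qed
  obtain b where b: "b \<in> B" "b \<notin> cl (AA \<union> C)" "prealizes M b q"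
    using codensity_type[OF C(2,1) q(1) \<open>nonalgebraic M q\<close>] by blast
  have "AA \<union> C \<subseteq> B" "AA \<union> D \<subseteq> AA \<union> C" using C AA_subset by (auto simp: C_def)
  then have "cl (AA \<union> D) \<subseteq> cl (AA \<union> C)" by (intro cl_mono)
  moreover have "psat M b \<theta>" using b q by (auto simp: prealizes_def)
  ultimately show thesis using that b psat by blast
qed

text \<open>One formula works for all models of \<open>T\<beta>\<close> on this type. So finiteness
  of a fibre is recorded in the \<open>L\<beta>\<close>-type of the parameters and carries over to
  any other realization of that type.\<close>

definition Infinite :: "nat \<Rightarrow> ('f, 'r) fm \<Rightarrow> ('f, 'r) fm" where
  "Infinite x \<phi> = (SOME \<psi>. \<psi> \<in> formulas L\<beta> \<and> fv \<psi> \<subseteq> fv \<phi> - {x} \<and>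
     (\<forall>(N :: ('f, 'r, 'b) struct) e. models L\<beta> N T\<beta> \<and> range e \<subseteq> univ N \<longrightarrow>
        (infinite {a \<in> univ N. sat N (e(x := a)) \<phi>} \<longleftrightarrow> sat N e \<psi>)))"

lemma Infinite:
  assumes "\<phi> \<in> formulas L\<beta>"
  shows "Infinite x \<phi> \<in> formulas L\<beta>" "fv (Infinite x \<phi>) \<subseteq> fv \<phi> - {x}"
    "\<And>(N :: ('f, 'r, 'b) struct) e. models L\<beta> N T\<beta> \<Longrightarrow> range e \<subseteq> univ N \<Longrightarrow>
       sat N e (Infinite x \<phi>) \<longleftrightarrow> infinite {a \<in> univ N. sat N (e(x := a)) \<phi>}"
proof -
  have "eliminates_exists_inf TYPE('b) L\<beta> T\<beta>"
    using setting by (simp add: pair_setting_def geometric_def)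
  with assms have "\<exists>\<psi>\<in>formulas L\<beta>. fv \<psi> \<subseteq> fv \<phi> - {x} \<and>
        (\<forall>(N :: ('f, 'r, 'b) struct) e. models L\<beta> N T\<beta> \<and> range e \<subseteq> univ N \<longrightarrow>
           (infinite {a \<in> univ N. sat N (e(x := a)) \<phi>} \<longleftrightarrow> sat N e \<psi>))"
    unfolding eliminates_exists_inf_def by blast
  then have *: "Infinite x \<phi> \<in> formulas L\<beta> \<and> fv (Infinite x \<phi>) \<subseteq> fv \<phi> - {x} \<and>
        (\<forall>(N :: ('f, 'r, 'b) struct) e. models L\<beta> N T\<beta> \<and> range e \<subseteq> univ N \<longrightarrow>
           (infinite {a \<in> univ N. sat N (e(x := a)) \<phi>} \<longleftrightarrow> sat N e (Infinite x \<phi>)))"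
    unfolding Infinite_def Bex_def by (rule someI_ex)
  show "Infinite x \<phi> \<in> formulas L\<beta>" by (rule *[THEN conjunct1])
  show "fv (Infinite x \<phi>) \<subseteq> fv \<phi> - {x}" by (rule *[THEN conjunct2, THEN conjunct1])
  show "sat N e (Infinite x \<phi>) \<longleftrightarrow> infinite {a \<in> univ N. sat N (e(x := a)) \<phi>}"
    if "models L\<beta> N T\<beta>" "range e \<subseteq> univ N" for N :: "('f, 'r, 'b) struct" and e
    using *[THEN conjunct2, THEN conjunct2] that by simp
qed

subsection \<open>Back and forth\<close>

text \<open>Tuples are initial segments of total assignments, so \<open>sat\<close> applies to them
  directly, and the bound on the free variables hides the remaining values. Both tuples live in M:
  the system compares tuples of one model.\<close>

definition bf :: "nat \<Rightarrow> (nat \<Rightarrow> 'b) \<Rightarrow> (nat \<Rightarrow> 'b) \<Rightarrow> bool" where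
  "bf k c c' \<longleftrightarrow> range c \<subseteq> B \<and> range c' \<subseteq> B \<and>
     (\<forall>\<phi>\<in>formulas L\<beta>. fv \<phi> \<subseteq> {..<k} \<longrightarrow> sat M c \<phi> = sat M c' \<phi>) \<and>
     (\<forall>i<k. c i \<in> AA \<longleftrightarrow> c' i \<in> AA) \<and>
     (\<forall>\<phi>\<in>formulas L\<alpha>. fv \<phi> \<subseteq> {i. i < k \<and> c i \<in> AA} \<longrightarrow> sat AM c \<phi> = sat AM c' \<phi>) \<and>
     free_from_A (c ` {..<k}) \<and> free_from_A (c' ` {..<k})"

lemma bfD:
  assumes "bf k c c'"
  shows "range c \<subseteq> B" "range c' \<subseteq> B"
    "\<And>\<phi>. \<phi> \<in> formulas L\<beta> \<Longrightarrow> fv \<phi> \<subseteq> {..<k} \<Longrightarrow> sat M c \<phi> = sat M c' \<phi>"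
    "\<And>i. i < k \<Longrightarrow> c i \<in> AA \<longleftrightarrow> c' i \<in> AA"
    "\<And>\<phi>. \<phi> \<in> formulas L\<alpha> \<Longrightarrow> fv \<phi> \<subseteq> {i. i < k \<and> c i \<in> AA} \<Longrightarrow> sat AM c \<phi> = sat AM c' \<phi>"
    "free_from_A (c ` {..<k})" "free_from_A (c' ` {..<k})"
    "{i. i < k \<and> c' i \<in> AA} = {i. i < k \<and> c i \<in> AA}"
  using assms unfolding bf_def by auto

lemma bf_sym: "bf k c c' \<Longrightarrow> bf k c' c"
  using bfD(8)[of k c c'] unfolding bf_def by simp

text \<open>One-way transfer suffices, because applied to negations it gives the converse. The
  \<open>L\<alpha>\<close>-part has to be examined anew only when the new point lies in A.\<close>

lemma bf_extend:
  assumes bf: "bf k c c'" and b: "b \<in> B" "b' \<in> B" "b \<in> AA \<longleftrightarrow> b' \<in> AA"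
    and beta: "\<And>\<eta>. \<eta> \<in> formulas L\<beta> \<Longrightarrow> fv \<eta> \<subseteq> {..k} \<Longrightarrow> sat M (c(k := b)) \<eta> \<Longrightarrow> sat M (c'(k := b')) \<eta>"
    and alpha: "\<And>\<psi>. b \<in> AA \<Longrightarrow> \<psi> \<in> formulas L\<alpha> \<Longrightarrow> fv \<psi> \<subseteq> insert k {i. i < k \<and> c i \<in> AA} \<Longrightarrow>
      sat AM (c(k := b)) \<psi> \<Longrightarrow> sat AM (c'(k := b')) \<psi>"
    and free: "free_from_A (insert b (c ` {..<k}))" "free_from_A (insert b' (c' ` {..<k}))"
  shows "bf (Suc k) (c(k := b)) (c'(k := b'))"
  unfolding bf_def
proof (intro conjI ballI impI allI)
  show "range (c(k := b)) \<subseteq> B" "range (c'(k := b')) \<subseteq> B"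
    using bfD(1,2)[OF bf] b by auto
  show "sat M (c(k := b)) \<phi> = sat M (c'(k := b')) \<phi>" if "\<phi> \<in> formulas L\<beta>" "fv \<phi> \<subseteq> {..<Suc k}" for \<phi>
    using beta[of \<phi>] beta[of "Neg \<phi>"] that by (auto simp: lessThan_Suc_atMost)
  show "(c(k := b)) i \<in> AA \<longleftrightarrow> (c'(k := b')) i \<in> AA" if "i < Suc k" for i
    using bfD(4)[OF bf, of i] b that by auto
  show "sat AM (c(k := b)) \<phi> = sat AM (c'(k := b')) \<phi>"
    if \<phi>: "\<phi> \<in> formulas L\<alpha>" "fv \<phi> \<subseteq> {i. i < Suc k \<and> (c(k := b)) i \<in> AA}" for \<phi>
  proof (cases "b \<in> AA")
    case True
    have "{i. i < Suc k \<and> (c(k := b)) i \<in> AA} \<subseteq> insert k {i. i < k \<and> c i \<in> AA}" by auto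
    then have "fv \<phi> \<subseteq> insert k {i. i < k \<and> c i \<in> AA}" using \<phi>(2) by (rule order_trans[rotated])
    then show ?thesis using alpha[OF True, of \<phi>] alpha[OF True, of "Neg \<phi>"] \<phi> by auto
  next
    case False
    then have fv: "fv \<phi> \<subseteq> {i. i < k \<and> c i \<in> AA}" using \<phi>(2) by (auto split: if_splits simp: less_Suc_eq)
    have "sat AM (c(k := b)) \<phi> = sat AM c \<phi>" "sat AM (c'(k := b')) \<phi> = sat AM c' \<phi>"
      by (rule sat_cong; use fv in auto)+
    then show ?thesis using bfD(5)[OF bf \<phi>(1) fv] by simp
  qed
  have "(c(k := b)) ` {..<Suc k} = insert b (c ` {..<k})"
    "(c'(k := b')) ` {..<Suc k} = insert b' (c' ` {..<k})" by (auto simp: lessThan_Suc)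
  then show "free_from_A ((c(k := b)) ` {..<Suc k})" "free_from_A ((c'(k := b')) ` {..<Suc k})"
    using free by simp_all
qed

lemma bf_finite:
  assumes bf: "bf k c c'" and \<eta>: "\<eta> \<in> formulas L\<beta>" "fv \<eta> \<subseteq> {..k}"
  shows "finite {a \<in> B. sat M (c(k := a)) \<eta>} \<longleftrightarrow> finite {a \<in> B. sat M (c'(k := a)) \<eta>}"
proof -
  note inf = Infinite[OF \<eta>(1), where x = k]
  have "fv (Infinite k \<eta>) \<subseteq> {..<k}" by (rule subset_lessThan[OF inf(2) \<eta>(2)])
  then have "sat M c (Infinite k \<eta>) = sat M c' (Infinite k \<eta>)" using bfD(3)[OF bf inf(1)] by blast
  then show ?thesis
    using inf(3)[OF models_beta bfD(1)[OF bf]] inf(3)[OF models_beta bfD(2)[OF bf]] by blast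
qed

text \<open>The types of c pose a challenge that c solves with a, and c' is a second contender in
  the same model. A challenge demands finite fibres over every realization of q in every model;
  \<open>Infinite\<close> turns finiteness at c into a formula of q.\<close>

lemma mordell_lang_transfer:
  assumes bf: "bf k c c'" and \<phi>: "\<phi> \<in> formulas L\<beta>" "fv \<phi> \<subseteq> {..k}"
    and \<psi>: "\<psi> \<in> formulas L\<alpha>" "fv \<psi> \<subseteq> insert k {i. i < k \<and> c i \<in> AA}"
    and a: "a \<in> AA" "sat M (c(k := a)) \<phi>" "sat AM (c(k := a)) \<psi>"
    and fin: "finite {a \<in> B. sat M (c(k := a)) \<phi>}"
  shows "\<exists>a'\<in>AA. sat M (c'(k := a')) \<phi> \<and> sat AM (c'(k := a')) \<psi>"
proof -
  define I where "I = {i. i < k \<and> c i \<in> AA}"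
  define p where "p = {\<phi> \<in> formulas L\<alpha>. fv \<phi> \<subseteq> I \<and> sat AM c \<phi>}"
  define q where "q = {\<phi> \<in> formulas L\<beta>. fv \<phi> \<subseteq> {..<k} \<and> sat M c \<phi>}"
  note bfD = bfD[OF bf]
  have contender: "mordell_lang_contender A L\<alpha> L\<beta> T k I p q M e"
    if e: "range e \<subseteq> B" "{i. i < k \<and> e i \<in> AA} = I" "free_from_A (e ` {..<k})"
      "\<And>\<phi>. \<phi> \<in> q \<Longrightarrow> sat M e \<phi>" "\<And>\<phi>. \<phi> \<in> p \<Longrightarrow> sat AM e \<phi>" for e
    unfolding mordell_lang_contender_def
  proof (intro conjI)
    have "e ` {..<k} \<inter> AA = e ` I" using e(2) by auto
    moreover have eB: "e ` {..<k} \<subseteq> B" using e(1) by auto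
    ultimately show "free_over L\<beta> M (e ` {..<k}) (e ` I) AA"
      using free_over_if_free_from_A[OF eB e(3)] by simp
    show "e ` {..<k} \<subseteq> B" by (rule eB)
    show "{i \<in> {..<k}. e i \<in> AA} = I" using e(2) by auto
  qed (use e models_T in \<open>auto simp: realizes_def sat_A_struct\<close>)
  have "complete_type TYPE('b) L\<alpha> T\<alpha> I p"
    unfolding complete_type_def
  proof (intro conjI exI[of _ AM] exI[of _ c] models_alpha)
    show "c ` I \<subseteq> univ AM" by (auto simp: I_def)
  qed (auto simp: p_def realizes_def)
  moreover have "complete_type TYPE('b) L\<beta> T\<beta> {..<k} q"
    unfolding complete_type_def
  proof (intro conjI exI[of _ M] exI[of _ c] models_beta)
    show "c ` {..<k} \<subseteq> univ M" using bfD(1) by auto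
  qed (auto simp: q_def realizes_def)
  moreover have "finite {a \<in> univ N. sat N (e(k := a)) \<phi>}"
    if N: "models L\<beta> N T\<beta>" "e ` {..<k} \<subseteq> univ N" "realizes N e q"
    for N :: "('f, 'r, 'b) struct" and e
  proof -
    define \<psi>' where "\<psi>' = Infinite k \<phi>"
    note \<psi>' = Infinite[OF \<phi>(1), where x = k, folded \<psi>'_def]
    have fv: "fv \<psi>' \<subseteq> {..<k}" by (rule subset_lessThan[OF \<psi>'(2) \<phi>(2)])
    obtain u where u: "u \<in> univ N" using N(1) by (auto simp: models_def is_struct_def)
    \<comment> \<open>Nothing is known about e beyond k, whereas \<open>Infinite\<close> speaks
      about assignments with all values in N; an arbitrary element fills the rest.\<close>
    define e' where "e' i = (if i < k then e i else u)" for i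
    have e': "range e' \<subseteq> univ N" using N(2) u by (auto simp: e'_def)
    have "Neg \<psi>' \<in> q" using \<psi>'(1) fv \<psi>'(3)[OF models_beta bfD(1)] fin by (auto simp: q_def)
    then have "\<not> sat N e \<psi>'" using N(3) by (auto simp: realizes_def)
    moreover have "sat N e \<psi>' = sat N e' \<psi>'" by (rule sat_cong) (use fv in \<open>auto simp: e'_def\<close>)
    ultimately have "finite {a \<in> univ N. sat N (e'(k := a)) \<phi>}" using \<psi>'(3)[OF N(1) e'] by auto
    moreover have "sat N (e'(k := a)) \<phi> = sat N (e(k := a)) \<phi>" for a
      by (rule sat_cong) (use \<phi>(2) in \<open>auto simp: e'_def\<close>)
    ultimately show ?thesis by simp
  qed
  moreover have "I \<subseteq> {..<k}" by (auto simp: I_def)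
  ultimately have challenge: "mordell_lang_challenge TYPE('b) L\<alpha> L\<beta> T\<alpha> T\<beta> k I p q \<phi> \<psi>"
    unfolding mordell_lang_challenge_def using \<phi> \<psi> unfolding I_def by blast
  have "mordell_lang_contender A L\<alpha> L\<beta> T k I p q M c"
    by (rule contender) (use bfD in \<open>auto simp: I_def p_def q_def\<close>)
  then have solution: "mordell_lang_solution A L\<alpha> L\<beta> T k I p q \<phi> \<psi> M c a"
    using a by (simp add: mordell_lang_solution_def sat_A_struct)
  have contender': "mordell_lang_contender A L\<alpha> L\<beta> T k I p q M c'"
  proof (rule contender)
    show "{i. i < k \<and> c' i \<in> AA} = I" using bfD(8) by (simp add: I_def)
    show "sat M c' \<phi>" if "\<phi> \<in> q" for \<phi> using that bfD(3) by (auto simp: q_def)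
    show "sat AM c' \<phi>" if "\<phi> \<in> p" for \<phi> using that bfD(5) by (auto simp: p_def I_def)
  qed (use bfD in auto)
  have "mordell_lang_condition TYPE('b) A L\<alpha> L\<beta> T\<alpha> T\<beta> T"
    using ml_theory by (simp add: mordell_lang_theory_def)
  with challenge solution contender' have "\<exists>a. mordell_lang_solution A L\<alpha> L\<beta> T k I p q \<phi> \<psi> M c' a"
    unfolding mordell_lang_condition_def by blast
  then show ?thesis by (auto simp: mordell_lang_solution_def sat_A_struct)
qed

text \<open>The candidates for a' form a finite set Z. For each pair of an \<open>L\<beta>\<close>-
  and an \<open>L\<alpha>\<close>-formula true of a, Mordell-Lang supplies a candidate satisfying
  both. Pairs are closed under conjunction, so a single candidate serves them all.\<close>

lemma forth_A_algebraic:
  assumes bf: "bf k c c'" and a: "a \<in> AA" "a \<in> cl (c ` {..<k})"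
  obtains a' where "bf (Suc k) (c(k := a)) (c'(k := a'))"
proof -
  note bfD = bfD[OF bf]
  let ?I = "{i. i < k \<and> c i \<in> AA}"
  obtain \<eta> where \<eta>: "\<eta> \<in> formulas L\<beta>" "fv \<eta> \<subseteq> {..k}" "sat M (c(k := a)) \<eta>"
    "finite {x \<in> B. sat M (c(k := x)) \<eta>}" using acl_tupleE[OF a(2)] by blast
  define Z where "Z = {x \<in> AA. sat M (c'(k := x)) \<eta>}"
  have "finite {x \<in> B. sat M (c'(k := x)) \<eta>}" using bf_finite[OF bf \<eta>(1,2)] \<eta>(4) by simp
  moreover have "Z \<subseteq> {x \<in> B. sat M (c'(k := x)) \<eta>}" using AA_subset by (auto simp: Z_def)
  ultimately have finZ: "finite Z" by (rule finite_subset[rotated])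
  define true where "true \<phi> \<psi> \<longleftrightarrow> \<phi> \<in> formulas L\<beta> \<and> fv \<phi> \<subseteq> {..k} \<and> sat M (c(k := a)) \<phi> \<and>
    \<psi> \<in> formulas L\<alpha> \<and> fv \<psi> \<subseteq> insert k ?I \<and> sat AM (c(k := a)) \<psi>" for \<phi> \<psi>
  define pred where "pred = (\<lambda>(\<phi>, \<psi>) x. sat M (c'(k := x)) \<phi> \<and> sat AM (c'(k := x)) \<psi>)"
  define \<P> where "\<P> = pred ` {(\<phi>, \<psi>). true \<phi> \<psi>}"
  have "\<exists>a'\<in>Z. \<forall>P\<in>\<P>. P a'"
  proof (rule finite_common_point[OF finZ])
    have "true (Neg Falsum) (Neg Falsum)" unfolding true_def by auto
    then show "\<P> \<noteq> {}" by (auto simp: \<P>_def)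
  next
    fix P Q assume "P \<in> \<P>" "Q \<in> \<P>"
    then obtain \<phi>1 \<psi>1 \<phi>2 \<psi>2 where "true \<phi>1 \<psi>1" "true \<phi>2 \<psi>2" and PQ: "P = pred (\<phi>1, \<psi>1)" "Q = pred (\<phi>2, \<psi>2)"
      by (auto simp: \<P>_def)
    then have "true (Conj \<phi>1 \<phi>2) (Conj \<psi>1 \<psi>2)" by (simp add: true_def)
    then have "pred (Conj \<phi>1 \<phi>2, Conj \<psi>1 \<psi>2) \<in> \<P>" unfolding \<P>_def by blast
    then show "\<exists>R\<in>\<P>. \<forall>z. R z \<longrightarrow> P z \<and> Q z" by (rule bexI[rotated]) (simp add: pred_def PQ)
  next
    fix P assume "P \<in> \<P>"
    then obtain \<phi> \<psi> where t: "true \<phi> \<psi>" and P: "P = pred (\<phi>, \<psi>)" by (auto simp: \<P>_def)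
    have "finite {x \<in> B. sat M (c(k := x)) (Conj \<eta> \<phi>)}"
      by (rule finite_subset[OF _ \<eta>(4)]) auto
    then have "\<exists>a'\<in>AA. sat M (c'(k := a')) (Conj \<eta> \<phi>) \<and> sat AM (c'(k := a')) \<psi>"
      using t \<eta> a by (intro mordell_lang_transfer[OF bf]) (auto simp: true_def)
    then show "\<exists>z\<in>Z. P z" by (auto simp: Z_def P pred_def)
  qed
  then obtain a' where a': "a' \<in> Z" "\<forall>P\<in>\<P>. P a'" by blast
  have a'A: "a' \<in> AA" using a' by (simp add: Z_def)
  have t: "sat M (c'(k := a')) \<phi> \<and> sat AM (c'(k := a')) \<psi>" if "true \<phi> \<psi>" for \<phi> \<psi>
    using bspec[OF a'(2), of "pred (\<phi>, \<psi>)"] that by (auto simp: \<P>_def pred_def)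
  have "bf (Suc k) (c(k := a)) (c'(k := a'))"
  proof (rule bf_extend[OF bf])
    show "free_from_A (insert a (c ` {..<k}))" "free_from_A (insert a' (c' ` {..<k}))"
      using bfD a a'A by (auto intro!: free_insert_A)
    show "sat M (c'(k := a')) \<phi>" if "\<phi> \<in> formulas L\<beta>" "fv \<phi> \<subseteq> {..k}" "sat M (c(k := a)) \<phi>" for \<phi>
      using t[of \<phi> "Neg Falsum"] that by (simp add: true_def)
    show "sat AM (c'(k := a')) \<psi>"
      if "\<psi> \<in> formulas L\<alpha>" "fv \<psi> \<subseteq> insert k ?I" "sat AM (c(k := a)) \<psi>" for \<psi>
      using t[of "Neg Falsum" \<psi>] that by (simp add: true_def)
  qed (use a a'A AA_subset in auto)
  then show thesis by (rule that)
qed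

text \<open>The transported type is non-algebraic because a formula with finitely many solutions
  over c' also has finitely many over c, which would make b algebraic.\<close>

lemma bf_transfer_type:
  assumes bf: "bf k c c'" and b: "b \<in> B" "b \<notin> cl (c ` {..<k})"
  shows "unary_type L\<beta> M (c' ` {..<k}) (transfer_type L\<beta> M k {..<k} c b c')"
    "nonalgebraic M (transfer_type L\<beta> M k {..<k} c b c')"
    "\<And>b' \<phi>. b' \<in> B \<Longrightarrow> prealizes M b' (transfer_type L\<beta> M k {..<k} c b c') \<Longrightarrow>
       \<phi> \<in> formulas L\<beta> \<Longrightarrow> fv \<phi> \<subseteq> {..k} \<Longrightarrow> sat M (c(k := b)) \<phi> \<Longrightarrow> sat M (c'(k := b')) \<phi>"
proof -
  let ?q = "transfer_type L\<beta> M k {..<k} c b c'"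
  have lt: "{..<k} = {i. i < k \<and> True}" by auto
  show "unary_type L\<beta> M (c' ` {..<k}) ?q"
    by (rule unary_type_transfer[OF lt b(1)]) (rule bfD(3)[OF bf])
  show "nonalgebraic M ?q"
    unfolding nonalgebraic_def
  proof (intro ballI notI)
    fix \<theta> assume \<theta>: "\<theta> \<in> ?q" "finite (psolutions M \<theta>)"
    have \<theta>p: "\<theta> \<in> pformulas L\<beta> (c' ` {i. i < k \<and> True})" using \<theta> by (simp add: transfer_type_def lt)
    let ?t = "tuple_fm c' k \<theta>"
    have fv: "fv ?t \<subseteq> {..k}" using fv_tuple_fm[of "fst \<theta>" "snd \<theta>" L\<beta> c' k "\<lambda>_. True"] \<theta>p by auto
    have t: "?t \<in> formulas L\<beta>" using \<theta>p by (cases \<theta>) (auto simp: pformulas_def)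
    have "sat M (c'(k := x)) ?t = psat M x \<theta>" for x
      using sat_tuple_fm[of "fst \<theta>" "snd \<theta>" L\<beta> c' k "\<lambda>_. True" M x] \<theta>p by simp
    then have "finite {x \<in> B. sat M (c'(k := x)) ?t}" using \<theta>(2) by (simp add: psolutions_def)
    then have "finite {x \<in> B. sat M (c(k := x)) ?t}" using bf_finite[OF bf t fv] by simp
    moreover have "sat M (c(k := b)) ?t" using \<theta>(1) by (simp add: transfer_type_def)
    ultimately have "b \<in> cl (c ` {..<k})" using t fv b(1) by (intro acl_tupleI[of ?t _ k]) auto
    with b show False by simp
  qed
  show "sat M (c'(k := b')) \<phi>"
    if "b' \<in> B" "prealizes M b' ?q" "\<phi> \<in> formulas L\<beta>" "fv \<phi> \<subseteq> {..k}" "sat M (c(k := b)) \<phi>" for b' \<phi>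
  proof (rule transfer_type_realized[OF lt b(1) that(1) _ that(2,3)])
    show "fv \<phi> \<subseteq> insert k {..<k}" using that(4) by auto
  qed (use that bfD(3)[OF bf] in auto)
qed

lemma forth_A_generic:
  assumes bf: "bf k c c'" and a: "a \<in> AA" "a \<notin> cl (c ` {..<k})"
  obtains a' where "bf (Suc k) (c(k := a)) (c'(k := a'))"
proof -
  note bfD = bfD[OF bf]
  define J where "J = {i. i < k \<and> c' i \<in> AA}"
  define q where "q = transfer_type L\<beta> M k {..<k} c a c'"
  define p where "p = transfer_type L\<alpha> AM k J c a c'"
  let ?C = "c' ` {..<k}"
  have aB: "a \<in> B" using a AA_subset by auto
  have CB: "?C \<subseteq> B" using bfD(2) by auto
  have AC: "AA \<inter> ?C = c' ` J" by (auto simp: J_def)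
  note tq = bf_transfer_type[OF bf aB a(2)]
  have q: "unary_type L\<beta> M ?C q" and nonalg: "nonalgebraic M q" unfolding q_def by (rule tq)+
  have eqA: "sat AM c \<phi> = sat AM c' \<phi>" if "\<phi> \<in> formulas L\<alpha>" "fv \<phi> \<subseteq> J" for \<phi>
    using bfD(5) that unfolding J_def bfD(8) by blast
  have p: "unary_type L\<alpha> AM (AA \<inter> ?C) p"
    unfolding p_def AC by (rule unary_type_transfer[where P = "\<lambda>x. x \<in> AA"]) (use a eqA in \<open>auto simp: J_def\<close>)
  \<comment> \<open>Quantifier-free formulas have the same truth value in \<open>AM\<close> and in
    M, and both types are read through the same translation \<open>tuple_fm c' k\<close>, so the
    formula is itself a member of q.\<close>
  have qf: "\<forall>(\<theta>, e)\<in>p. quantifier_free \<theta> \<and> \<theta> \<in> formulas (L\<alpha> \<inter> L\<beta>) \<longrightarrow> type_implies M q (\<theta>, e)"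
  proof (intro ballI, clarify)
    fix \<theta> e assume \<theta>: "(\<theta>, e) \<in> p" "quantifier_free \<theta>" "\<theta> \<in> formulas (L\<alpha> \<inter> L\<beta>)"
    have "sat AM (c(k := a)) (tuple_fm c' k (\<theta>, e))" using \<theta>(1) by (simp add: p_def transfer_type_def)
    then have "sat M (c(k := a)) (tuple_fm c' k (\<theta>, e))"
      using \<theta>(2) by (simp add: sat_A_struct tuple_fm_def relativize_quantifier_free)
    moreover have "(\<theta>, e) \<in> pformulas L\<beta> ?C"
      using \<theta>(1,3) by (auto simp: p_def transfer_type_def pformulas_def formulas_def J_def)
    ultimately have "(\<theta>, e) \<in> q" by (simp add: q_def transfer_type_def)
    then show "type_implies M q (\<theta>, e)"
      unfolding type_implies_def by (intro exI[of _ "{(\<theta>, e)}"]) (auto simp: prealizes_def)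
  qed
  obtain \<kappa>' :: "'b rel" where \<kappa>': "Card_order \<kappa>'" "lang_card L2 <o \<kappa>'" "saturated \<kappa>' L2 M"
    "\<And>C :: 'b set. countable C \<Longrightarrow> |C| <o \<kappa>'" by (rule \<kappa>_on_elements) blast
  have less: "|?C| <o \<kappa>'" by (rule \<kappa>'(4)) auto
  have dens: "density_condition TYPE('b) A L\<alpha> L\<beta> T" using ml_theory by (simp add: mordell_lang_theory_def)
  have "\<exists>a\<in>AA. prealizes M a ({(relativize A \<theta>, e) |\<theta> e. (\<theta>, e) \<in> p} \<union> q)"
    by (rule dens[unfolded density_condition_def, rule_format, of M \<kappa>' ?C q p])
       (intro conjI models_T \<kappa>'(1-3) CB less q nonalg p qf)
  then obtain a' where a': "a' \<in> AA" "prealizes M a' ({(relativize A \<theta>, e) |\<theta> e. (\<theta>, e) \<in> p} \<union> q)" ..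
  have rq: "prealizes M a' q" using a'(2) by (auto simp: prealizes_def)
  have rp: "prealizes AM a' p"
    unfolding prealizes_def
  proof
    fix \<theta> assume "\<theta> \<in> p"
    then have "psat M a' (relativize A (fst \<theta>), snd \<theta>)" using a'(2) by (force simp: prealizes_def)
    then show "psat AM a' \<theta>" by (cases \<theta>) (simp add: psat_Pair sat_A_struct)
  qed
  have "bf (Suc k) (c(k := a)) (c'(k := a'))"
  proof (rule bf_extend[OF bf])
    show "free_from_A (insert a (c ` {..<k}))" "free_from_A (insert a' (c' ` {..<k}))"
      using bfD a a'(1) by (auto intro!: free_insert_A)
    show "sat M (c'(k := a')) \<phi>" if "\<phi> \<in> formulas L\<beta>" "fv \<phi> \<subseteq> {..k}" "sat M (c(k := a)) \<phi>" for \<phi>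
      using tq(3)[of a' \<phi>] that a' AA_subset rq by (auto simp: q_def)
    show "sat AM (c'(k := a')) \<psi>"
      if "\<psi> \<in> formulas L\<alpha>" "fv \<psi> \<subseteq> insert k {i. i < k \<and> c i \<in> AA}" "sat AM (c(k := a)) \<psi>" for \<psi>
    proof (rule transfer_type_realized[where J = J and P = "\<lambda>x. x \<in> AA"])
      show "prealizes AM a' (transfer_type L\<alpha> AM k J c a c')" using rp by (simp add: p_def)
      show "fv \<psi> \<subseteq> insert k J" using that(2) by (simp add: J_def bfD(8))
    qed (use that a' a eqA in \<open>auto simp: J_def\<close>)
  qed (use a a' AA_subset in auto)
  then show thesis by (rule that)
qed

lemma forth_A:
  assumes "bf k c c'" "a \<in> AA"
  obtains a' where "bf (Suc k) (c(k := a)) (c'(k := a'))"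
proof (cases "a \<in> cl (c ` {..<k})")
  case True
  then show thesis using forth_A_algebraic[OF assms] that by blast
next
  case False
  then show thesis using forth_A_generic[OF assms] that by blast
qed

text \<open>Matching a point outside A can require auxiliary points of A first, so one move may
  lengthen the tuples by several entries.\<close>

definition bf_extension ::
  "nat \<Rightarrow> (nat \<Rightarrow> 'b) \<Rightarrow> (nat \<Rightarrow> 'b) \<Rightarrow> nat \<Rightarrow> (nat \<Rightarrow> 'b) \<Rightarrow> (nat \<Rightarrow> 'b) \<Rightarrow> bool" where
  "bf_extension k c c' l d d' \<longleftrightarrow> k \<le> l \<and> bf l d d' \<and> (\<forall>i<k. d i = c i \<and> d' i = c' i)"

lemma bf_extension_refl: "bf k c c' \<Longrightarrow> bf_extension k c c' k c c'"
  by (simp add: bf_extension_def)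

lemma bf_extension_trans:
  "bf_extension k c c' l d d' \<Longrightarrow> bf_extension l d d' j e e' \<Longrightarrow> bf_extension k c c' j e e'"
  by (auto simp: bf_extension_def)

lemma bf_extension_sym: "bf_extension k c c' l d d' \<Longrightarrow> bf_extension k c' c l d' d"
  by (auto simp: bf_extension_def bf_sym)

lemma bf_extension_Suc:
  "bf (Suc k) (c(k := b)) (c'(k := b')) \<Longrightarrow> bf_extension k c c' (Suc k) (c(k := b)) (c'(k := b'))"
  by (auto simp: bf_extension_def)

lemma bf_extension_image: "bf_extension k c c' l d d' \<Longrightarrow> c ` {..<k} \<subseteq> d ` {..<l}"
proof
  fix x assume ext: "bf_extension k c c' l d d'" and "x \<in> c ` {..<k}"
  then obtain i where i: "i < k" "x = c i" by auto
  with ext have "i < l" "d i = x" by (auto simp: bf_extension_def)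
  then show "x \<in> d ` {..<l}" by auto
qed

lemma forth_finite:
  assumes forth: "\<And>k c c' x. bf k c c' \<Longrightarrow> x \<in> X \<Longrightarrow> \<exists>l d d'. bf_extension k c c' l d d' \<and> x \<in> d ` {..<l}"
    and "finite X" "bf k c c'"
  shows "\<exists>l d d'. bf_extension k c c' l d d' \<and> X \<subseteq> d ` {..<l}"
  using assms(2,1)
proof (induction X)
  case empty
  then show ?case using bf_extension_refl[OF assms(3)] by blast
next
  case (insert x X)
  then obtain l d d' where d: "bf_extension k c c' l d d'" "X \<subseteq> d ` {..<l}" by blast
  then have "bf l d d'" by (simp add: bf_extension_def)
  then obtain j e e' where e: "bf_extension l d d' j e e'" "x \<in> e ` {..<j}"
    using insert.prems by blast
  have "insert x X \<subseteq> e ` {..<j}" using d(2) e(2) bf_extension_image[OF e(1)] by blast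
  with bf_extension_trans[OF d(1) e(1)] show ?case by blast
qed

lemma forth_A_set:
  assumes "finite X" "X \<subseteq> AA" "bf k c c'"
  shows "\<exists>l d d'. bf_extension k c c' l d d' \<and> X \<subseteq> d ` {..<l}"
proof (rule forth_finite[OF _ assms(1,3)])
  fix k c c' x assume bf: "bf k c c'" and x: "x \<in> X"
  obtain a' where a': "bf (Suc k) (c(k := x)) (c'(k := a'))"
    using forth_A[OF bf] x assms(2) by blast
  have "x \<in> (c(k := x)) ` {..<Suc k}" by (auto intro!: image_eqI[of _ _ k])
  with bf_extension_Suc[OF a']
  show "\<exists>l d d'. bf_extension k c c' l d d' \<and> x \<in> d ` {..<l}" by blast
qed

text \<open>A partner with the right \<open>L\<beta>\<close>-type exists among finitely many
  candidates; the danger is that it lies in A although b does not.\<close>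

lemma forth_algebraic:
  assumes bf: "bf k c c'" and b: "b \<in> cl (c ` {..<k})" "b \<notin> AA"
  shows "\<exists>l d d'. bf_extension k c c' l d d' \<and> b \<in> d ` {..<l}"
proof -
  have bB: "b \<in> B" using b(1) cl_subset by auto
  obtain \<eta> where \<eta>: "\<eta> \<in> formulas L\<beta>" "fv \<eta> \<subseteq> {..k}" "sat M (c(k := b)) \<eta>"
    "finite {x \<in> B. sat M (c(k := x)) \<eta>}" using acl_tupleE[OF b(1)] by blast
  define Z where "Z = {x \<in> B. sat M (c'(k := x)) \<eta>}"
  have finZ: "finite Z" using bf_finite[OF bf \<eta>(1,2)] \<eta>(4) by (simp add: Z_def)
  \<comment> \<open>Once all solutions in \<open>A\<close> on the right are named, a partner of \<open>b\<close> cannot lie in \<open>A\<close>.\<close>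
  have "\<exists>l d' d. bf_extension k c' c l d' d \<and> Z \<inter> AA \<subseteq> d' ` {..<l}"
    using forth_A_set[of "Z \<inter> AA" k c' c] finZ bf_sym[OF bf] by auto
  then obtain l d d' where d: "bf_extension k c c' l d d'" "Z \<inter> AA \<subseteq> d' ` {..<l}"
    using bf_extension_sym by blast
  then have bfl: "bf l d d'" and kl: "k \<le> l" and eq: "\<And>i. i < k \<Longrightarrow> d i = c i" "\<And>i. i < k \<Longrightarrow> d' i = c' i"
    by (auto simp: bf_extension_def)
  \<comment> \<open>The tuples have grown, so the object variable moves from k to the first free
    position l.\<close>
  define \<eta>' where "\<eta>' = subst \<eta> (\<lambda>i. if i = k then l else i)"
  have sat: "sat M (d(l := x)) \<eta>' = sat M (c(k := x)) \<eta>" for x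
    unfolding \<eta>'_def sat_subst by (rule sat_cong) (use \<eta>(2) kl eq in auto)
  have sat': "sat M (d'(l := x)) \<eta>' = sat M (c'(k := x)) \<eta>" for x
    unfolding \<eta>'_def sat_subst by (rule sat_cong) (use \<eta>(2) kl eq in auto)
  have \<eta>': "\<eta>' \<in> formulas L\<beta>" using \<eta>(1) by (simp add: \<eta>'_def)
  have fv\<eta>': "fv \<eta>' \<subseteq> {..l}"
    using fv_subst[of \<eta> "\<lambda>i. if i = k then l else i"] \<eta>(2) kl unfolding \<eta>'_def by fastforce
  define \<Phi> where "\<Phi> = {\<phi> \<in> formulas L\<beta>. fv \<phi> \<subseteq> {..l} \<and> sat M (d(l := b)) \<phi>}"
  define pred where "pred = (\<lambda>\<phi> x. sat M (d'(l := x)) \<phi>)"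
  have "\<exists>b'\<in>Z. \<forall>P\<in>pred ` \<Phi>. P b'"
  proof (rule finite_common_point[OF finZ])
    have "Neg Falsum \<in> \<Phi>" by (simp add: \<Phi>_def)
    then show "pred ` \<Phi> \<noteq> {}" by blast
  next
    fix P Q assume "P \<in> pred ` \<Phi>" "Q \<in> pred ` \<Phi>"
    then obtain \<phi> \<psi> where \<phi>: "\<phi> \<in> \<Phi>" "\<psi> \<in> \<Phi>" "P = pred \<phi>" "Q = pred \<psi>" by blast
    then have "Conj \<phi> \<psi> \<in> \<Phi>" by (simp add: \<Phi>_def)
    then have "pred (Conj \<phi> \<psi>) \<in> pred ` \<Phi>" by (rule imageI)
    then show "\<exists>R\<in>pred ` \<Phi>. \<forall>z. R z \<longrightarrow> P z \<and> Q z"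
      by (rule bexI[rotated]) (simp add: pred_def \<phi>(3,4))
  next
    fix P assume "P \<in> pred ` \<Phi>"
    then obtain \<phi> where \<phi>: "\<phi> \<in> formulas L\<beta>" "fv \<phi> \<subseteq> {..l}" "sat M (d(l := b)) \<phi>" "P = pred \<phi>"
      by (auto simp: \<Phi>_def)
    let ?\<psi> = "Exist l (Conj \<eta>' \<phi>)"
    have "sat M d ?\<psi>" using \<phi>(3) \<eta>(3) sat bB by auto
    moreover have "?\<psi> \<in> formulas L\<beta>" using \<phi>(1) \<eta>' by simp
    moreover have "fv ?\<psi> \<subseteq> {..<l}"
      by (rule subset_lessThan[of _ "fv \<eta>' \<union> fv \<phi>"]) (use \<phi>(2) fv\<eta>' in auto)
    ultimately have "sat M d' ?\<psi>" using bfD(3)[OF bfl] by blast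
    then show "\<exists>z\<in>Z. P z" by (auto simp: Z_def sat' \<phi>(4) pred_def)
  qed
  then obtain b' where b'Z: "b' \<in> Z" and b': "\<And>\<phi>. \<phi> \<in> \<Phi> \<Longrightarrow> sat M (d'(l := b')) \<phi>"
    by (auto simp: pred_def)
  have b'B: "b' \<in> B" using b'Z by (simp add: Z_def)
  have b'A: "b' \<notin> AA"
  proof
    assume "b' \<in> AA"
    then obtain i where i: "i < l" "b' = d' i" using d(2) b'Z by auto
    then have "d i \<in> AA" using bfD(4)[OF bfl] \<open>b' \<in> AA\<close> by blast
    \<comment> \<open>The entry \<open>d i\<close> lies in A and b does not, so this inequality
      belongs to the type that b' realizes.\<close>
    then have "Neg (Eq (Var l) (Var i)) \<in> \<Phi>" using b(2) i(1) by (auto simp: \<Phi>_def)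
    from b'[OF this] i show False by simp
  qed
  have rg: "d ` {..<l} \<subseteq> B" "d' ` {..<l} \<subseteq> B" using bfD(1,2)[OF bfl] by auto
  have bcl: "b \<in> cl (d ` {..<l})"
    using b(1) cl_mono[OF bf_extension_image[OF d(1)] rg(1)] by auto
  have b'cl: "b' \<in> cl (d' ` {..<l})"
  proof (rule acl_tupleI[OF \<eta>'])
    show "fv \<eta>' \<subseteq> insert l {..<l}" using fv\<eta>' by auto
  qed (use b'Z finZ in \<open>auto simp: sat' Z_def\<close>)
  have "bf (Suc l) (d(l := b)) (d'(l := b'))"
  proof (rule bf_extend[OF bfl])
    show "sat M (d'(l := b')) \<phi>" if "\<phi> \<in> formulas L\<beta>" "fv \<phi> \<subseteq> {..l}" "sat M (d(l := b)) \<phi>" for \<phi>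
      using that by (intro b') (simp add: \<Phi>_def)
    show "free_from_A (insert b (d ` {..<l}))"
      by (rule free_insert_algebraic) (use rg bfD(6)[OF bfl] bcl bB in auto)
    show "free_from_A (insert b' (d' ` {..<l}))"
      by (rule free_insert_algebraic) (use rg bfD(7)[OF bfl] b'cl b'B in auto)
  qed (use bB b'B b b'A in auto)
  from bf_extension_trans[OF d(1) bf_extension_Suc[OF this]]
  show ?thesis by (intro exI conjI) (assumption, auto intro!: image_eqI[of _ _ l])
qed

text \<open>Codensity realizes the transported type by a point generic over A and c'. Genericity
  both keeps the partner outside A and preserves freeness.\<close>

lemma forth_generic:
  assumes bf: "bf k c c'" and b: "b \<in> B" "b \<notin> cl (AA \<union> c ` {..<k})"
  obtains b' where "bf (Suc k) (c(k := b)) (c'(k := b'))"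
proof -
  have rg: "c ` {..<k} \<subseteq> B" "c' ` {..<k} \<subseteq> B" using bfD(1,2)[OF bf] by auto
  have sub: "AA \<union> c ` {..<k} \<subseteq> B" "AA \<union> c' ` {..<k} \<subseteq> B" using rg AA_subset by auto
  have "cl (c ` {..<k}) \<subseteq> cl (AA \<union> c ` {..<k})" using sub(1) by (intro cl_mono) auto
  then have "b \<notin> cl (c ` {..<k})" using b by auto
  note tq = bf_transfer_type[OF bf b(1) this]
  obtain b' where b': "b' \<in> B" "b' \<notin> cl (AA \<union> c' ` {..<k})"
    "prealizes M b' (transfer_type L\<beta> M k {..<k} c b c')"
    using codensity_type[OF _ rg(2) tq(1,2)] by blast
  have nA: "b \<notin> AA" "b' \<notin> AA" using b(2) b'(2) cl_ext[OF sub(1)] cl_ext[OF sub(2)] by auto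
  have "bf (Suc k) (c(k := b)) (c'(k := b'))"
  proof (rule bf_extend[OF bf])
    show "free_from_A (insert b (c ` {..<k}))" "free_from_A (insert b' (c' ` {..<k}))"
      using rg bfD(6,7)[OF bf] b b' by (auto intro!: free_insert_generic)
  qed (use b b' nA tq(3) in auto)
  then show thesis by (rule that)
qed

text \<open>A point algebraic over A and the tuple uses only finitely many elements of A; once these
  are adjoined, it is algebraic over the tuple alone.\<close>

lemma forth:
  assumes bf: "bf k c c'" and b: "b \<in> B"
  shows "\<exists>l d d'. bf_extension k c c' l d d' \<and> b \<in> d ` {..<l}"
proof (cases "b \<in> AA")
  case True
  then show ?thesis using forth_A_set[of "{b}" k c c'] bf by auto
next
  case nA: False
  have sub: "AA \<union> c ` {..<k} \<subseteq> B" using bfD(1)[OF bf] AA_subset by auto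
  show ?thesis
  proof (cases "b \<in> cl (AA \<union> c ` {..<k})")
    case True
    then obtain X where X: "X \<subseteq> AA \<union> c ` {..<k}" "finite X" "b \<in> cl X" using cl_finite[OF sub] by blast
    then obtain l d d' where d: "bf_extension k c c' l d d'" "X \<inter> AA \<subseteq> d ` {..<l}"
      using forth_A_set[of "X \<inter> AA" k c c'] bf by auto
    then have bfl: "bf l d d'" by (simp add: bf_extension_def)
    have "X \<subseteq> d ` {..<l}" using X(1) d(2) bf_extension_image[OF d(1)] by blast
    moreover have "d ` {..<l} \<subseteq> B" using bfD(1)[OF bfl] by auto
    ultimately have "b \<in> cl (d ` {..<l})" using X(3) cl_mono by blast
    then obtain j e e' where "bf_extension l d d' j e e'" "b \<in> e ` {..<j}"
      using forth_algebraic[OF bfl _ nA] by blast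
    with bf_extension_trans[OF d(1)] show ?thesis by blast
  next
    case False
    then obtain b' where "bf (Suc k) (c(k := b)) (c'(k := b'))" using forth_generic[OF bf b] by blast
    from bf_extension_Suc[OF this] show ?thesis
      by (intro exI conjI) (assumption, auto intro!: image_eqI[of _ _ k])
  qed
qed

section \<open>Preservation of all formulas of the pair\<close>

lemma bf_eval:
  assumes bf: "bf k c c'" and \<sigma>: "\<sigma> ` tm_vars t \<subseteq> {..<k}" and t: "tm_symbs t \<subseteq> L\<beta>"
    and i: "i < k" "c i = eval_tm M (c \<circ> \<sigma>) t"
  shows "c' i = eval_tm M (c' \<circ> \<sigma>) t"
proof -
  let ?\<phi> = "Eq (Var i) (subst_tm \<sigma> t)"
  have "?\<phi> \<in> formulas L\<beta>" using t by (simp add: formulas_def tm_symbs_subst)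
  moreover have "fv ?\<phi> \<subseteq> {..<k}" using \<sigma> i by (simp add: tm_vars_subst)
  moreover have "sat M c ?\<phi>" using i by (simp add: eval_subst_tm)
  ultimately have "sat M c' ?\<phi>" using bfD(3)[OF bf] by blast
  then show ?thesis by (simp add: eval_subst_tm)
qed

lemma tm_symbs_L2: "tm_symbs t \<subseteq> L2 \<Longrightarrow> tm_symbs t \<subseteq> L\<beta>"
proof (induction t)
  case (Fn f ts)
  then have "FSym f (length ts) \<in> L\<beta>" using fun_symbols by simp
  moreover have "tm_symbs t \<subseteq> L\<beta>" if "t \<in> set ts" for t
    using that Fn.prems by (intro Fn.IH) auto
  ultimately show ?case by auto
qed simp

text \<open>For a relation outside \<open>L\<beta>\<close> the values of the argument terms are
  first adjoined to the tuple. If it belongs to \<open>L\<alpha>\<close>, it is decided by the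
  \<open>L\<alpha>\<close>-type when all values lie in A, and is false on both sides otherwise. The
  remaining relation is A, whose membership is matched.\<close>

lemma bf_Rel:
  assumes bf: "bf k c c'" and \<phi>: "Rel r ts \<in> formulas L2" "\<sigma> ` fv (Rel r ts) \<subseteq> {..<k}"
  shows "sat M (c \<circ> \<sigma>) (Rel r ts) = sat M (c' \<circ> \<sigma>) (Rel r ts)"
proof (cases "RSym r (length ts) \<in> L\<beta>")
  case True
  have "subst (Rel r ts) \<sigma> \<in> formulas L\<beta>"
    using True \<phi>(1) tm_symbs_L2 unfolding subst_formulas by (auto simp: formulas_def)
  moreover have "fv (subst (Rel r ts) \<sigma>) \<subseteq> {..<k}" by (rule order_trans[OF fv_subst \<phi>(2)])
  ultimately show ?thesis using bfD(3)[OF bf] unfolding sat_subst[symmetric] by blast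
next
  case False
  have tb: "tm_symbs t \<subseteq> L\<beta>" if "t \<in> set ts" for t
    using \<phi>(1) that tm_symbs_L2 by (auto simp: formulas_def)
  have tv: "\<sigma> ` tm_vars t \<subseteq> {..<k}" if "t \<in> set ts" for t using \<phi>(2) that by auto
  have valB: "eval_tm M (c \<circ> \<sigma>) t \<in> B" if "t \<in> set ts" for t
  proof (rule eval_tm_univ)
    show "is_struct L\<beta> M" using models_beta by (simp add: models_def)
    show "(c \<circ> \<sigma>) ` tm_vars t \<subseteq> B" using bfD(1)[OF bf] by auto
  qed (rule tb[OF that])
  define X where "X = eval_tm M (c \<circ> \<sigma>) ` set ts"
  have "\<exists>l d d'. bf_extension k c c' l d d' \<and> X \<subseteq> d ` {..<l}"
  proof (rule forth_finite[OF _ _ bf])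
    show "finite X" by (simp add: X_def)
    show "\<exists>l d d'. bf_extension k c c' l d d' \<and> x \<in> d ` {..<l}" if "bf k c c'" "x \<in> X" for k c c' x
      using forth[OF that(1)] that(2) valB by (auto simp: X_def)
  qed
  then obtain l d d' where d: "bf_extension k c c' l d d'" "X \<subseteq> d ` {..<l}" by blast
  then have bfl: "bf l d d'" and kl: "k \<le> l" and eq: "\<And>i. i < k \<Longrightarrow> d i = c i" "\<And>i. i < k \<Longrightarrow> d' i = c' i"
    by (auto simp: bf_extension_def)
  have "\<forall>t\<in>set ts. \<exists>i<l. d i = eval_tm M (c \<circ> \<sigma>) t" using d(2) by (force simp: X_def)
  then obtain f where f: "\<And>t. t \<in> set ts \<Longrightarrow> f t < l" "\<And>t. t \<in> set ts \<Longrightarrow> d (f t) = eval_tm M (c \<circ> \<sigma>) t"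
    by metis
  have f': "d' (f t) = eval_tm M (c' \<circ> \<sigma>) t" if t: "t \<in> set ts" for t
  proof -
    have "eval_tm M (c \<circ> \<sigma>) t = eval_tm M (d \<circ> \<sigma>) t" "eval_tm M (c' \<circ> \<sigma>) t = eval_tm M (d' \<circ> \<sigma>) t"
      using tv[OF t] eq by (auto intro!: eval_tm_cong)
    moreover have "d' (f t) = eval_tm M (d' \<circ> \<sigma>) t"
      using tv[OF t] kl tb[OF t] f[OF t] calculation by (intro bf_eval[OF bfl]) auto
    ultimately show ?thesis by simp
  qed
  have map: "map (eval_tm M (c \<circ> \<sigma>)) ts = map (d \<circ> f) ts" "map (eval_tm M (c' \<circ> \<sigma>)) ts = map (d' \<circ> f) ts"
    using f f' by auto
  have inA: "d (f t) \<in> AA \<longleftrightarrow> d' (f t) \<in> AA" if "t \<in> set ts" for t using bfD(4)[OF bfl f(1)[OF that]] .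
  have inB: "d (f t) \<in> B" "d' (f t) \<in> B" for t using bfD(1,2)[OF bfl] by auto
  show ?thesis
  proof (cases "RSym r (length ts) \<in> L\<alpha>")
    case alpha: True
    show ?thesis
    proof (cases "\<forall>t\<in>set ts. d (f t) \<in> AA")
      case True
      let ?\<phi> = "Rel r (map (Var \<circ> f) ts)"
      have "?\<phi> \<in> formulas L\<alpha>" using alpha by (simp add: formulas_def)
      moreover have "fv ?\<phi> \<subseteq> {i. i < l \<and> d i \<in> AA}" using True f(1) by auto
      ultimately have "sat AM d ?\<phi> = sat AM d' ?\<phi>" using bfD(5)[OF bfl] by blast
      moreover have "sat AM e ?\<phi> = rint M r (map (e \<circ> f) ts)" for e
        by (simp add: A_struct_def comp_def)
      ultimately show ?thesis using map by (simp only: sat.simps)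
    next
      case nA: False
      have no: "\<not> rint M r (map (e \<circ> f) ts)" if "\<exists>t\<in>set ts. e (f t) \<notin> AA" "\<And>t. e (f t) \<in> B" for e
      proof
        assume "rint M r (map (e \<circ> f) ts)"
        then have "set (map (e \<circ> f) ts) \<subseteq> AA"
          using alpha False that(2) by (intro rel_only_on_A[of r]) auto
        with that(1) show False by auto
      qed
      have "\<not> rint M r (map (d \<circ> f) ts)" by (rule no) (use nA inB in auto)
      moreover have "\<not> rint M r (map (d' \<circ> f) ts)" by (rule no) (use nA inA inB in auto)
      ultimately show ?thesis using map by (simp only: sat.simps)
    qed
  next
    case nalpha: False
    then have "r = A" "length ts = 1" using \<phi>(1) False by (auto simp: formulas_def lang2_def)
    then obtain t where t: "ts = [t]" by (auto simp: length_Suc_conv)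
    have "rint M A [d (f t)] = rint M A [d' (f t)]" using inA[of t] inB by (simp add: t A_part_def)
    moreover have "sat M (c \<circ> \<sigma>) (Rel r ts) = rint M A (map (d \<circ> f) ts)"
      "sat M (c' \<circ> \<sigma>) (Rel r ts) = rint M A (map (d' \<circ> f) ts)"
      using map \<open>r = A\<close> by (simp_all only: sat.simps)
    ultimately show ?thesis by (simp add: t)
  qed
qed

text \<open>The map \<sigma> separates variable names from tuple positions: under a quantifier, x is
  sent to whichever position i the chosen element occupies in the longer tuple.\<close>

lemma bf_sat:
  assumes "\<phi> \<in> formulas L2" "bf k c c'" "\<sigma> ` fv \<phi> \<subseteq> {..<k}"
  shows "sat M (c \<circ> \<sigma>) \<phi> = sat M (c' \<circ> \<sigma>) \<phi>"
  using assms
proof (induction \<phi> arbitrary: k c c' \<sigma>)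
  case (Eq s t)
  have "subst (Eq s t) \<sigma> \<in> formulas L\<beta>"
    using Eq.prems(1) tm_symbs_L2 unfolding subst_formulas by (auto simp: formulas_def)
  moreover have "fv (subst (Eq s t :: ('f, 'r) fm) \<sigma>) \<subseteq> {..<k}" by (rule order_trans[OF fv_subst Eq.prems(3)])
  ultimately show ?case using bfD(3)[OF Eq.prems(2)] unfolding sat_subst[symmetric] by blast
next
  case (Rel r ts)
  then show ?case by (intro bf_Rel)
next
  case (Imp \<phi> \<psi>)
  have sub: "\<sigma> ` fv \<phi> \<subseteq> {..<k}" "\<sigma> ` fv \<psi> \<subseteq> {..<k}" "\<phi> \<in> formulas L2" "\<psi> \<in> formulas L2"
    using Imp.prems(1,3) by auto
  have "sat M (c \<circ> \<sigma>) \<phi> = sat M (c' \<circ> \<sigma>) \<phi>" by (rule Imp.IH(1)[OF sub(3) Imp.prems(2) sub(1)])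
  moreover have "sat M (c \<circ> \<sigma>) \<psi> = sat M (c' \<circ> \<sigma>) \<psi>"
    by (rule Imp.IH(2)[OF sub(4) Imp.prems(2) sub(2)])
  ultimately show ?case by (simp only: sat.simps)
next
  case (Forall x \<phi>)
  have step: "\<exists>a'\<in>B. sat M ((c \<circ> \<sigma>)(x := a)) \<phi> = sat M ((c' \<circ> \<sigma>)(x := a')) \<phi>"
    if bf: "bf k c c'" and a: "a \<in> B" for c c' a
  proof -
    obtain l d d' i where d: "bf_extension k c c' l d d'" and i: "i < l" "d i = a"
      using forth[OF bf a] by blast
    then have bfl: "bf l d d'" and kl: "k \<le> l" and eq: "\<And>i. i < k \<Longrightarrow> d i = c i" "\<And>i. i < k \<Longrightarrow> d' i = c' i"
      by (auto simp: bf_extension_def)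
    have \<sigma>: "\<sigma> v < k" if "v \<in> fv \<phi>" "v \<noteq> x" for v using Forall.prems(3) that by auto
    have "(\<sigma>(x := i)) ` fv \<phi> \<subseteq> {..<l}" using \<sigma> i kl by (auto intro: less_le_trans)
    then have "sat M (d \<circ> \<sigma>(x := i)) \<phi> = sat M (d' \<circ> \<sigma>(x := i)) \<phi>"
      using Forall.prems(1) bfl by (intro Forall.IH) auto
    moreover have "sat M (d \<circ> \<sigma>(x := i)) \<phi> = sat M ((c \<circ> \<sigma>)(x := a)) \<phi>"
      by (rule sat_cong) (use \<sigma> eq i in auto)
    moreover have "sat M (d' \<circ> \<sigma>(x := i)) \<phi> = sat M ((c' \<circ> \<sigma>)(x := d' i)) \<phi>"
      by (rule sat_cong) (use \<sigma> eq i in auto)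
    moreover have "d' i \<in> B" using bfD(2)[OF bfl] by auto
    ultimately show ?thesis by blast
  qed
  show ?case
  proof
    assume "sat M (c \<circ> \<sigma>) (Forall x \<phi>)"
    then show "sat M (c' \<circ> \<sigma>) (Forall x \<phi>)" unfolding sat.simps
      using step[OF bf_sym[OF Forall.prems(2)]] by blast
  next
    assume "sat M (c' \<circ> \<sigma>) (Forall x \<phi>)"
    then show "sat M (c \<circ> \<sigma>) (Forall x \<phi>)" unfolding sat.simps
      using step[OF Forall.prems(2)] by blast
  qed
qed simp

subsection \<open>Generic tuples\<close>

text \<open>Being generic over A is an infinitary condition. Collecting all formulas it implies
  makes it a partial type, usable in compactness arguments.\<close>

definition generic_formulas :: "nat \<Rightarrow> ('f, 'r) fm set" where
  "generic_formulas j =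
     {\<gamma> \<in> formulas L2. \<forall>e. range e \<subseteq> B \<longrightarrow> e j \<notin> cl (AA \<union> e ` {..<j}) \<longrightarrow> sat M e \<gamma>}"

text \<open>If some \<phi> witnesses that \<open>e j\<close> is algebraic, let \<gamma> say that for
  all parameters from A, \<eta> implies that its fibre in variable j is infinite. This holds at
  every generic assignment, since a finite fibre gives algebraicity, but it fails at e.\<close>

lemma generic_formulas_suffice:
  assumes e: "range e \<subseteq> B" and sat: "\<forall>\<gamma>\<in>generic_formulas j. sat M e \<gamma>"
  shows "e j \<notin> cl (AA \<union> e ` {..<j})"
proof
  assume "e j \<in> cl (AA \<union> e ` {..<j})"
  then obtain \<phi> e0 where \<phi>: "\<phi> \<in> formulas L\<beta>" "e0 ` (fv \<phi> - {0}) \<subseteq> AA \<union> e ` {..<j}"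
    "psat M (e j) (\<phi>, e0)" "finite (psolutions M (\<phi>, e0))"
    by (auto simp: acl_def pformulas_def)
  \<comment> \<open>The object variable goes to j and parameters among the earlier entries to their
    least index. All other parameters come from A and get distinct variables above j, which \<gamma>
    quantifies.\<close>
  define \<sigma> where "\<sigma> v = (if v = 0 then j else if e0 v \<in> e ` {..<j} then LEAST i. e i = e0 v else Suc j + v)" for v
  define \<eta> where "\<eta> = subst \<phi> \<sigma>"
  define Y where "Y = \<sigma> ` fv \<phi> \<inter> {Suc j..}"
  define \<gamma> where "\<gamma> = Forall_set Y (Imp (Conj_set ((\<lambda>y. Rel A [Var y]) ` Y)) (Imp \<eta> (Infinite j \<eta>)))"
  have finY: "finite Y" by (simp add: Y_def)
  have \<eta>: "\<eta> \<in> formulas L\<beta>" using \<phi>(1) by (simp add: \<eta>_def)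
  have fv\<eta>: "i < j \<or> i = j \<or> i \<in> Y" if "i \<in> fv \<eta>" for i
    using that fv_subst[of \<phi> \<sigma>] by (auto simp: \<eta>_def Y_def)
  have least: "(LEAST i. e i = e0 v) < j" "e (LEAST i. e i = e0 v) = e0 v" if "e0 v \<in> e ` {..<j}" for v
    using that least_index[of "e0 v" e j "\<lambda>_. True"] by (auto simp: lessThan_def)
  have "Rel A [Var y] \<in> formulas L2" for y by (auto simp: formulas_def lang2_def)
  then have \<gamma>L: "\<gamma> \<in> formulas L2"
    using formulas_beta[OF \<eta>] formulas_beta[OF Infinite(1)[OF \<eta>]] finY
    by (auto simp: \<gamma>_def Conj_set_formulas)
  have sat\<gamma>: "sat M e \<gamma> \<longleftrightarrow> (\<forall>e1. (\<forall>i. i \<notin> Y \<longrightarrow> e1 i = e i) \<and> e1 ` Y \<subseteq> AA \<and> sat M e1 \<eta> \<longrightarrow>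
      infinite {a \<in> B. sat M (e1(j := a)) \<eta>})" if e: "range e \<subseteq> B" for e
  proof -
    have "range e1 \<subseteq> B" if "\<forall>i. i \<notin> Y \<longrightarrow> e1 i = e i" "e1 ` Y \<subseteq> B" for e1
    proof -
      have "e1 i \<in> B" for i using that e by (cases "i \<in> Y") auto
      then show ?thesis by auto
    qed
    then have inf: "sat M e1 (Infinite j \<eta>) \<longleftrightarrow> infinite {a \<in> B. sat M (e1(j := a)) \<eta>}"
      if "\<forall>i. i \<notin> Y \<longrightarrow> e1 i = e i" "e1 ` Y \<subseteq> B" for e1
      using Infinite(3)[OF \<eta> models_beta] that by blast
    have mem: "e1 ` Y \<subseteq> B \<and> (\<forall>y\<in>Y. rint M A [e1 y]) \<longleftrightarrow> e1 ` Y \<subseteq> AA" for e1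
      by (auto simp: A_part_def)
    have "sat M e \<gamma> \<longleftrightarrow> (\<forall>e1. (\<forall>i. i \<notin> Y \<longrightarrow> e1 i = e i) \<and> e1 ` Y \<subseteq> B \<longrightarrow>
        (\<forall>y\<in>Y. rint M A [e1 y]) \<longrightarrow> sat M e1 \<eta> \<longrightarrow> sat M e1 (Infinite j \<eta>))"
      using finY by (simp add: \<gamma>_def sat_Forall_set sat_Conj_set)
    also have "\<dots> \<longleftrightarrow> (\<forall>e1. (\<forall>i. i \<notin> Y \<longrightarrow> e1 i = e i) \<and> e1 ` Y \<subseteq> AA \<and> sat M e1 \<eta> \<longrightarrow>
        infinite {a \<in> B. sat M (e1(j := a)) \<eta>})"
    proof (rule all_cong1)
      fix e1
      show "((\<forall>i. i \<notin> Y \<longrightarrow> e1 i = e i) \<and> e1 ` Y \<subseteq> B \<longrightarrow>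
          (\<forall>y\<in>Y. rint M A [e1 y]) \<longrightarrow> sat M e1 \<eta> \<longrightarrow> sat M e1 (Infinite j \<eta>)) \<longleftrightarrow>
        ((\<forall>i. i \<notin> Y \<longrightarrow> e1 i = e i) \<and> e1 ` Y \<subseteq> AA \<and> sat M e1 \<eta> \<longrightarrow>
          infinite {a \<in> B. sat M (e1(j := a)) \<eta>})"
        using inf[of e1] mem[of e1] by argo
    qed
    finally show ?thesis .
  qed
  have "\<gamma> \<in> generic_formulas j"
    unfolding generic_formulas_def
  proof (intro CollectI conjI \<gamma>L allI impI)
    fix e assume e: "range e \<subseteq> B" "e j \<notin> cl (AA \<union> e ` {..<j})"
    show "sat M e \<gamma>"
      unfolding sat\<gamma>[OF e(1)]
    proof (intro allI impI notI)
      fix e1 assume e1: "(\<forall>i. i \<notin> Y \<longrightarrow> e1 i = e i) \<and> e1 ` Y \<subseteq> AA \<and> sat M e1 \<eta>"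
        and fin: "finite {a \<in> B. sat M (e1(j := a)) \<eta>}"
      have j: "e1 j = e j" using e1 by (auto simp: Y_def)
      have "e1 j \<in> cl (e1 ` (fv \<eta> - {j}))"
      proof (rule acl_tupleI[OF \<eta>])
        show "sat M (e1(j := e1 j)) \<eta>" using e1 by simp
        show "e1 j \<in> B" using j e(1) by auto
      qed (use fin in auto)
      moreover have "e1 i \<in> AA \<union> e ` {..<j}" if "i \<in> fv \<eta> - {j}" for i
        using fv\<eta>[of i] that e1 by (auto simp: Y_def)
      then have "e1 ` (fv \<eta> - {j}) \<subseteq> AA \<union> e ` {..<j}" by auto
      moreover have "AA \<union> e ` {..<j} \<subseteq> B" using AA_subset e(1) by auto
      ultimately have "e1 j \<in> cl (AA \<union> e ` {..<j})" using cl_mono by blast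
      then show False using e(2) j by simp
    qed
  qed
  then have "sat M e \<gamma>" using sat by blast
  \<comment> \<open>On Y the original parameters are restored: position \<open>Suc j + v\<close>
    holds \<open>e0 v\<close>.\<close>
  define e1 where "e1 i = (if i \<in> Y then e0 (i - Suc j) else e i)" for i
  have psat: "sat M (e1(j := a)) \<eta> = psat M a (\<phi>, e0)" for a
    unfolding \<eta>_def sat_subst psat_Pair
  proof (rule sat_cong)
    fix v assume v: "v \<in> fv \<phi>"
    show "(e1(j := a) \<circ> \<sigma>) v = (e0(0 := a)) v"
    proof (cases "v \<noteq> 0 \<and> e0 v \<notin> e ` {..<j}")
      case True
      then have "\<sigma> v = Suc j + v" by (simp add: \<sigma>_def)
      moreover from this v have "Suc j + v \<in> Y" by (force simp: Y_def)
      ultimately show ?thesis using True by (simp add: e1_def)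
    next
      case False
      then show ?thesis using least[of v] by (auto simp: \<sigma>_def e1_def Y_def)
    qed
  qed
  have "e1 i \<in> AA" if i: "i \<in> Y" for i
  proof -
    obtain v where v: "v \<in> fv \<phi>" "i = \<sigma> v" "Suc j \<le> \<sigma> v" using i by (auto simp: Y_def)
    then have "v \<noteq> 0" "e0 v \<notin> e ` {..<j}" using least(1)[of v] by (auto simp: \<sigma>_def split: if_splits)
    then show ?thesis using v \<phi>(2) i by (auto simp: e1_def \<sigma>_def)
  qed
  then have "e1 ` Y \<subseteq> AA" by auto
  moreover have "sat M e1 \<eta>"
  proof -
    have "e1(j := e j) = e1" by (auto simp: e1_def Y_def)
    with psat[of "e j"] \<phi>(3) show ?thesis by simp
  qed
  moreover have "\<forall>i. i \<notin> Y \<longrightarrow> e1 i = e i" by (simp add: e1_def)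
  ultimately have "infinite {a \<in> B. sat M (e1(j := a)) \<eta>}"
    using \<open>sat M e \<gamma>\<close> unfolding sat\<gamma>[OF e] by blast
  then show False using \<phi>(4) by (simp add: psat psolutions_def)
qed

definition generic :: "nat \<Rightarrow> nat \<Rightarrow> (nat \<Rightarrow> 'b) \<Rightarrow> bool" where
  "generic k K e \<longleftrightarrow> (\<forall>j. k \<le> j \<and> j < K \<longrightarrow> e j \<notin> cl (AA \<union> e ` {..<j}))"

lemma generic_cong: "generic k K e \<Longrightarrow> (\<And>i. i < K \<Longrightarrow> e' i = e i) \<Longrightarrow> generic k K e'"
proof -
  assume g: "generic k K e" and eq: "\<And>i. i < K \<Longrightarrow> e' i = e i"
  have "e' ` {..<j} = e ` {..<j}" if "j < K" for j by (rule image_cong) (use that eq in auto)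
  with g eq show ?thesis by (simp add: generic_def)
qed

lemma free_from_A_generic:
  assumes "free_from_A (e ` {..<k})" "range e \<subseteq> B" "k \<le> K" "generic k K e"
  shows "free_from_A (e ` {..<K})"
  using assms(3,1,4)
proof (induction rule: dec_induct)
  case (step l)
  then have "free_from_A (e ` {..<l})" by (auto simp: generic_def)
  then have "free_from_A (insert (e l) (e ` {..<l}))"
    by (rule free_insert_generic[rotated]) (use assms(2) step in \<open>auto simp: generic_def\<close>)
  then show ?case by (simp add: lessThan_Suc)
qed

text \<open>Generic entries lie outside A, so the parts of both tuples in A occur below k, where the
  tuples coincide. This settles the \<open>L\<alpha>\<close>-types.\<close>

lemma bf_generic:
  assumes c: "free_from_A (e ` {..<k})" "k \<le> K" and e: "range e \<subseteq> B" "range e' \<subseteq> B"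
    and eq: "\<And>i. i < k \<Longrightarrow> e' i = e i" and gen: "generic k K e" "generic k K e'"
    and beta: "\<And>\<phi>. \<phi> \<in> formulas L\<beta> \<Longrightarrow> fv \<phi> \<subseteq> {..<K} \<Longrightarrow> sat M e \<phi> \<Longrightarrow> sat M e' \<phi>"
  shows "bf K e e'"
  unfolding bf_def
proof (intro conjI ballI impI allI e)
  show "free_from_A (e ` {..<K})" by (rule free_from_A_generic[OF c(1) e(1) c(2) gen(1)])
  have "e' ` {..<k} = e ` {..<k}" using eq by (intro image_cong) auto
  then have "free_from_A (e' ` {..<k})" using c(1) by simp
  then show "free_from_A (e' ` {..<K})" by (rule free_from_A_generic[OF _ e(2) c(2) gen(2)])
  show "sat M e \<phi> = sat M e' \<phi>" if "\<phi> \<in> formulas L\<beta>" "fv \<phi> \<subseteq> {..<K}" for \<phi>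
    using beta[of \<phi>] beta[of "Neg \<phi>"] that by auto
  have ge: "d i \<notin> AA" if "k \<le> i" "i < K" "generic k K d" "range d \<subseteq> B" for d i
  proof -
    have "AA \<union> d ` {..<i} \<subseteq> B" using AA_subset that by auto
    then have "AA \<subseteq> cl (AA \<union> d ` {..<i})" using cl_ext by blast
    then show ?thesis using that by (auto simp: generic_def)
  qed
  show "e i \<in> AA \<longleftrightarrow> e' i \<in> AA" if "i < K" for i
    using eq[of i] ge[of i e] ge[of i e'] gen e that by (cases "i < k") auto
  show "sat AM e \<phi> = sat AM e' \<phi>" if "fv \<phi> \<subseteq> {i. i < K \<and> e i \<in> AA}" for \<phi>
  proof (rule sat_cong)
    fix i assume "i \<in> fv \<phi>"
    then have "i < K" "e i \<in> AA" using that by auto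
    then have "i < k" using ge[OF _ _ gen(1) e(1), of i] by (cases "i < k") auto
    then show "e i = e' i" using eq by simp
  qed
qed

section \<open>Iterated infinite quantifiers\<close>

lemma foldr_Infinite:
  assumes "\<phi> \<in> formulas L\<beta>"
  shows "foldr Infinite xs \<phi> \<in> formulas L\<beta>" "fv (foldr Infinite xs \<phi>) \<subseteq> fv \<phi> - set xs"
proof -
  have "foldr Infinite xs \<phi> \<in> formulas L\<beta> \<and> fv (foldr Infinite xs \<phi>) \<subseteq> fv \<phi> - set xs"
  proof (induction xs)
    case (Cons x xs)
    with Infinite(1,2)[of "foldr Infinite xs \<phi>" x] show ?case by auto
  qed (use assms in simp)
  then show "foldr Infinite xs \<phi> \<in> formulas L\<beta>" "fv (foldr Infinite xs \<phi>) \<subseteq> fv \<phi> - set xs" by auto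
qed

text \<open>The quantifiers are added from the innermost, variable K - 1, outwards. With finitely
  many values at stage l, the entry \<open>e l\<close> would be algebraic over the earlier entries
  and the variables of \<phi> beyond the block, contrary to \<open>gen\<close>.\<close>

lemma Infinite_block_intro:
  assumes \<phi>: "\<phi> \<in> formulas L\<beta>" and e: "range e \<subseteq> B" "sat M e \<phi>" and "k \<le> K"
    and gen: "\<And>j. k \<le> j \<Longrightarrow> j < K \<Longrightarrow> e j \<notin> cl (e ` ({..<j} \<union> (fv \<phi> - {..<K})))"
  shows "sat M e (foldr Infinite [k..<K] \<phi>)"
  using \<open>k \<le> K\<close> gen
proof (induction rule: inc_induct)
  case (step l)
  let ?\<psi> = "foldr Infinite [Suc l..<K] \<phi>"
  note \<psi> = foldr_Infinite[OF \<phi>, of "[Suc l..<K]"]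
  have "infinite {a \<in> B. sat M (e(l := a)) ?\<psi>}"
  proof
    assume fin: "finite {a \<in> B. sat M (e(l := a)) ?\<psi>}"
    have "e l \<in> cl (e ` (fv ?\<psi> - {l}))"
      by (rule acl_tupleI[OF \<psi>(1)]) (use fin step e in auto)
    moreover have "fv ?\<psi> - {l} \<subseteq> {..<l} \<union> (fv \<phi> - {..<K})"
    proof
      fix i assume "i \<in> fv ?\<psi> - {l}"
      then have "i \<in> fv \<phi>" "i \<notin> {Suc l..<K}" "i \<noteq> l" using \<psi>(2) by auto
      then show "i \<in> {..<l} \<union> (fv \<phi> - {..<K})" by auto
    qed
    then have "cl (e ` (fv ?\<psi> - {l})) \<subseteq> cl (e ` ({..<l} \<union> (fv \<phi> - {..<K})))"
      by (intro cl_mono image_mono) (use e in auto)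
    ultimately show False using step.prems[of l] step.hyps by auto
  qed
  then have "sat M e (Infinite l ?\<psi>)" using Infinite(3)[OF \<psi>(1) models_beta e(1)] by simp
  then show ?case using step.hyps by (simp add: upt_conv_Cons)
qed (use e in simp)

text \<open>The quantifiers are removed from the outermost inwards, codensity providing for each a
  witness generic over A and all earlier entries.\<close>

lemma Infinite_block_elim:
  assumes \<phi>: "\<phi> \<in> formulas L\<beta>" and e: "range e \<subseteq> B" "sat M e (foldr Infinite [k..<K] \<phi>)" and "k \<le> K"
  shows "\<exists>e'. range e' \<subseteq> B \<and> (\<forall>i. i \<notin> {k..<K} \<longrightarrow> e' i = e i) \<and> generic k K e' \<and> sat M e' \<phi>"
proof -
  have "\<exists>e'. range e' \<subseteq> B \<and> (\<forall>i. i \<notin> {k..<l} \<longrightarrow> e' i = e i) \<and> generic k l e' \<and>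
      sat M e' (foldr Infinite [l..<K] \<phi>)" if "k \<le> l" "l \<le> K" for l
    using that
  proof (induction rule: dec_induct)
    case base
    show ?case by (rule exI[of _ e]) (use e in \<open>auto simp: generic_def\<close>)
  next
    case (step l)
    then obtain e' where e': "range e' \<subseteq> B" "\<forall>i. i \<notin> {k..<l} \<longrightarrow> e' i = e i" "generic k l e'"
      "sat M e' (foldr Infinite [l..<K] \<phi>)" by auto
    let ?\<psi> = "foldr Infinite [Suc l..<K] \<phi>"
    note \<psi> = foldr_Infinite[OF \<phi>, of "[Suc l..<K]"]
    have "sat M e' (Infinite l ?\<psi>)" using e'(4) step.prems by (simp add: upt_conv_Cons)
    then have "infinite {a \<in> B. sat M (e'(l := a)) ?\<psi>}"
      using Infinite(3)[OF \<psi>(1) models_beta e'(1)] by simp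
    then obtain b where b: "b \<in> B" "sat M (e'(l := b)) ?\<psi>" "b \<notin> cl (AA \<union> e' ` {..<l})"
      using codensity[OF \<psi>(1) e'(1), of l "e' ` {..<l}"] e'(1) by blast
    have "generic k (Suc l) (e'(l := b))"
      unfolding generic_def
    proof (intro allI impI)
      fix j assume j: "k \<le> j \<and> j < Suc l"
      have im: "(e'(l := b)) ` {..<j} = e' ` {..<j}" by (rule image_cong) (use j in auto)
      show "(e'(l := b)) j \<notin> cl (AA \<union> (e'(l := b)) ` {..<j})"
      proof (cases "j = l")
        case True
        then show ?thesis using b(3) im by simp
      next
        case False
        then show ?thesis using e'(3) im j by (auto simp: generic_def)
      qed
    qed
    moreover have "\<forall>i. i \<notin> {k..<Suc l} \<longrightarrow> (e'(l := b)) i = e i" using e'(2) step.hyps by auto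
    moreover have "range (e'(l := b)) \<subseteq> B" using e'(1) b(1) by auto
    ultimately show ?case using b(2) by blast
  qed
  from this[of K] assms(4) show ?thesis by simp
qed

subsection \<open>Open sets\<close>

lemma n_pos: "0 < n"
  by (rule topology[unfolded definable_topology_def, THEN conjunct1])

lemma \<tau>_formula: "\<tau> \<in> formulas L\<beta>"
  by (rule topology[unfolded definable_topology_def, THEN conjunct2, THEN conjunct1])

lemma fv_\<tau>: "fv \<tau> \<subseteq> {..n}"
  by (rule topology[unfolded definable_topology_def, THEN conjunct2, THEN conjunct2, THEN conjunct1])

lemmas topology_M = topology[unfolded definable_topology_def, THEN conjunct2, THEN conjunct2,
    THEN conjunct2, THEN spec, THEN mp, OF models_beta]

lemma openin_tau_top:
  "openin (tau_top M n \<tau>) = arbitrary union_of (\<lambda>S. S \<in> tau_basis M n \<tau>)"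
  unfolding tau_top_def by (rule topology_inverse'[OF topology_M[THEN conjunct1]])

text \<open>A nonempty open set contains a nonempty basic set, which is infinite and
  \<open>L\<beta>\<close>-definable, so codensity applies.\<close>

lemma open_contains_generic:
  assumes U: "openin (tau_top M n \<tau>) U" "U \<noteq> {}" and D: "finite D" "D \<subseteq> B"
  obtains b where "b \<in> U" "b \<in> B" "b \<notin> cl (AA \<union> D)"
proof -
  obtain S where S: "S \<in> tau_basis M n \<tau>" "S \<subseteq> U" "S \<noteq> {}"
    using U unfolding openin_tau_top union_of_def by auto
  have "infinite S" using topology_M[THEN conjunct2, THEN conjunct2, THEN conjunct1] S by blast
  obtain d where d: "d \<in> {..<n} \<rightarrow>\<^sub>E B" "S = tau_set M \<tau> d" using S(1) by (auto simp: tau_basis_def)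
  obtain u where u: "u \<in> B" using B_nonempty by auto
  define c where "c = case_nat u (\<lambda>j. if j < n then d j else u)"
  have "c i \<in> B" for i using d(1) u by (cases i) (auto simp: c_def)
  then have c: "range c \<subseteq> B" by auto
  have "sat M (c(0 := b)) \<tau> = sat M (case_nat b d) \<tau>" for b
    by (rule sat_cong) (use fv_\<tau> in \<open>auto simp: c_def split: nat.splits\<close>)
  then have "{b \<in> B. sat M (c(0 := b)) \<tau>} = S" by (simp add: d(2) tau_set_def)
  with codensity[OF \<tau>_formula c _ D, of 0] \<open>infinite S\<close> S(2) that show thesis by blast
qed

text \<open>The parameters of a box occupy the variables \<open>k, \<dots>, k + m * n - 1\<close>.\<close>

definition box_params :: "nat \<Rightarrow> nat \<Rightarrow> (nat \<Rightarrow> 'b) \<Rightarrow> nat \<times> nat \<Rightarrow> 'b" where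
  "box_params k m e = (\<lambda>(i, j)\<in>{..<m} \<times> {..<n}. e (k + i * n + j))"

lemma box_index: "i < m \<Longrightarrow> j < n \<Longrightarrow> k + i * n + j < k + m * n"
proof -
  assume "i < m" "j < n"
  then have "i * n + j < Suc i * n" by simp
  also have "\<dots> \<le> m * n" using \<open>i < m\<close> by (intro mult_le_mono1) simp
  finally show ?thesis by simp
qed

lemma box_params_cong:
  "(\<And>i. k \<le> i \<Longrightarrow> i < k + m * n \<Longrightarrow> e i = e' i) \<Longrightarrow> box_params k m e = box_params k m e'"
  using box_index by (fastforce simp: box_params_def restrict_def)

text \<open>An open set of parameters contains a product of nonempty open sets around each of its
  points. Its coordinates are chosen one after the other, each generic over A, D and everything
  before it.\<close>

lemma generic_box_params:
  assumes O: "openin (product_topology (\<lambda>_. tau_top M n \<tau>) ({..<m} \<times> {..<n})) W" "W \<noteq> {}"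
    and e: "range e \<subseteq> B" and D: "finite D" "D \<subseteq> B"
  obtains e' where "range e' \<subseteq> B" "\<And>i. i \<notin> {k..<k + m * n} \<Longrightarrow> e' i = e i"
    "box_params k m e' \<in> W"
    "\<And>j. k \<le> j \<Longrightarrow> j < k + m * n \<Longrightarrow> e' j \<notin> cl (AA \<union> (D \<union> e' ` {..<j}))"
proof -
  let ?I = "{..<m} \<times> {..<n}"
  obtain w where w: "w \<in> W" using O(2) by auto
  from bspec[OF O(1)[unfolded openin_product_topology_alt] w] obtain U where
    U: "\<forall>p\<in>?I. openin (tau_top M n \<tau>) (U p)" "w \<in> Pi\<^sub>E ?I U" "Pi\<^sub>E ?I U \<subseteq> W"
    by blast
  \<comment> \<open>Division with remainder by n recovers the coordinate (i, j) from position k + i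
    * n + j.\<close>
  define U' where "U' j = U ((j - k) div n, (j - k) mod n)" for j
  have U': "openin (tau_top M n \<tau>) (U' j)" "U' j \<noteq> {}" if "k \<le> j" "j < k + m * n" for j
  proof -
    have "j - k < m * n" using that by simp
    then have "((j - k) div n, (j - k) mod n) \<in> ?I"
      using n_pos by (auto intro: less_mult_imp_div_less)
    then show "openin (tau_top M n \<tau>) (U' j)" "U' j \<noteq> {}" using U(1,2) by (auto simp: U'_def)
  qed
  have "\<exists>e'. range e' \<subseteq> B \<and> (\<forall>i. i \<notin> {k..<l} \<longrightarrow> e' i = e i) \<and>
      (\<forall>j. k \<le> j \<and> j < l \<longrightarrow> e' j \<in> U' j \<and> e' j \<notin> cl (AA \<union> (D \<union> e' ` {..<j})))"
    if "k \<le> l" "l \<le> k + m * n" for l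
    using that
  proof (induction rule: dec_induct)
    case base
    show ?case by (rule exI[of _ e]) (use e in auto)
  next
    case (step l)
    then obtain e' where e': "range e' \<subseteq> B" "\<forall>i. i \<notin> {k..<l} \<longrightarrow> e' i = e i"
      "\<forall>j. k \<le> j \<and> j < l \<longrightarrow> e' j \<in> U' j \<and> e' j \<notin> cl (AA \<union> (D \<union> e' ` {..<j}))" by auto
    have fin: "finite (D \<union> e' ` {..<l})" "D \<union> e' ` {..<l} \<subseteq> B" using D e'(1) by auto
    have kl: "k \<le> l" "l < k + m * n" using step by auto
    obtain b where b: "b \<in> U' l" "b \<in> B" "b \<notin> cl (AA \<union> (D \<union> e' ` {..<l}))"
      using open_contains_generic[OF U'[OF kl] fin] by blast
    have im: "(e'(l := b)) ` {..<j} = e' ` {..<j}" if "j \<le> l" for j by (rule image_cong) (use that in auto)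
    have "(e'(l := b)) j \<in> U' j \<and> (e'(l := b)) j \<notin> cl (AA \<union> (D \<union> (e'(l := b)) ` {..<j}))"
      if "k \<le> j \<and> j < Suc l" for j
      using that e'(3) b im[of j] by (cases "j = l") auto
    moreover have "\<forall>i. i \<notin> {k..<Suc l} \<longrightarrow> (e'(l := b)) i = e i" using e'(2) kl by auto
    moreover have "range (e'(l := b)) \<subseteq> B" using e'(1) b(2) by auto
    ultimately show ?case by blast
  qed
  from this[of "k + m * n"] obtain e' where e': "range e' \<subseteq> B" "\<forall>i. i \<notin> {k..<k + m * n} \<longrightarrow> e' i = e i"
    "\<forall>j. k \<le> j \<and> j < k + m * n \<longrightarrow> e' j \<in> U' j \<and> e' j \<notin> cl (AA \<union> (D \<union> e' ` {..<j}))" by auto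
  have "box_params k m e' \<in> Pi\<^sub>E ?I U"
  proof (rule PiE_I)
    fix p assume "p \<in> ?I"
    then obtain i j where p: "p = (i, j)" "i < m" "j < n" by auto
    have "e' (k + i * n + j) \<in> U' (k + i * n + j)" using e'(3) box_index[OF p(2,3), of k] by auto
    moreover have "U' (k + i * n + j) = U p" using p(3) by (simp add: U'_def p(1))
    ultimately show "box_params k m e' p \<in> U p" using p by (simp add: box_params_def)
  qed (auto simp: box_params_def)
  then have "box_params k m e' \<in> W" using U(3) by blast
  with e' that show thesis by blast
qed

text \<open>Says that the point stored in the m variables from k + m * n on lies in the box whose
  parameters are stored from k on.\<close>

definition box_fm :: "nat \<Rightarrow> nat \<Rightarrow> ('f, 'r) fm" where
  "box_fm k m =
     Conj_set ((\<lambda>i. subst \<tau> (case_nat (k + m * n + i) (\<lambda>j. k + i * n + j))) ` {..<m})"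

lemma box_fm_formulas: "box_fm k m \<in> formulas L\<beta>"
  using \<tau>_formula by (auto simp: box_fm_def Conj_set_formulas)

lemma fv_box_fm: "fv (box_fm k m) \<subseteq> {k..<k + m * n + m}"
proof
  fix v assume "v \<in> fv (box_fm k m)"
  then obtain i where i: "i < m" "v \<in> fv (subst \<tau> (case_nat (k + m * n + i) (\<lambda>j. k + i * n + j)))"
    by (auto simp: box_fm_def fv_Conj_set)
  then obtain w where w: "w \<in> fv \<tau>" "v = case_nat (k + m * n + i) (\<lambda>j. k + i * n + j) w"
    using fv_subst by blast
  show "v \<in> {k..<k + m * n + m}"
  proof (cases w)
    case (Suc j)
    then have "j < n" using w(1) fv_\<tau> by auto
    then show ?thesis using w(2) Suc box_index[OF i(1), of j k] by simp
  qed (use w(2) i(1) in simp)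
qed

definition point :: "nat \<Rightarrow> nat \<Rightarrow> (nat \<Rightarrow> 'b) \<Rightarrow> nat \<Rightarrow> 'b" where
  "point K m e = (\<lambda>i\<in>{..<m}. e (K + i))"

lemma sat_box_fm:
  assumes "range e \<subseteq> B"
  shows "sat M e (box_fm k m) \<longleftrightarrow> point (k + m * n) m e \<in> tau_box M \<tau> m (box_params k m e)"
proof -
  have "sat M e (subst \<tau> (case_nat (k + m * n + i) (\<lambda>j. k + i * n + j))) \<longleftrightarrow>
      e (k + m * n + i) \<in> tau_set M \<tau> (\<lambda>j. box_params k m e (i, j))" if i: "i < m" for i
  proof -
    have "sat M (e \<circ> case_nat (k + m * n + i) (\<lambda>j. k + i * n + j)) \<tau> =
        sat M (case_nat (e (k + m * n + i)) (\<lambda>j. box_params k m e (i, j))) \<tau>"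
      by (rule sat_cong) (use fv_\<tau> i in \<open>auto simp: box_params_def split: nat.splits\<close>)
    moreover have "e (k + m * n + i) \<in> B" using assms by auto
    ultimately show ?thesis by (simp add: sat_subst tau_set_def)
  qed
  then show ?thesis
    by (auto simp: box_fm_def sat_Conj_set tau_box_def point_def PiE_iff)
qed

lemma definable_set_reindex:
  assumes "\<phi> \<in> formulas L" "range c \<subseteq> B"
  shows "definable_set L M m
    {x \<in> {..<m} \<rightarrow>\<^sub>E B. sat M (\<lambda>i. if K \<le> i \<and> i < K + m then x (i - K) else c i) \<phi>}"
  unfolding definable_set_def
proof (intro bexI exI conjI)
  \<comment> \<open>The block of the point moves to the variables below m, as
    \<open>definable_set\<close> expects, and every parameter moves up by m to stay clear of
    it.\<close>
  let ?\<sigma> = "\<lambda>i. if K \<le> i \<and> i < K + m then i - K else i + m"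
  show "subst \<phi> ?\<sigma> \<in> formulas L" using assms(1) by simp
  show "range (\<lambda>i. c (i - m)) \<subseteq> B" using assms(2) by auto
  have "(\<lambda>i. if i < m then x i else c (i - m)) \<circ> ?\<sigma> = (\<lambda>i. if K \<le> i \<and> i < K + m then x (i - K) else c i)"
    for x :: "nat \<Rightarrow> 'b" by (auto simp: fun_eq_iff)
  then show "{x \<in> {..<m} \<rightarrow>\<^sub>E B. sat M (\<lambda>i. if K \<le> i \<and> i < K + m then x (i - K) else c i) \<phi>} =
      {x \<in> {..<m} \<rightarrow>\<^sub>E B. sat M (\<lambda>i. if i < m then x i else c (i - m)) (subst \<phi> ?\<sigma>)}"
    by (simp add: sat_subst)
qed

end

section \<open>Definability of one fixed open set\<close>

text \<open>Variables below k hold the parameters c, the next m * n the parameters of a box, and the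
  following m a point.\<close>

locale definable_open = ml_model L\<alpha> L\<beta> A T\<alpha> T\<beta> T \<tau> n M \<kappa>
  for L\<alpha> L\<beta> :: "('f, 'r) lang" and A :: 'r
    and T\<alpha> T\<beta> T :: "('f, 'r) fm set" and \<tau> :: "('f, 'r) fm" and n :: nat
    and M :: "('f, 'r, 'b) struct" and \<kappa> :: "'k rel" +
  fixes m :: nat and V :: "(nat \<Rightarrow> 'b) set" and \<phi> :: "('f, 'r) fm" and c :: "nat \<Rightarrow> 'b" and k :: nat
  assumes open_V: "openin (product_topology (\<lambda>_. tau_top M n \<tau>) {..<m}) V"
    and \<phi>: "\<phi> \<in> formulas L2" "fv \<phi> \<subseteq> {..<k} \<union> {k + m * n..<k + m * n + m}"
    and V_def: "\<And>e. range e \<subseteq> B \<Longrightarrow> (\<And>i. i < k \<Longrightarrow> e i = c i) \<Longrightarrow>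
      sat M e \<phi> \<longleftrightarrow> point (k + m * n) m e \<in> V"
    and c: "range c \<subseteq> B" "free_from_A (c ` {..<k})"
begin

abbreviation "K \<equiv> k + m * n"

definition over_c :: "(nat \<Rightarrow> 'b) \<Rightarrow> bool" where
  "over_c e \<longleftrightarrow> range e \<subseteq> B \<and> (\<forall>i<k. e i = c i)"

definition box_in_V :: "('f, 'r) fm" where
  "box_in_V = Forall_set {K..<K + m} (Imp (box_fm k m) \<phi>)"

lemma V_subset: "V \<subseteq> {..<m} \<rightarrow>\<^sub>E B"
proof -
  have "\<Union>(tau_basis M n \<tau>) = B" by (rule topology_M[THEN conjunct2, THEN conjunct1])
  then have "topspace (tau_top M n \<tau>) \<subseteq> B"
    unfolding topspace_def openin_tau_top union_of_def by auto
  then have "topspace (product_topology (\<lambda>_. tau_top M n \<tau>) {..<m}) \<subseteq> {..<m} \<rightarrow>\<^sub>E B"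
    unfolding topspace_product_topology by (intro PiE_mono) auto
  then show ?thesis using openin_subset[OF open_V] by (rule order_trans[rotated])
qed

lemma box_in_V_formulas: "box_in_V \<in> formulas L2"
  using \<phi>(1) formulas_beta[OF box_fm_formulas] by (simp add: box_in_V_def)

lemma fv_box_in_V: "fv box_in_V \<subseteq> {..<K}"
proof -
  have "fv (box_fm k m) \<union> fv \<phi> - {K..<K + m} \<subseteq> {..<K}"
    using fv_box_fm[of k m] \<phi>(2) by fastforce
  then show ?thesis by (simp add: box_in_V_def fv_Forall_set)
qed

lemma sat_box_in_V:
  assumes e: "over_c e"
  shows "sat M e box_in_V \<longleftrightarrow> tau_box M \<tau> m (box_params k m e) \<subseteq> V"
proof -
  have ext: "over_c e'" "box_params k m e' = box_params k m e"
    if "\<forall>i. i \<notin> {K..<K + m} \<longrightarrow> e' i = e i" "e' ` {K..<K + m} \<subseteq> B" for e'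
  proof -
    have "e' i \<in> B" for i using that e by (cases "i \<in> {K..<K + m}") (auto simp: over_c_def)
    then show "over_c e'" using that(1) e by (auto simp: over_c_def)
    show "box_params k m e' = box_params k m e" by (rule box_params_cong) (use that(1) in auto)
  qed
  have sat: "sat M e' (Imp (box_fm k m) \<phi>) \<longleftrightarrow>
      (point K m e' \<in> tau_box M \<tau> m (box_params k m e') \<longrightarrow> point K m e' \<in> V)" if "over_c e'" for e'
    using sat_box_fm[of e'] V_def[of e'] that by (simp add: over_c_def)
  show ?thesis
  proof
    assume l: "sat M e box_in_V"
    show "tau_box M \<tau> m (box_params k m e) \<subseteq> V"
    proof
      fix x assume x: "x \<in> tau_box M \<tau> m (box_params k m e)"
      then have xB: "x \<in> {..<m} \<rightarrow>\<^sub>E B" by (auto simp: tau_box_def tau_set_def PiE_iff)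
      define e' where "e' i = (if i \<in> {K..<K + m} then x (i - K) else e i)" for i
      have e': "\<forall>i. i \<notin> {K..<K + m} \<longrightarrow> e' i = e i" "e' ` {K..<K + m} \<subseteq> B"
        using xB by (auto simp: e'_def PiE_iff)
      have "point K m e' = x"
        using xB by (auto simp: point_def e'_def fun_eq_iff PiE_iff extensional_def)
      moreover have "sat M e' (Imp (box_fm k m) \<phi>)"
        using l e' unfolding box_in_V_def sat_Forall_set[OF finite_atLeastLessThan] by blast
      ultimately show "x \<in> V" using sat[OF ext(1)[OF e']] ext(2)[OF e'] x by simp
    qed
  next
    assume "tau_box M \<tau> m (box_params k m e) \<subseteq> V"
    then show "sat M e box_in_V"
      unfolding box_in_V_def sat_Forall_set[OF finite_atLeastLessThan] using sat ext by (metis subsetD)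
  qed
qed

definition good :: "('f, 'r) fm set" where
  "good = {\<eta> \<in> formulas L\<beta>. fv \<eta> \<subseteq> {..<K} \<and>
     (\<forall>e. over_c e \<and> generic k K e \<and> sat M e \<eta> \<longrightarrow> tau_box M \<tau> m (box_params k m e) \<subseteq> V)}"

definition many_boxes :: "('f, 'r) fm \<Rightarrow> ('f, 'r) fm" where
  "many_boxes \<eta> = foldr Infinite [k..<K] (Conj \<eta> (box_fm k m))"

lemma many_boxes:
  assumes "\<eta> \<in> formulas L\<beta>"
  shows "many_boxes \<eta> \<in> formulas L\<beta>" "fv (many_boxes \<eta>) \<subseteq> fv \<eta> \<union> {K..<K + m} - {k..<K}"
proof -
  have \<eta>: "Conj \<eta> (box_fm k m) \<in> formulas L\<beta>" using assms box_fm_formulas by simp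
  note H = foldr_Infinite[OF \<eta>, of "[k..<K]"]
  show "many_boxes \<eta> \<in> formulas L\<beta>" using H(1) by (simp add: many_boxes_def)
  show "fv (many_boxes \<eta>) \<subseteq> fv \<eta> \<union> {K..<K + m} - {k..<K}"
    using H(2) fv_box_fm[of k m] unfolding many_boxes_def by fastforce
qed

text \<open>The infinite quantifiers yield at least one generic box through the point, and a good
  formula places that box inside V.\<close>

lemma good_sound:
  assumes \<eta>: "\<eta> \<in> good" and e: "over_c e" "sat M e (many_boxes \<eta>)"
  shows "point K m e \<in> V"
proof -
  have \<eta>': "Conj \<eta> (box_fm k m) \<in> formulas L\<beta>" using \<eta> box_fm_formulas by (simp add: good_def)
  obtain e' where e': "range e' \<subseteq> B" "\<forall>i. i \<notin> {k..<K} \<longrightarrow> e' i = e i" "generic k K e'"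
    "sat M e' \<eta>" "sat M e' (box_fm k m)"
    using Infinite_block_elim[OF \<eta>', of e k K] e by (auto simp: many_boxes_def over_c_def)
  then have "over_c e'" using e(1) by (auto simp: over_c_def)
  then have "tau_box M \<tau> m (box_params k m e') \<subseteq> V" using \<eta> e' by (auto simp: good_def)
  then have "point K m e' \<in> V" using e'(5) sat_box_fm[OF e'(1)] by blast
  moreover have "point K m e' = point K m e" using e'(2) by (auto simp: point_def)
  ultimately show ?thesis by simp
qed

text \<open>Another generic tuple over c with the \<open>L\<beta>\<close>-type of e would be related
  to e by \<open>bf\<close>, hence would also have its box in V. So this type, genericity and
  \<open>Neg box_in_V\<close> are jointly unsatisfiable, and the finite part of the type used by
  compactness is the desired \<eta>.\<close>

lemma good_if_type:
  assumes e: "over_c e" "generic k K e" "tau_box M \<tau> m (box_params k m e) \<subseteq> V"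
  obtains \<eta> where "\<eta> \<in> good" "sat M e \<eta>"
proof -
  define q where "q = {\<eta> \<in> formulas L\<beta>. fv \<eta> \<subseteq> {..<K} \<and> sat M e \<eta>}"
  define G where "G = (\<Union>j\<in>{k..<K}. generic_formulas j)"
  let ?sat = "\<lambda>F. \<exists>e'. (\<forall>i. i \<notin> {k..<K} \<longrightarrow> e' i = e i) \<and> range e' \<subseteq> B \<and> (\<forall>\<eta>\<in>F. sat M e' \<eta>)"
  have re: "range e \<subseteq> B" using e(1) by (simp add: over_c_def)
  have "\<not> ?sat (q \<union> G \<union> {Neg box_in_V})"
  proof
    assume "?sat (q \<union> G \<union> {Neg box_in_V})"
    then obtain e' where e': "\<forall>i. i \<notin> {k..<K} \<longrightarrow> e' i = e i" "range e' \<subseteq> B"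
      "\<forall>\<eta>\<in>q. sat M e' \<eta>" "\<forall>\<eta>\<in>G. sat M e' \<eta>" "\<not> sat M e' box_in_V" by auto
    have gen: "generic k K e'"
      unfolding generic_def
      using generic_formulas_suffice[OF e'(2)] e'(4) by (auto simp: G_def)
    have "c ` {..<k} = e ` {..<k}" using e(1) by (intro image_cong) (auto simp: over_c_def)
    then have free: "free_from_A (e ` {..<k})" using c(2) by simp
    have "bf K e e'"
      by (rule bf_generic[OF free _ re e'(2) _ e(2) gen]) (use e' in \<open>auto simp: q_def\<close>)
    then have "sat M (e \<circ> id) box_in_V = sat M (e' \<circ> id) box_in_V"
      using fv_box_in_V by (intro bf_sat[OF box_in_V_formulas]) auto
    then show False using e'(5) sat_box_in_V[OF e(1)] e(3) by simp
  qed
  moreover have "q \<union> G \<union> {Neg box_in_V} \<subseteq> formulas L2"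
    using formulas_beta box_in_V_formulas by (auto simp: q_def G_def generic_formulas_def)
  ultimately obtain F where F: "F \<subseteq> q \<union> G \<union> {Neg box_in_V}" "finite F" "\<not> ?sat F"
    using saturation_tuple[OF finite_atLeastLessThan re, of "q \<union> G \<union> {Neg box_in_V}" k K] by blast
  define \<eta> where "\<eta> = Conj_set (F \<inter> q)"
  have fin: "finite (F \<inter> q)" using F by simp
  have "sat M e \<eta>" unfolding \<eta>_def sat_Conj_set[OF fin] by (auto simp: q_def)
  moreover have "\<eta> \<in> good"
    unfolding good_def
  proof (intro CollectI conjI allI impI)
    show "\<eta> \<in> formulas L\<beta>" unfolding \<eta>_def Conj_set_formulas[OF fin] by (auto simp: q_def)
    show fv\<eta>: "fv \<eta> \<subseteq> {..<K}" unfolding \<eta>_def fv_Conj_set[OF fin] by (auto simp: q_def)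
    fix d assume "over_c d \<and> generic k K d \<and> sat M d \<eta>"
    then have d: "over_c d" "generic k K d" "sat M d \<eta>" by auto
    \<comment> \<open>The inconsistency of F concerns assignments equal to e outside
      \<open>{k..<K}\<close>, so the values of d from K on are reset to those of e. Genericity,
      \<eta> and the box do not see them.\<close>
    define d' where "d' i = (if i < K then d i else e i)" for i
    have d': "\<forall>i. i \<notin> {k..<K} \<longrightarrow> d' i = e i" "range d' \<subseteq> B" "over_c d'"
      using d(1) e(1) by (auto simp: d'_def over_c_def)
    have "generic k K d'" using d(2) by (rule generic_cong) (simp add: d'_def)
    then have "\<forall>\<gamma>\<in>G. sat M d' \<gamma>" using d'(2) by (auto simp: G_def generic_formulas_def generic_def)
    moreover have "sat M d' \<eta> = sat M d \<eta>" by (rule sat_cong) (use fv\<eta> in \<open>auto simp: d'_def\<close>)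
    then have "\<forall>\<gamma>\<in>F \<inter> q. sat M d' \<gamma>" using d(3) unfolding \<eta>_def sat_Conj_set[OF fin] by simp
    moreover have "\<exists>\<gamma>\<in>F. \<not> sat M d' \<gamma>" using F(3) d'(1,2) by blast
    ultimately have "sat M d' box_in_V" using F(1) by auto
    then have "tau_box M \<tau> m (box_params k m d') \<subseteq> V" using sat_box_in_V[OF d'(3)] by simp
    moreover have "box_params k m d' = box_params k m d"
      by (rule box_params_cong) (simp add: d'_def)
    ultimately show "tau_box M \<tau> m (box_params k m d) \<subseteq> V" by simp
  qed
  ultimately show thesis using that by blast
qed

text \<open>The interior assumption on the topology allows box parameters generic over A, c and the
  point itself. Genericity over A makes \<open>good_if_type\<close> applicable, and genericity over
  the point gives the infinite quantifiers.\<close>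

lemma good_complete:
  assumes e: "over_c e" "point K m e \<in> V"
  obtains \<eta> where "\<eta> \<in> good" "sat M e (many_boxes \<eta>)"
proof -
  let ?S = "{d \<in> {..<m} \<times> {..<n} \<rightarrow>\<^sub>E B. point K m e \<in> tau_box M \<tau> m d \<and> tau_box M \<tau> m d \<subseteq> V}"
  let ?X = "product_topology (\<lambda>_. tau_top M n \<tau>) ({..<m} \<times> {..<n})"
  have ne: "?X interior_of ?S \<noteq> {}"
    by (rule topology_M[THEN conjunct2, THEN conjunct2, THEN conjunct2, rule_format])
      (use open_V e(2) in blast)
  have re: "range e \<subseteq> B" using e(1) by (simp add: over_c_def)
  have D: "finite (e ` {K..<K + m})" "e ` {K..<K + m} \<subseteq> B" using re by auto
  obtain e' where e': "range e' \<subseteq> B" "\<And>i. i \<notin> {k..<K} \<Longrightarrow> e' i = e i"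
    "box_params k m e' \<in> ?X interior_of ?S"
    "\<And>j. k \<le> j \<Longrightarrow> j < K \<Longrightarrow> e' j \<notin> cl (AA \<union> (e ` {K..<K + m} \<union> e' ` {..<j}))"
    by (rule generic_box_params[OF openin_interior_of ne re D, where k = k]) blast
  have S: "box_params k m e' \<in> ?S" by (rule subsetD[OF interior_of_subset e'(3)])
  have over: "over_c e'" using e(1) e'(1,2) by (auto simp: over_c_def)
  have sub: "AA \<union> (e ` {K..<K + m} \<union> e' ` {..<j}) \<subseteq> B" for j using AA_subset D e'(1) by auto
  have cl_le: "cl X \<subseteq> cl (AA \<union> (e ` {K..<K + m} \<union> e' ` {..<j}))"
    if "X \<subseteq> AA \<union> (e ` {K..<K + m} \<union> e' ` {..<j})" for X j using that sub by (rule cl_mono)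
  have "generic k K e'"
    unfolding generic_def
  proof (intro allI impI)
    fix j assume "k \<le> j \<and> j < K"
    then show "e' j \<notin> cl (AA \<union> e' ` {..<j})" using e'(4)[of j] cl_le[of "AA \<union> e' ` {..<j}" j] by auto
  qed
  then obtain \<eta> where \<eta>: "\<eta> \<in> good" "sat M e' \<eta>" using good_if_type[OF over] S by blast
  have pt: "point K m e' = point K m e" using e'(2) by (auto simp: point_def)
  then have "sat M e' (box_fm k m)" using S sat_box_fm[OF e'(1)] by simp
  have \<eta>L: "\<eta> \<in> formulas L\<beta>" "fv \<eta> \<subseteq> {..<K}" using \<eta>(1) by (auto simp: good_def)
  have "sat M e' (many_boxes \<eta>)"
    unfolding many_boxes_def
  proof (rule Infinite_block_intro)
    show "Conj \<eta> (box_fm k m) \<in> formulas L\<beta>" using \<eta>L(1) box_fm_formulas by simp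
    show "sat M e' (Conj \<eta> (box_fm k m))" using \<eta>(2) \<open>sat M e' (box_fm k m)\<close> by simp
    fix j assume j: "k \<le> j" "j < K"
    have "fv (Conj \<eta> (box_fm k m)) - {..<K} \<subseteq> {K..<K + m}"
      using \<eta>L(2) fv_box_fm[of k m] by fastforce
    then have "e' ` (fv (Conj \<eta> (box_fm k m)) - {..<K}) \<subseteq> e' ` {K..<K + m}" by (rule image_mono)
    also have "e' ` {K..<K + m} = e ` {K..<K + m}" by (rule image_cong) (use e'(2) in auto)
    finally have "cl (e' ` ({..<j} \<union> (fv (Conj \<eta> (box_fm k m)) - {..<K}))) \<subseteq>
        cl (AA \<union> (e ` {K..<K + m} \<union> e' ` {..<j}))" by (intro cl_le) (simp only: image_Un, blast)
    then show "e' j \<notin> cl (e' ` ({..<j} \<union> (fv (Conj \<eta> (box_fm k m)) - {..<K})))"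
      using e'(4)[OF j] by blast
  qed (use e'(1) in auto)
  moreover have "sat M e' (many_boxes \<eta>) = sat M e (many_boxes \<eta>)"
    by (rule sat_cong) (use many_boxes(2)[OF \<eta>L(1)] e'(2) in auto)
  ultimately show thesis using \<eta>(1) that by blast
qed

text \<open>The set Q says that the point is in V but no good formula accounts for it. It has no
  realization by \<open>good_complete\<close>, so finitely many good formulas already cover V, and
  \<open>good_sound\<close> keeps them inside V.\<close>

lemma definable_beta: "definable_set L\<beta> M m V"
proof -
  define Q where "Q = insert \<phi> ((\<lambda>\<eta>. Neg (many_boxes \<eta>)) ` good)"
  let ?sat = "\<lambda>F. \<exists>e. (\<forall>i. i \<notin> {K..<K + m} \<longrightarrow> e i = c i) \<and> range e \<subseteq> B \<and> (\<forall>\<eta>\<in>F. sat M e \<eta>)"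
  have over: "over_c e" if "\<forall>i. i \<notin> {K..<K + m} \<longrightarrow> e i = c i" "range e \<subseteq> B" for e
    using that by (auto simp: over_c_def)
  have V: "sat M e \<phi> \<longleftrightarrow> point K m e \<in> V" if "over_c e" for e
    using V_def that by (auto simp: over_c_def)
  have "\<not> ?sat Q"
  proof
    assume "?sat Q"
    then obtain e where e: "over_c e" "\<forall>\<eta>\<in>Q. sat M e \<eta>" using over by blast
    then have "point K m e \<in> V" using V by (simp add: Q_def)
    with e(1) obtain \<eta> where "\<eta> \<in> good" "sat M e (many_boxes \<eta>)" by (rule good_complete)
    with e(2) show False by (auto simp: Q_def)
  qed
  moreover have "Q \<subseteq> formulas L2"
    using \<phi>(1) many_boxes(1) formulas_beta by (auto simp: Q_def good_def)
  ultimately obtain F where F: "F \<subseteq> Q" "finite F" "\<not> ?sat F"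
    using saturation_tuple[OF finite_atLeastLessThan c(1), of Q K "K + m"] by blast
  have "F - {\<phi>} \<subseteq> (\<lambda>\<eta>. Neg (many_boxes \<eta>)) ` good" "finite (F - {\<phi>})" using F by (auto simp: Q_def)
  then obtain H where H: "H \<subseteq> good" "finite H" "F - {\<phi>} = (\<lambda>\<eta>. Neg (many_boxes \<eta>)) ` H"
    by (meson finite_subset_image)
  \<comment> \<open>By the description of \<open>H\<close>, this is the disjunction of
    \<open>many_boxes \<eta>\<close> over finitely many good \<eta>.\<close>
  define \<psi> where "\<psi> = Neg (Conj_set (F - {\<phi>}))"
  have fin: "finite (F - {\<phi>})" using F(2) by simp
  have \<psi>: "\<psi> \<in> formulas L\<beta>"
    using fin H many_boxes(1) by (auto simp: \<psi>_def Conj_set_formulas good_def)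
  have sat\<psi>: "sat M e \<psi> \<longleftrightarrow> point K m e \<in> V"
    if e: "\<forall>i. i \<notin> {K..<K + m} \<longrightarrow> e i = c i" "range e \<subseteq> B" for e
  proof
    assume "sat M e \<psi>"
    then have "\<exists>\<eta>\<in>F - {\<phi>}. \<not> sat M e \<eta>" unfolding \<psi>_def sat_Neg sat_Conj_set[OF fin] by blast
    then obtain \<eta> where "\<eta> \<in> H" "sat M e (many_boxes \<eta>)" unfolding H(3) by auto
    then show "point K m e \<in> V" using H(1) good_sound over[OF e] by blast
  next
    assume "point K m e \<in> V"
    then have "sat M e \<phi>" using V over[OF e] by simp
    moreover have "\<exists>\<eta>\<in>F. \<not> sat M e \<eta>" using F(3) e by blast
    ultimately show "sat M e \<psi>" unfolding \<psi>_def sat_Neg sat_Conj_set[OF fin] by auto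
  qed
  let ?e = "\<lambda>x i. if K \<le> i \<and> i < K + m then x (i - K) else c i"
  have "x \<in> V \<longleftrightarrow> sat M (?e x) \<psi>" if x: "x \<in> {..<m} \<rightarrow>\<^sub>E B" for x
  proof -
    have "point K m (?e x) = x"
      using x by (auto simp: point_def fun_eq_iff PiE_iff extensional_def)
    moreover have "range (?e x) \<subseteq> B" using x c(1) by (auto simp: PiE_iff)
    ultimately show ?thesis using sat\<psi>[of "?e x"] by auto
  qed
  then have "V = {x \<in> {..<m} \<rightarrow>\<^sub>E B. sat M (?e x) \<psi>}" using V_subset by blast
  with definable_set_reindex[OF \<psi> c(1), of m K] show ?thesis by simp
qed

end

theorem theorem4p5:
  fixes L\<alpha> L\<beta> :: "('f, 'r) lang" and A :: 'r
    and T\<alpha> T\<beta> T :: "('f, 'r) fm set" and \<tau> :: "('f, 'r) fm" and n m :: nat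
    and M :: "('f, 'r, 'b) struct" and \<kappa> :: "'k rel" and V :: "(nat \<Rightarrow> 'b) set"
  assumes "pair_setting TYPE('b) A L\<alpha> L\<beta> T\<alpha> T\<beta>"
    and "definable_topology TYPE('b) L\<beta> T\<beta> n \<tau>"
    and "mordell_lang_theory TYPE('b) A L\<alpha> L\<beta> T\<alpha> T\<beta> T"
    and "consistent (lang2 A L\<alpha> L\<beta>) T"
    and "models (lang2 A L\<alpha> L\<beta>) M T"
    and "Card_order \<kappa>"
    and "lang_card (lang2 A L\<alpha> L\<beta>) <o \<kappa>"
    and "saturated \<kappa> (lang2 A L\<alpha> L\<beta>) M"
    and "openin (product_topology (\<lambda>_. tau_top M n \<tau>) {..<m}) V"
    and "definable_set (lang2 A L\<alpha> L\<beta>) M m V"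
  shows "definable_set L\<beta> M m V"
proof -
  interpret ml_model L\<alpha> L\<beta> A T\<alpha> T\<beta> T \<tau> n M \<kappa>
    by unfold_locales fact+
  obtain \<phi> e where \<phi>: "\<phi> \<in> formulas L2" and e: "range e \<subseteq> B"
    and V: "V = {x \<in> {..<m} \<rightarrow>\<^sub>E B. sat M (\<lambda>i. if i < m then x i else e i) \<phi>}"
    using assms(10) by (auto simp: definable_set_def)
  have "e ` fv \<phi> \<subseteq> B" "finite (e ` fv \<phi>)" using e by auto
  then obtain C where C: "e ` fv \<phi> \<subseteq> C" "finite C" "C \<subseteq> B" "free_from_A C"
    by (rule extend_to_free)
  obtain xs where xs: "set xs = C" using finite_list[OF C(2)] by blast
  define k where "k = length xs"
  \<comment> \<open>From k on any element of B will do; \<open>e 0\<close> is one.\<close>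
  define c where "c i = (if i < k then xs ! i else e 0)" for i
  have c_im: "c ` {..<k} = C" using xs by (auto simp: c_def k_def in_set_conv_nth image_iff)
  have c: "range c \<subseteq> B" using C(3) e xs by (auto simp: c_def k_def)
  have "\<forall>v\<in>fv \<phi>. \<exists>i<k. c i = e v" using C(1) c_im by (force simp: image_iff)
  then obtain idx where idx: "\<And>v. v \<in> fv \<phi> \<Longrightarrow> idx v < k" "\<And>v. v \<in> fv \<phi> \<Longrightarrow> c (idx v) = e v" by metis
  \<comment> \<open>Object variables go to the block of the point, parameters to a position of c
    that holds their value.\<close>
  define \<sigma> where "\<sigma> v = (if v < m then k + m * n + v else idx v)" for v
  interpret definable_open L\<alpha> L\<beta> A T\<alpha> T\<beta> T \<tau> n M \<kappa> m V "subst \<phi> \<sigma>" c k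
  proof
    show "openin (product_topology (\<lambda>_. tau_top M n \<tau>) {..<m}) V" by fact
    show "subst \<phi> \<sigma> \<in> formulas L2" using \<phi> by simp
    show "fv (subst \<phi> \<sigma>) \<subseteq> {..<k} \<union> {k + m * n..<k + m * n + m}"
      using fv_subst[of \<phi> \<sigma>] idx(1) by (fastforce simp: \<sigma>_def)
    show "range c \<subseteq> B" by (rule c)
    show "free_from_A (c ` {..<k})" using C(4) c_im by simp
    fix d assume d: "range d \<subseteq> B" "\<And>i. i < k \<Longrightarrow> d i = c i"
    have "sat M (d \<circ> \<sigma>) \<phi> = sat M (\<lambda>i. if i < m then point (k + m * n) m d i else e i) \<phi>"
      by (rule sat_cong) (use d(2) idx in \<open>auto simp: \<sigma>_def point_def\<close>)
    moreover have "point (k + m * n) m d \<in> {..<m} \<rightarrow>\<^sub>E B" using d(1) by (auto simp: point_def)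
    ultimately show "sat M d (subst \<phi> \<sigma>) \<longleftrightarrow> point (k + m * n) m d \<in> V"
      by (simp add: sat_subst V)
  qed
  show ?thesis by (rule definable_beta)
qed

end
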